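(* Fix $n\in\mathbb{N}$ and suppose that Assumptions 1–6 listed in the context hold, with constants $\delta,M_2,\hat M_1,\bar\delta,\overline{M}_2,\bar\kappa$. Let $\mathrm{TV}$ denote the total variation distance. Then $$\mathrm{TV}\Big(\mathcal{L}\big(\sqrt{n}(\boldsymbol{\tilde\theta}_n-\bar\theta_n)\big),\ \mathcal{N}(0,\bar J_n(\bar\theta_n)^{-1})\Big)\ \le\ A_1 n^{-1/2}+2\,\bar{\mathscr{D}}+A_2\,n^{d/2}e^{-n\bar\kappa},$$ where $$A_1=\frac{\sqrt{3}\,\mathrm{Tr}\big[\bar J_n(\bar\theta_n)^{-1}\big]\,\overline{M}_2}{4\sqrt{\big(\bar\lambda_{\min}-\bar\delta\,\overline{M}_2\big)\big(1-\bar{\mathscr{D}}\big)}},\qquad A_2=\frac{2\,\big|\det(\hat J^{p})\big|^{1/2}\hat M_1}{(2\pi)^{d/2}\big(1-\hat{\mathscr{D}}^{p}\big)}.$$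
   Context: Setup. Fix $n,d\in\mathbb{N}$. $\pi:\mathbb{R}^d\to\mathbb{R}$ is a Lebesgue probability density (the prior), $L_n:\mathbb{R}^d\to\mathbb{R}$ is a function (the generalized log-likelihood), and $\Pi_n(\theta)=e^{L_n(\theta)}\pi(\theta)/z_n$ is a Lebesgue probability density (the generalized posterior), with $z_n\in(0,\infty)$ the normalizing constant. $\boldsymbol{\tilde\theta}_n$ is a random vector with density $\Pi_n$. Put $\overline{L}_n=\log\Pi_n$, $\hat\theta_n=\arg\max_{\theta\in\mathbb{R}^d}L_n(\theta)$ (MLE) and $\bar\theta_n=\arg\max_{\theta\in\mathbb{R}^d}\overline{L}_n(\theta)$ (MAP). Here $f''$ is the Hessian of $f$, and $f'''(\theta)[u,v,w]=\sum_{i,j,k}\frac{\partial^3 f}{\partial\theta_i\partial\theta_j\partial\theta_k}(\theta)u_iv_jw_k$ with norm $\|f'''(\theta)\|^*=\sup_{\|u\|,\|v\|,\|w\|\le1}|f'''(\theta)[u,v,w]|$; $\|\cdot\|$ is the Euclidean norm. Let $\hat J_n(\theta)=-L_n''(\theta)/n$ and $\bar J_n(\theta)=-\overline{L}_n''(\theta)/n$. $\mathcal{L}(\cdot)$ denotes the law of a random vector, and $\mathrm{TV}(\nu_1,\nu_2)=\sup_A|\nu_1(A)-\nu_2(A)|$ over measurable $A$. Assumptions. 1. There is a unique MLE $\hat\theta_n$. There are $\delta>0$ and $M_2>0$ such that $L_n$ is three times differentiable inside $\{\theta:\|\theta-\hat\theta_n\|\le\delta\}$ and $\sup_{\|\theta-\hat\theta_n\|\le\delta}\|L_n'''(\theta)\|^*/n\le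 M_2$. 2. For the same $\delta$ there is $\hat M_1>0$ with $\sup_{\|\theta-\hat\theta_n\|\le\delta}|1/\pi(\theta)|\le\hat M_1$. 3. There is a unique MAP $\bar\theta_n$. There are $\bar\delta>0$ and $\overline{M}_2>0$ such that $\log\pi$ is three times differentiable inside $\{\theta:\|\theta-\bar\theta_n\|\le\bar\delta\}$ and $\sup_{\|\theta-\bar\theta_n\|\le\bar\delta}\|\overline{L}_n'''(\theta)\|^*/n\le\overline{M}_2$ (existence of the derivatives of $\overline{L}_n$ on this ball being part of the condition). 4. For the same $\delta,\bar\delta$: $\max\Big\{\|\hat\theta_n-\bar\theta_n\|,\sqrt{\mathrm{Tr}[\bar J_n(\bar\theta_n)^{-1}]/n}\Big\}<\bar\delta$ and $\sqrt{\mathrm{Tr}\big[(\hat J_n(\hat\theta_n)+\tfrac{\delta M_2}{3}I_{d\times d})^{-1}\big]/n}<\delta$. 5. $\bar\lambda_{\min}>\bar\delta\,\overline{M}_2$, where $\bar\lambda_{\min}$ is the minimal eigenvalue of $\bar J_n(\bar\theta_n)$. 6. For the same $\bar\delta$ there is $\bar\kappa>0$ with $\sup_{\theta:\|\theta-\hat\theta_n\|>\bar\delta-\|\hat\theta_n-\bar\theta_n\|}\frac{L_n(\theta)-L_n(\hat\theta_n)}{n}\le-\bar\kappa$. Notation. $\hat J^{p}=\hat J_n(\hat\theta_n)+\frac{\delta M_2}{3}I_{d\times d}$, with minimal eigenvalue $\hat\lambda^{p}_{\min}$; $$\bar{\mathscr{D}}=\exp\Big[-\tfrac12\Big(\bar\delta\sqrt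 n-\sqrt{\mathrm{Tr}[\bar J_n(\bar\theta_n)^{-1}]}\Big)^2\bar\lambda_{\min}\Big],\qquad \hat{\mathscr{D}}^{p}=\exp\Big[-\tfrac12\Big(\delta\sqrt n-\sqrt{\mathrm{Tr}[(\hat J^{p})^{-1}]}\Big)^2\hat\lambda^{p}_{\min}\Big].$$ *)

theory Defs
  imports "HOL-Probability.Probability"
begin

definition partial_deriv :: "'d::finite \<Rightarrow> (real^'d \<Rightarrow> real) \<Rightarrow> real^'d \<Rightarrow> real" where
  "partial_deriv i f x = deriv (\<lambda>t. f (x + t *\<^sub>R axis i 1)) 0"

definition hessian :: "(real^'d::finite \<Rightarrow> real) \<Rightarrow> real^'d \<Rightarrow> real^'d^'d" where
  "hessian f x = (\<chi> i j. partial_deriv i (partial_deriv j f) x)"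

definition third_deriv ::
  "(real^'d::finite \<Rightarrow> real) \<Rightarrow> real^'d \<Rightarrow> real^'d \<Rightarrow> real^'d \<Rightarrow> real^'d \<Rightarrow> real" where
  "third_deriv f x u v w =
     (\<Sum>i\<in>UNIV. \<Sum>j\<in>UNIV. \<Sum>k\<in>UNIV.
        partial_deriv i (partial_deriv j (partial_deriv k f)) x * u $ i * v $ j * w $ k)"

definition norm_third_deriv :: "(real^'d::finite \<Rightarrow> real) \<Rightarrow> real^'d \<Rightarrow> real" where
  "norm_third_deriv f x =
     (SUP (u, v, w) \<in> cball 0 1 \<times> cball 0 1 \<times> cball 0 1. \<bar>third_deriv f x u v w\<bar>)"

(* Total (Frechet) differentiability of order three at a point; a function into a
   finite-dimensional space is differentiable iff its components are, so the second and
   third order conditions are stated for the partial derivatives. *)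
definition thrice_differentiable_at :: "(real^'d::finite \<Rightarrow> real) \<Rightarrow> real^'d \<Rightarrow> bool" where
  "thrice_differentiable_at f x \<longleftrightarrow>
     (\<forall>\<^sub>F y in nhds x. f differentiable (at y)) \<and>
     (\<forall>i. \<forall>\<^sub>F y in nhds x. partial_deriv i f differentiable (at y)) \<and>
     (\<forall>i j. partial_deriv i (partial_deriv j f) differentiable (at x))"

(* Only used for symmetric matrices, where the set of real eigenvalues is nonempty
   (it is finite for every matrix). *)
definition min_eigenvalue :: "real^'d::finite^'d \<Rightarrow> real" where
  "min_eigenvalue A = Min {l. \<exists>v. v \<noteq> 0 \<and> A *v v = l *\<^sub>R v}"

definition is_unique_arg_max :: "('a \<Rightarrow> 'b::ord) \<Rightarrow> 'a \<Rightarrow> bool" where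
  "is_unique_arg_max f x \<longleftrightarrow>
     is_arg_max f (\<lambda>_. True) x \<and> (\<forall>y. is_arg_max f (\<lambda>_. True) y \<longrightarrow> y = x)"

(* Logarithm of a nonnegative real with log 0 = -infinity. The library has ln 0 = 0, so
   maximising ln of a density that vanishes somewhere would give a wrong maximiser. *)
definition log_ext :: "real \<Rightarrow> ereal" where
  "log_ext x = (if 0 < x then ereal (ln x) else - \<infinity>)"

definition prob_density :: "(real^'d::finite \<Rightarrow> real) \<Rightarrow> bool" where
  "prob_density f \<longleftrightarrow>
     f \<in> borel_measurable borel \<and> (\<forall>x. 0 \<le> f x) \<and> prob_space (density lborel (\<lambda>x. ennreal (f x)))"

definition multivariate_normal :: "real^'d::finite \<Rightarrow> real^'d^'d \<Rightarrow> (real^'d) measure" where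
  "multivariate_normal m S = density lborel (\<lambda>x. ennreal
     (exp (- ((x - m) \<bullet> (matrix_inv S *v (x - m))) / 2) / sqrt ((2 * pi) ^ CARD('d) * det S)))"

definition total_variation :: "'a measure \<Rightarrow> 'a measure \<Rightarrow> real" where
  "total_variation M N = (SUP A \<in> sets M. \<bar>measure M A - measure N A\<bar>)"

definition posterior ::
  "(real^'d::finite \<Rightarrow> real) \<Rightarrow> (real^'d \<Rightarrow> real) \<Rightarrow> real \<Rightarrow> real^'d \<Rightarrow> real" where
  "posterior L \<pi> z \<theta> = exp (L \<theta>) * \<pi> \<theta> / z"

definition observed_information :: "nat \<Rightarrow> (real^'d::finite \<Rightarrow> real) \<Rightarrow> real^'d \<Rightarrow> real^'d^'d" where
  "observed_information n f \<theta> = - (1 / real n) *\<^sub>R hessian f \<theta>"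

definition gauss_tail :: "nat \<Rightarrow> real \<Rightarrow> real^'d::finite^'d \<Rightarrow> real" where
  "gauss_tail n r J =
     exp (- (1 / 2) * (r * sqrt (real n) - sqrt (trace (matrix_inv J)))\<^sup>2 * min_eigenvalue J)"

end

theory Submission
  imports Defs
begin

text \<open>
  Rescale by \<open>\<surd>n\<close> around the MAP and let \<open>B\<close> be the ball of radius \<open>\<delta>bar * \<surd>n\<close>.
  Conditioning a probability measure on \<open>B\<close> changes it in total variation by at most its mass
  outside \<open>B\<close>, so the distance splits into the distance of the two conditioned laws, the Gaussian
  mass outside \<open>B\<close> and the posterior mass outside \<open>B\<close>.

  \<^bold>\<open>Inside the ball.\<close> By the bound on the third derivative and the gap between \<open>lam_bar\<close> and
  \<open>\<delta>bar * M2_bar\<close>, the posterior restricted to \<open>B\<close> is strongly log-concave with constant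
  \<open>lam_bar - \<delta>bar * M2_bar\<close>, and the logarithm of the density ratio between the Gaussian and the
  posterior has gradient at most \<open>M2_bar / (2 * \<surd>n) * |x|^2\<close>. A logarithmic Sobolev inequality
  bounds the relative entropy by the mean square of this gradient under the conditioned Gaussian,
  and Pinsker's inequality turns that into a bound on total variation. The fourth moment of the
  Gaussian is at most three times the squared trace of the covariance, which produces the first
  term with its exact constant. The logarithmic Sobolev inequality on the ball is obtained as Bobkov
  and Ledoux did, by letting the weight of one argument of the Prekopa-Leindler inequality tend
  to zero; on a ball, this argument produces no boundary terms. These steps are
  \<open>prekopa_leindler\<close>, \<open>prekopa_leindler_perturbed_density\<close>,
  \<open>relative_entropy_le_of_exponential_bound\<close> and \<open>pinsker_event\<close>; their combination is
  \<open>tv_le_of_strongly_log_concave\<close>.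

  \<^bold>\<open>Outside the ball.\<close> The Gaussian tail is a Chernoff bound after diagonalizing the
  covariance (\<open>nn_integral_diagonal_gaussian_tail\<close>). The posterior tail compares two estimates
  of the same density: away from the MLE the likelihood is smaller than its maximum by the factor
  \<open>exp (- n * \<kappa>bar)\<close>, while near the MLE a Taylor bound keeps it above a multiple of
  a Gaussian with precision matrix \<open>n * Jp\<close>, which gives a lower bound for the normalizing
  constant (\<open>posterior_tail_le\<close>).
\<close>

section \<open>The Prekopa-Leindler inequality\<close>

text \<open>Slide \<open>A\<close> by the least point of \<open>B\<close> and \<open>B\<close> by the greatest point of \<open>A\<close>: both copies
  lie in the sum set and they meet in one point only.\<close>

lemma brunn_minkowski_line_compact:
  fixes A B :: "real set"
  assumes "compact A" "compact B" "A \<noteq> {}" "B \<noteq> {}"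
  shows "measure lebesgue A + measure lebesgue B \<le> measure lebesgue {x + y |x y. x \<in> A \<and> y \<in> B}"
proof -
  let ?S = "{x + y |x y. x \<in> A \<and> y \<in> B}"
  obtain a where a: "a \<in> A" "\<And>x. x \<in> A \<Longrightarrow> x \<le> a"
    using compact_attains_sup[OF assms(1,3)] by blast
  obtain b where b: "b \<in> B" "\<And>x. x \<in> B \<Longrightarrow> b \<le> x"
    using compact_attains_inf[OF assms(2,4)] by blast
  let ?A = "(+) b ` A" and ?B = "(+) a ` B"
  have mA: "?A \<in> lmeasurable" and mB: "?B \<in> lmeasurable"
    using assms by (auto intro!: lmeasurable_compact compact_translation)
  have "?A \<inter> ?B \<subseteq> {a + b}"
  proof
    fix z assume "z \<in> ?A \<inter> ?B"
    then obtain x y where "x \<in> A" "y \<in> B" "z = b + x" "z = a + y" by auto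
    then show "z \<in> {a + b}" using a(2)[of x] b(2)[of y] by auto
  qed
  then have "negligible (?A \<inter> ?B)" by (rule negligible_subset[rotated]) simp
  then have "measure lebesgue (?A \<union> ?B) = measure lebesgue ?A + measure lebesgue ?B"
    using mA mB by (simp add: measure_Un3 negligible_imp_measure0)
  also have "\<dots> = measure lebesgue A + measure lebesgue B"
    by (simp add: measure_translation)
  finally have "measure lebesgue A + measure lebesgue B = measure lebesgue (?A \<union> ?B)" by simp
  also have "\<dots> \<le> measure lebesgue ?S"
  proof (rule measure_mono_fmeasurable)
    show "?A \<union> ?B \<subseteq> ?S"
    proof (intro Un_least image_subsetI)
      show "b + x \<in> ?S" if "x \<in> A" for x
        using that b(1) by (intro CollectI exI[of _ x] exI[of _ b]) simp
      show "a + y \<in> ?S" if "y \<in> B" for y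
        using that a(1) by (intro CollectI exI[of _ a] exI[of _ y]) simp
    qed
    show "?A \<union> ?B \<in> sets lebesgue" using mA mB by (auto simp: fmeasurable_def)
    show "?S \<in> lmeasurable" using assms by (intro lmeasurable_compact compact_sums)
  qed
  finally show ?thesis .
qed

text \<open>Inner regularity with a non-empty compact set: a sum set with an empty summand is empty,
  so an empty approximant would be useless below.\<close>

lemma bounded_borel_inner_compact:
  fixes S :: "real set"
  assumes "S \<in> sets borel" "bounded S" "S \<noteq> {}" "e > 0"
  obtains K where "compact K" "K \<noteq> {}" "K \<subseteq> S" "measure lebesgue S \<le> measure lebesgue K + e"
proof -
  have S: "S \<in> sets lebesgue" "S \<in> lmeasurable"
    using assms sets_completionI_sets[of S lborel] by (auto intro: bounded_set_imp_lmeasurable)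
  obtain T where T: "closed T" "T \<subseteq> S" "S - T \<in> lmeasurable" "emeasure lebesgue (S - T) < ennreal e"
    using sets_lebesgue_inner_closed[OF S(1) assms(4)] by blast
  obtain x where x: "x \<in> S" using assms by auto
  let ?K = "insert x T"
  have "bounded T" using T(2) assms(2) by (rule bounded_subset[rotated])
  then have K: "compact ?K" using T(1) by (intro compact_insert) (simp add: compact_eq_bounded_closed)
  have K_leb: "?K \<in> sets lebesgue" using K by (intro fmeasurableD lmeasurable_compact)
  have "S = ?K \<union> (S - ?K)" using T x by auto
  then have "measure lebesgue S \<le> measure lebesgue ?K + measure lebesgue (S - ?K)"
    using measure_Un_le[of ?K lebesgue "S - ?K"] K_leb S(1) by auto
  moreover have "measure lebesgue (S - ?K) \<le> measure lebesgue (S - T)"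
    using T(3) S(1) K_leb by (intro measure_mono_fmeasurable) auto
  moreover have "measure lebesgue (S - T) < e"
    using T(3,4) by (simp add: emeasure_eq_measure2 ennreal_less_iff)
  ultimately have "measure lebesgue S \<le> measure lebesgue ?K + e" by linarith
  then show thesis using T(2) x K by (intro that[of ?K]) auto
qed

text \<open>The set \<open>C\<close> stands for the Minkowski combination, which need not be Borel when \<open>A\<close> and \<open>B\<close>
  are.\<close>

lemma brunn_minkowski_line:
  fixes A B C :: "real set"
  assumes A: "A \<in> sets borel" "bounded A" "A \<noteq> {}" and B: "B \<in> sets borel" "bounded B" "B \<noteq> {}"
    and t: "0 < t" "t < 1" and C: "C \<in> sets borel"
    and ABC: "\<And>x y. x \<in> A \<Longrightarrow> y \<in> B \<Longrightarrow> (1 - t) * x + t * y \<in> C"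
  shows "ennreal (1 - t) * emeasure lborel A + ennreal t * emeasure lborel B \<le> emeasure lborel C"
proof (cases "emeasure lborel C = \<infinity>")
  case False
  have fin: "C \<in> lmeasurable" "A \<in> lmeasurable" "B \<in> lmeasurable"
  proof -
    show "C \<in> lmeasurable" using False C by (simp add: fmeasurable_def top.not_eq_extremum)
    show "A \<in> lmeasurable" using A sets_completionI_sets[of A lborel] by (simp add: bounded_set_imp_lmeasurable)
    show "B \<in> lmeasurable" using B sets_completionI_sets[of B lborel] by (simp add: bounded_set_imp_lmeasurable)
  qed
  have "(1 - t) * measure lebesgue A + t * measure lebesgue B \<le> measure lebesgue C + e" if e: "e > 0" for e
  proof -
    obtain K where K: "compact K" "K \<noteq> {}" "K \<subseteq> A" "measure lebesgue A \<le> measure lebesgue K + e"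
      using bounded_borel_inner_compact[OF A e] by blast
    obtain K' where K': "compact K'" "K' \<noteq> {}" "K' \<subseteq> B" "measure lebesgue B \<le> measure lebesgue K' + e"
      using bounded_borel_inner_compact[OF B e] by blast
    have "(1 - t) * measure lebesgue K + t * measure lebesgue K' =
      measure lebesgue ((*) (1 - t) ` K) + measure lebesgue ((*) t ` K')"
      using measure_lebesgue_affine[of "1-t" 0 K] measure_lebesgue_affine[of "t" 0 K'] t by simp
    also have "\<dots> \<le> measure lebesgue {x + y |x y. x \<in> ((*) (1 - t) ` K) \<and> y \<in> ((*) t ` K')}"
      using K K' by (intro brunn_minkowski_line_compact) (auto intro!: compact_continuous_image continuous_intros)
    also have "\<dots> \<le> measure lebesgue C"
    proof (rule measure_mono_fmeasurable)
      show "{x + y |x y. x \<in> ((*) (1 - t) ` K) \<and> y \<in> ((*) t ` K')} \<subseteq> C"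
        using K(3) K'(3) ABC by auto
      show "{x + y |x y. x \<in> ((*) (1 - t) ` K) \<and> y \<in> ((*) t ` K')} \<in> sets lebesgue"
        using K K' by (intro fmeasurableD lmeasurable_compact compact_sums) (auto intro!: compact_continuous_image continuous_intros)
    qed fact
    finally have 1: "(1 - t) * measure lebesgue K + t * measure lebesgue K' \<le> measure lebesgue C" .
    have "(1 - t) * measure lebesgue A + t * measure lebesgue B \<le> (1-t) * (measure lebesgue K + e) + t * (measure lebesgue K' + e)"
      using t K K' by (intro add_mono mult_left_mono) auto
    then show ?thesis using 1 by (simp add: algebra_simps)
  qed
  then have "(1 - t) * measure lebesgue A + t * measure lebesgue B \<le> measure lebesgue C"
    by (rule field_le_epsilon)
  moreover have "emeasure lborel S = ennreal (measure lebesgue S)" if "S \<in> lmeasurable" "S \<in> sets borel" for S :: "real set"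
    using that emeasure_eq_measure2[of S lebesgue] by (simp add: fmeasurable_def)
  ultimately show ?thesis using t fin A B C
    by (simp add: ennreal_mult[symmetric] ennreal_plus[symmetric] del: ennreal_plus)
qed simp

lemma nn_integral_level_sets:
  fixes f :: "real \<Rightarrow> real"
  assumes f[measurable]: "f \<in> borel_measurable borel"
  shows "(\<integral>\<^sup>+x. ennreal (f x) \<partial>lborel) = (\<integral>\<^sup>+s\<in>{0<..}. emeasure lborel {x. s < f x} \<partial>lborel)"
proof -
  define I :: "real \<Rightarrow> real \<Rightarrow> ennreal" where "I x s = (if 0 < s \<and> s < f x then 1 else 0)" for x s
  have I: "(\<lambda>p. I (snd p) (fst p)) \<in> borel_measurable (lborel \<Otimes>\<^sub>M lborel)"
    unfolding I_def by measurable
  have "(\<integral>\<^sup>+x. ennreal (f x) \<partial>lborel) = (\<integral>\<^sup>+x. (\<integral>\<^sup>+s. I x s \<partial>lborel) \<partial>lborel)"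
  proof (rule nn_integral_cong)
    fix x
    have "(\<integral>\<^sup>+s. I x s \<partial>lborel) = (\<integral>\<^sup>+s. indicator {0<..<f x} s \<partial>lborel)"
      by (rule nn_integral_cong) (simp add: I_def indicator_def)
    also have "\<dots> = emeasure lborel {0<..<f x}" by simp
    also have "\<dots> = ennreal (f x)"
      by (cases "0 \<le> f x") (simp_all add: ennreal_neg)
    finally show "ennreal (f x) = (\<integral>\<^sup>+s. I x s \<partial>lborel)" ..
  qed
  also have "\<dots> = (\<integral>\<^sup>+s. (\<integral>\<^sup>+x. I x s \<partial>lborel) \<partial>lborel)"
    by (rule lborel_pair.Fubini') (use I in \<open>simp add: split_beta'\<close>)
  also have "\<dots> = (\<integral>\<^sup>+s\<in>{0<..}. emeasure lborel {x. s < f x} \<partial>lborel)"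
  proof (rule nn_integral_cong)
    fix s
    have "(\<integral>\<^sup>+x. I x s \<partial>lborel) = (\<integral>\<^sup>+x. indicator {x. s < f x} x * indicator {0<..} s \<partial>lborel)"
      by (rule nn_integral_cong) (auto simp: I_def indicator_def)
    also have "\<dots> = (\<integral>\<^sup>+x. indicator {x. s < f x} x \<partial>lborel) * indicator {0<..} s"
      by (rule nn_integral_multc) measurable
    finally show "(\<integral>\<^sup>+x. I x s \<partial>lborel) = emeasure lborel {x. s < f x} * indicator {0<..} s"
      by (subst (asm) nn_integral_indicator) auto
  qed
  finally show ?thesis .
qed

text \<open>When both functions have supremum 1, their superlevel sets are non-empty for exactly the same
  levels, so the Brunn-Minkowski inequality applies level by level. This yields the arithmetic mean of
  the integrals, which is more than the geometric mean of the general inequality.\<close>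

lemma prekopa_leindler_line_normalized:
  fixes f g h :: "real \<Rightarrow> real"
  assumes [measurable]: "f \<in> borel_measurable borel" "g \<in> borel_measurable borel" "h \<in> borel_measurable borel"
    and supp: "\<And>x. f x > 0 \<Longrightarrow> \<bar>x\<bar> \<le> R" "\<And>x. g x > 0 \<Longrightarrow> \<bar>x\<bar> \<le> R"
    and le1: "\<And>x. f x \<le> 1" "\<And>x. g x \<le> 1"
    and sup: "\<And>s. s < 1 \<Longrightarrow> \<exists>x. s < f x" "\<And>s. s < 1 \<Longrightarrow> \<exists>x. s < g x"
    and t: "0 < t" "t < 1"
    and fgh: "\<And>x y s. 0 < s \<Longrightarrow> s < f x \<Longrightarrow> s < g y \<Longrightarrow> s < h ((1 - t) * x + t * y)"
  shows "ennreal (1 - t) * (\<integral>\<^sup>+x. ennreal (f x) \<partial>lborel) + ennreal t * (\<integral>\<^sup>+x. ennreal (g x) \<partial>lborel)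
    \<le> (\<integral>\<^sup>+x. ennreal (h x) \<partial>lborel)"
proof -
  have meas: "(\<lambda>s. emeasure lborel {x. s < F x}) \<in> borel_measurable borel"
    if F[measurable]: "F \<in> borel_measurable borel" for F :: "real \<Rightarrow> real"
  proof -
    have "{p. fst p < F (snd p)} = {p \<in> space (borel \<Otimes>\<^sub>M lborel). fst p < F (snd p)}"
      by (simp add: space_pair_measure)
    also have "\<dots> \<in> sets (borel \<Otimes>\<^sub>M lborel)" by measurable
    finally show ?thesis
      using lborel.measurable_emeasure_Pair[of "{p. fst p < F (snd p)}" borel] by (simp add: vimage_def)
  qed
  note [measurable] = meas[OF assms(1)] meas[OF assms(2)] meas[OF assms(3)]
  have "ennreal (1 - t) * (\<integral>\<^sup>+x. ennreal (f x) \<partial>lborel) + ennreal t * (\<integral>\<^sup>+x. ennreal (g x) \<partial>lborel)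
     = (\<integral>\<^sup>+s. ennreal (1 - t) * (emeasure lborel {x. s < f x} * indicator {0<..} s) +
           ennreal t * (emeasure lborel {x. s < g x} * indicator {0<..} s) \<partial>lborel)"
    by (subst nn_integral_add, measurable, subst (1 2) nn_integral_cmult, measurable)
      (simp only: nn_integral_level_sets assms(1,2))
  also have "\<dots> \<le> (\<integral>\<^sup>+s. emeasure lborel {x. s < h x} * indicator {0<..} s \<partial>lborel)"
  proof (rule nn_integral_mono)
    fix s :: real
    show "ennreal (1 - t) * (emeasure lborel {x. s < f x} * indicator {0<..} s) +
           ennreal t * (emeasure lborel {x. s < g x} * indicator {0<..} s)
         \<le> emeasure lborel {x. s < h x} * indicator {0<..} s"
    proof (cases "0 < s \<and> s < 1")
      case True
      have "bounded {x. s < f x}" "bounded {x. s < g x}"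
        using supp True by (auto simp: bounded_real intro!: exI[of _ R])
      moreover have "{x. s < f x} \<noteq> {}" "{x. s < g x} \<noteq> {}" using sup[of s] True by auto
      ultimately have "ennreal (1 - t) * emeasure lborel {x. s < f x} + ennreal t * emeasure lborel {x. s < g x}
          \<le> emeasure lborel {x. s < h x}"
        using t fgh True by (intro brunn_minkowski_line) auto
      then show ?thesis using True by simp
    next
      case False
      then have "s \<le> 0 \<or> (s > 0 \<and> {x. s < f x} = {} \<and> {x. s < g x} = {})"
        using le1 order.strict_trans2[of s "f _" 1] order.strict_trans2[of s "g _" 1] by auto
      then show ?thesis by auto
    qed
  qed
  also have "\<dots> = (\<integral>\<^sup>+x. ennreal (h x) \<partial>lborel)"
    by (simp only: nn_integral_level_sets assms(3))
  finally show ?thesis .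
qed

lemma powr_weighted_mean_gt:
  fixes s a b t :: real
  assumes "0 < s" "s < a" "s < b" "0 < t" "t < 1"
  shows "s < a powr (1 - t) * b powr t"
proof -
  have "s = s powr (1 - t) * s powr t"
    using assms by (simp flip: powr_add)
  also have "\<dots> < a powr (1 - t) * b powr t"
    using assms by (intro mult_strict_mono powr_less_mono2) auto
  finally show ?thesis .
qed

lemma weighted_geometric_mean_le_arithmetic_mean:
  fixes x y t :: real
  assumes "0 \<le> x" "0 \<le> y" "0 < t" "t < 1"
  shows "x powr (1 - t) * y powr t \<le> (1 - t) * x + t * y"
proof (cases "x = 0 \<or> y = 0")
  case True
  then show ?thesis using assms by auto
next
  case False
  then show ?thesis using assms by (intro Youngs_inequality_0) auto
qed

text \<open>Dividing by the suprema reduces to the normalized case; the weighted inequality between the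
  geometric and the arithmetic mean restores the factors.\<close>

lemma prekopa_leindler_line:
  fixes f g h :: "real \<Rightarrow> real"
  assumes meas[measurable]: "f \<in> borel_measurable borel" "g \<in> borel_measurable borel"
    and int: "integrable lborel f" "integrable lborel g" "integrable lborel h"
    and nonneg: "\<And>x. 0 \<le> f x" "\<And>x. 0 \<le> g x" "\<And>x. 0 \<le> h x"
    and bounded: "\<And>x. f x \<le> M" "\<And>x. g x \<le> M"
    and supp: "\<And>x. f x \<noteq> 0 \<Longrightarrow> \<bar>x\<bar> \<le> R" "\<And>x. g x \<noteq> 0 \<Longrightarrow> \<bar>x\<bar> \<le> R"
    and t: "0 < t" "t < 1"
    and fgh: "\<And>x y. f x powr (1 - t) * g y powr t \<le> h ((1 - t) * x + t * y)"
  shows "integral\<^sup>L lborel f powr (1 - t) * integral\<^sup>L lborel g powr t \<le> integral\<^sup>L lborel h"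
proof -
  have [measurable]: "h \<in> borel_measurable borel" using int(3) by (simp add: integrable_iff_bounded)
  define a where "a = Sup (range f)"
  define b where "b = Sup (range g)"
  have bdd: "bdd_above (range f)" "bdd_above (range g)" using bounded by (auto intro!: bdd_aboveI)
  have le: "f x \<le> a" "g x \<le> b" for x
    unfolding a_def b_def using bdd by (auto intro: cSUP_upper)
  show ?thesis
  proof (cases "a \<le> 0 \<or> b \<le> 0")
    case True
    then have "f = (\<lambda>_. 0) \<or> g = (\<lambda>_. 0)"
      using le nonneg by (metis (full_types, opaque_lifting) order.antisym order.trans)
    then show ?thesis using nonneg by (auto intro!: Bochner_Integration.integral_nonneg)
  next
    case False
    then have ab: "a > 0" "b > 0" by auto
    define c where "c = a powr (1 - t) * b powr t"
    have c: "c > 0" using ab by (simp add: c_def)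
    have sup: "\<exists>x. s < f x / a" "\<exists>x. s < g x / b" if "s < 1" for s
    proof -
      have "s * a < Sup (range f)" "s * b < Sup (range g)" using that ab by (auto simp: a_def b_def)
      then obtain x y where "s * a < f x" "s * b < g y"
        using less_cSUP_iff[OF _ bdd(1)] less_cSUP_iff[OF _ bdd(2)] by auto
      then show "\<exists>x. s < f x / a" "\<exists>x. s < g x / b" using ab by (auto simp: pos_less_divide_eq)
    qed
    have "ennreal (1 - t) * (\<integral>\<^sup>+x. ennreal (f x / a) \<partial>lborel) + ennreal t * (\<integral>\<^sup>+x. ennreal (g x / b) \<partial>lborel)
      \<le> (\<integral>\<^sup>+x. ennreal (h x / c) \<partial>lborel)"
    proof (rule prekopa_leindler_line_normalized[where R=R])
      fix x y s :: real assume s: "0 < s" "s < f x / a" "s < g y / b"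
      then have "s < (f x / a) powr (1 - t) * (g y / b) powr t"
        using t by (intro powr_weighted_mean_gt)
      also have "\<dots> = f x powr (1 - t) * g y powr t / c"
        using ab nonneg by (simp add: powr_divide c_def)
      also have "\<dots> \<le> h ((1 - t) * x + t * y) / c"
        using c fgh by (intro divide_right_mono) auto
      finally show "s < h ((1 - t) * x + t * y) / c" .
    qed (use le ab supp t sup in \<open>auto simp: zero_less_divide_iff dest!: less_imp_neq[symmetric]\<close>)
    then have "ennreal ((1 - t) * (integral\<^sup>L lborel f / a) + t * (integral\<^sup>L lborel g / b)) \<le> ennreal (integral\<^sup>L lborel h / c)"
      using int nonneg ab c t
      by (simp add: nn_integral_eq_integral ennreal_mult[symmetric] ennreal_plus[symmetric] integral_nonneg_AE del: ennreal_plus)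
    then have "(1 - t) * (integral\<^sup>L lborel f / a) + t * (integral\<^sup>L lborel g / b) \<le> integral\<^sup>L lborel h / c"
      using nonneg c by (subst (asm) ennreal_le_iff) (auto intro!: divide_nonneg_pos Bochner_Integration.integral_nonneg)
    moreover have "(integral\<^sup>L lborel f / a) powr (1 - t) * (integral\<^sup>L lborel g / b) powr t \<le>
      (1 - t) * (integral\<^sup>L lborel f / a) + t * (integral\<^sup>L lborel g / b)"
      using t ab nonneg by (intro weighted_geometric_mean_le_arithmetic_mean) (auto intro!: divide_nonneg_pos Bochner_Integration.integral_nonneg)
    moreover have "(integral\<^sup>L lborel f / a) powr (1 - t) * (integral\<^sup>L lborel g / b) powr t
      = integral\<^sup>L lborel f powr (1 - t) * integral\<^sup>L lborel g powr t / c"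
      using ab nonneg by (simp add: powr_divide c_def Bochner_Integration.integral_nonneg)
    ultimately have "integral\<^sup>L lborel f powr (1 - t) * integral\<^sup>L lborel g powr t / c \<le> integral\<^sup>L lborel h / c"
      by linarith
    then show ?thesis using c by (simp add: divide_le_cancel)
  qed
qed

abbreviation lebesgue_PiM :: "'i set \<Rightarrow> ('i \<Rightarrow> real) measure" where
  "lebesgue_PiM I \<equiv> Pi\<^sub>M I (\<lambda>_. lborel)"

lemma integrable_PiM_lborel_bounded_support:
  fixes f :: "('i \<Rightarrow> real) \<Rightarrow> real"
  assumes I: "finite I" and f[measurable]: "f \<in> borel_measurable (lebesgue_PiM I)"
    and bnd: "\<And>x. 0 \<le> f x" "\<And>x. f x \<le> M" and supp: "\<And>x. f x \<noteq> 0 \<Longrightarrow> (\<forall>i\<in>I. \<bar>x i\<bar> \<le> R)"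
  shows "integrable (lebesgue_PiM I) f"
proof (rule integrableI_bounded_set)
  interpret finite_product_sigma_finite "\<lambda>_. lborel :: real measure" I by standard (rule I)
  let ?A = "PiE I (\<lambda>_. {- R..R})"
  show "?A \<in> sets (lebesgue_PiM I)" using I by (intro sets_PiM_I_finite) auto
  have "emeasure (lebesgue_PiM I) ?A = (\<Prod>i\<in>I. emeasure lborel {- R..R})"
    by (intro emeasure_PiM I) auto
  also have "\<dots> < \<infinity>" by (cases "-R \<le> R") (auto simp: less_top[symmetric] power_eq_top_ennreal)
  finally show "emeasure (lebesgue_PiM I) ?A < \<infinity>" .
  show "AE x in lebesgue_PiM I. x \<in> ?A \<longrightarrow> norm (f x) \<le> M" using bnd by simp
  show "AE x in lebesgue_PiM I. x \<notin> ?A \<longrightarrow> f x = 0"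
  proof (rule AE_I2, rule impI)
    fix x assume "x \<in> space (lebesgue_PiM I)" "x \<notin> ?A"
    then obtain i where "i \<in> I" "x i \<notin> {- R..R}" by (auto simp: space_PiM PiE_iff)
    then have "\<not> \<bar>x i\<bar> \<le> R" by (auto simp: abs_le_iff)
    with \<open>i \<in> I\<close> have "\<not> (\<forall>i\<in>I. \<bar>x i\<bar> \<le> R)" by blast
    then show "f x = 0" using supp by blast
  qed
qed (rule f)

text \<open>Induction on the set of coordinates. Integrating out one coordinate preserves the hypothesis:
  on each fibre this is the one-dimensional inequality. The functions are bounded with bounded support
  so that the marginals again have both properties and all integrals are finite.\<close>

lemma prekopa_leindler_PiM:
  fixes f g h :: "('i \<Rightarrow> real) \<Rightarrow> real"
  assumes "finite I" and t: "0 < t" "t < 1" and R: "0 \<le> R"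
    and "f \<in> borel_measurable (lebesgue_PiM I)" "g \<in> borel_measurable (lebesgue_PiM I)" "h \<in> borel_measurable (lebesgue_PiM I)"
    and "\<And>x. 0 \<le> f x" "\<And>x. 0 \<le> g x" "\<And>x. 0 \<le> h x"
    and "\<And>x. f x \<le> M" "\<And>x. g x \<le> M" "\<And>x. h x \<le> M"
    and "\<And>x. f x \<noteq> 0 \<Longrightarrow> (\<forall>i\<in>I. \<bar>x i\<bar> \<le> R)" "\<And>x. g x \<noteq> 0 \<Longrightarrow> (\<forall>i\<in>I. \<bar>x i\<bar> \<le> R)" "\<And>x. h x \<noteq> 0 \<Longrightarrow> (\<forall>i\<in>I. \<bar>x i\<bar> \<le> R)"
    and "\<And>x y. x \<in> space (lebesgue_PiM I) \<Longrightarrow> y \<in> space (lebesgue_PiM I) \<Longrightarrow>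
      f x powr (1 - t) * g y powr t \<le> h (\<lambda>i. (1 - t) * x i + t * y i)"
  shows "(\<integral>x. f x \<partial>lebesgue_PiM I) powr (1 - t) * (\<integral>x. g x \<partial>lebesgue_PiM I) powr t
     \<le> (\<integral>x. h x \<partial>lebesgue_PiM I)"
  using assms(1,5-)
proof (induction I arbitrary: f g h M rule: finite_induct)
  case empty
  have "integral\<^sup>L (Pi\<^sub>M {} (\<lambda>_. lborel)) F = F (\<lambda>_. undefined)" for F :: "('i \<Rightarrow> real) \<Rightarrow> real"
    by (simp add: PiM_empty lebesgue_integral_count_space_finite)
  \<comment> \<open>Points of the product are \<open>undefined\<close> off the index set, and so are their convex combinations.\<close>
  moreover have "(\<lambda>i::'i. (1 - t) * undefined + t * undefined) = (\<lambda>i. undefined::real)"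
    by (simp add: algebra_simps)
  ultimately show ?case using empty.prems(13)[of "\<lambda>_. undefined" "\<lambda>_. undefined"] by (simp add: space_PiM)
next
  case (insert i I)
  interpret product_sigma_finite "\<lambda>_::'i. lborel :: real measure" by standard
  note fin = \<open>finite I\<close> \<open>i \<notin> I\<close>
  define S where "S F x = (\<integral>u. F (x(i := u)) \<partial>lborel)" for F :: "('i \<Rightarrow> real) \<Rightarrow> real" and x
  have upd[measurable]: "(\<lambda>p. (fst p)(i := snd p)) \<in> lebesgue_PiM I \<Otimes>\<^sub>M lborel \<rightarrow>\<^sub>M lebesgue_PiM (insert i I)"
    using measurable_add_dim[of i I "\<lambda>_. lborel :: real measure"] by (simp add: split_beta')
  have S: "S F \<in> borel_measurable (lebesgue_PiM I)" "\<And>x. 0 \<le> S F x" "\<And>x. S F x \<le> 2 * R * M" "\<And>x. S F x \<noteq> 0 \<Longrightarrow> (\<forall>i\<in>I. \<bar>x i\<bar> \<le> R)"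
     "integral\<^sup>L (lebesgue_PiM (insert i I)) F = integral\<^sup>L (lebesgue_PiM I) (S F)"
     "\<And>x. x \<in> space (lebesgue_PiM I) \<Longrightarrow> (\<lambda>u. F (x(i := u))) \<in> borel_measurable borel"
     "\<And>x. x \<in> space (lebesgue_PiM I) \<Longrightarrow> integrable lborel (\<lambda>u. F (x(i := u)))"
    if F[measurable]: "F \<in> borel_measurable (lebesgue_PiM (insert i I))" and F0: "\<And>x. 0 \<le> F x" and FM: "\<And>x. F x \<le> M"
      and supp': "\<forall>x. F x \<noteq> 0 \<longrightarrow> (\<forall>i\<in>insert i I. \<bar>x i\<bar> \<le> R)" for F
  proof -
    have supp: "\<forall>i\<in>insert i I. \<bar>x i\<bar> \<le> R" if "F x \<noteq> 0" for x using that supp' by blast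
    have "(\<lambda>p. F ((fst p)(i := snd p))) \<in> borel_measurable (lebesgue_PiM I \<Otimes>\<^sub>M lborel)" by measurable
    then show "S F \<in> borel_measurable (lebesgue_PiM I)"
      unfolding S_def by (intro lborel.borel_measurable_lebesgue_integral) (simp add: split_beta')
    show "0 \<le> S F x" for x unfolding S_def using F0 by simp
    have M0: "0 \<le> M" using F0[of undefined] FM[of undefined] by simp
    show "S F x \<le> 2 * R * M" for x
    proof -
      have "S F x \<le> (\<integral>u. indicator {-R..R} u * M \<partial>lborel)"
        unfolding S_def
      proof (rule integral_mono')
        show "F (x(i := u)) \<le> indicator {-R..R} u * M" for u
          using FM[of "x(i:=u)"] supp[of "x(i:=u)"] M0 by (cases "F (x(i:=u)) = 0") (auto simp: indicator_def abs_le_iff)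
      qed (use F0 M0 R in \<open>auto intro!: integrable_mult_left integrable_real_indicator\<close>)
      then show ?thesis using R by simp
    qed
    show "\<forall>j\<in>I. \<bar>x j\<bar> \<le> R" if "S F x \<noteq> 0" for x
    proof -
      have "\<exists>u. F (x(i := u)) \<noteq> 0" using that unfolding S_def by (rule contrapos_np) simp
      then obtain u where "F (x(i := u)) \<noteq> 0" ..
      from supp[OF this] show ?thesis using fin by (auto split: if_splits)
    qed
    show "integral\<^sup>L (lebesgue_PiM (insert i I)) F = integral\<^sup>L (lebesgue_PiM I) (S F)"
      unfolding S_def using fin F0 FM supp F
      by (intro product_integral_insert integrable_PiM_lborel_bounded_support) auto
    show sl: "(\<lambda>u. F (x(i := u))) \<in> borel_measurable borel" if "x \<in> space (lebesgue_PiM I)" for x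
      using measurable_comp[OF measurable_component_update[OF that fin(2)] F] by (simp add: comp_def)
    show "integrable lborel (\<lambda>u. F (x(i := u)))" if "x \<in> space (lebesgue_PiM I)" for x
    proof (rule integrableI_bounded_set[where A="{-R..R}" and B=M])
      show "AE u in lborel. u \<notin> {-R..R} \<longrightarrow> F (x(i := u)) = 0"
        using supp[of "x(i := _)"] by (intro AE_I2) (force simp: abs_le_iff)
    qed (use sl[OF that] FM F0 R in auto)
  qed
  have supp: "\<forall>x. f x \<noteq> 0 \<longrightarrow> (\<forall>i\<in>insert i I. \<bar>x i\<bar> \<le> R)" "\<forall>x. g x \<noteq> 0 \<longrightarrow> (\<forall>i\<in>insert i I. \<bar>x i\<bar> \<le> R)"
    "\<forall>x. h x \<noteq> 0 \<longrightarrow> (\<forall>i\<in>insert i I. \<bar>x i\<bar> \<le> R)" using insert.prems(10-12) by blast+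
  note Sf = S[OF insert.prems(1,4,7) supp(1)] and Sg = S[OF insert.prems(2,5,8) supp(2)] and Sh = S[OF insert.prems(3,6,9) supp(3)]
  have slice: "S f x powr (1 - t) * S g y powr t \<le> S h (\<lambda>j. (1 - t) * x j + t * y j)"
    if x: "x \<in> space (lebesgue_PiM I)" and y: "y \<in> space (lebesgue_PiM I)" for x y
  proof -
    let ?z = "\<lambda>j. (1 - t) * x j + t * y j"
    have z: "?z \<in> space (lebesgue_PiM I)"
    proof -
      have "(1 - t) * undefined + t * undefined = (undefined :: real)" by (simp add: algebra_simps)
      then show ?thesis using x y by (simp add: space_PiM PiE_iff extensional_def)
    qed
    show ?thesis unfolding S_def
    proof (rule prekopa_leindler_line[where M=M and R=R])
      show "f (x(i := u)) powr (1 - t) * g (y(i := v)) powr t \<le> h (?z(i := (1 - t) * u + t * v))" for u v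
      proof -
        have "(\<lambda>j. (1 - t) * (x(i := u)) j + t * (y(i := v)) j) = ?z(i := (1 - t) * u + t * v)" by auto
        moreover have "x(i := u) \<in> space (lebesgue_PiM (insert i I))" "y(i := v) \<in> space (lebesgue_PiM (insert i I))"
          using x y by (auto simp: space_PiM PiE_iff extensional_def)
        ultimately show ?thesis using insert.prems(13)[of "x(i := u)" "y(i := v)"] by metis
      qed
      show "\<bar>u\<bar> \<le> R" if "f (x(i := u)) \<noteq> 0" for u using insert.prems(10)[OF that] by simp
      show "\<bar>u\<bar> \<le> R" if "g (y(i := u)) \<noteq> 0" for u using insert.prems(11)[OF that] by simp
    qed (use Sf(6,7)[OF x] Sg(6,7)[OF y] Sh(7)[OF z] insert.prems(4-9) t in auto)
  qed
  show ?case
    unfolding Sf(5) Sg(5) Sh(5)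
    by (rule insert.IH[of "S f" "S g" "S h" "2 * R * M"];
        (rule Sf(1-3) Sg(1-3) Sh(1-3) | erule Sf(4) Sg(4) Sh(4) | (rule slice; assumption)))
qed

text \<open>Lebesgue measure on a Euclidean space is the image of the product measure under the linear
  map that sends coordinates to points.\<close>

lemma prekopa_leindler:
  fixes f g h :: "'a::euclidean_space \<Rightarrow> real"
  assumes meas[measurable]: "f \<in> borel_measurable borel" "g \<in> borel_measurable borel" "h \<in> borel_measurable borel"
    and nonneg: "\<And>x. 0 \<le> f x" "\<And>x. 0 \<le> g x" "\<And>x. 0 \<le> h x"
    and bounded: "\<And>x. f x \<le> M" "\<And>x. g x \<le> M" "\<And>x. h x \<le> M"
    and supp: "\<And>x. f x \<noteq> 0 \<Longrightarrow> norm x \<le> R" "\<And>x. g x \<noteq> 0 \<Longrightarrow> norm x \<le> R" "\<And>x. h x \<noteq> 0 \<Longrightarrow> norm x \<le> R"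
    and R: "0 \<le> R" and t: "0 < t" "t < 1"
    and fgh: "\<And>x y. f x powr (1 - t) * g y powr t \<le> h ((1 - t) *\<^sub>R x + t *\<^sub>R y)"
  shows "integral\<^sup>L lborel f powr (1 - t) * integral\<^sup>L lborel g powr t \<le> integral\<^sup>L lborel h"
proof -
  define \<phi> :: "('a \<Rightarrow> real) \<Rightarrow> 'a" where "\<phi> x = (\<Sum>b\<in>Basis. x b *\<^sub>R b)" for x
  have \<phi>[measurable]: "\<phi> \<in> borel_measurable (lebesgue_PiM Basis)"
    unfolding \<phi>_def by measurable
  have int: "(\<integral>x. F x \<partial>lborel) = (\<integral>x. F (\<phi> x) \<partial>lebesgue_PiM Basis)"
    if "F \<in> borel_measurable borel" for F :: "'a \<Rightarrow> real"
  proof -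
    have "(lborel :: 'a measure) = distr (lebesgue_PiM Basis) borel \<phi>"
      unfolding \<phi>_def by (rule lborel_eq)
    then show ?thesis using integral_distr[OF \<phi> that] by simp
  qed
  have coord: "\<forall>b\<in>Basis. \<bar>x b\<bar> \<le> R" if "norm (\<phi> x) \<le> R" for x
  proof
    fix b :: 'a assume b: "b \<in> Basis"
    have "x b = \<phi> x \<bullet> b" using b unfolding \<phi>_def by simp
    then show "\<bar>x b\<bar> \<le> R" using Basis_le_norm[OF b, of "\<phi> x"] that by simp
  qed
  have lin: "\<phi> (\<lambda>b. (1 - t) * x b + t * y b) = (1 - t) *\<^sub>R \<phi> x + t *\<^sub>R \<phi> y" for x y
    unfolding \<phi>_def by (simp add: scaleR_sum_right sum.distrib scaleR_left_distrib)
  have m: "(\<lambda>x. f (\<phi> x)) \<in> borel_measurable (lebesgue_PiM Basis)"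
    "(\<lambda>x. g (\<phi> x)) \<in> borel_measurable (lebesgue_PiM Basis)"
    "(\<lambda>x. h (\<phi> x)) \<in> borel_measurable (lebesgue_PiM Basis)" by measurable
  show ?thesis
    unfolding int[OF meas(1)] int[OF meas(2)] int[OF meas(3)]
  proof (rule prekopa_leindler_PiM[OF finite_Basis t R])
    show "\<forall>b\<in>Basis. \<bar>x b\<bar> \<le> R" if "f (\<phi> x) \<noteq> 0" for x using coord supp(1) that by blast
    show "\<forall>b\<in>Basis. \<bar>x b\<bar> \<le> R" if "g (\<phi> x) \<noteq> 0" for x using coord supp(2) that by blast
    show "\<forall>b\<in>Basis. \<bar>x b\<bar> \<le> R" if "h (\<phi> x) \<noteq> 0" for x using coord supp(3) that by blast
    show "f (\<phi> x) powr (1 - t) * g (\<phi> y) powr t \<le> h (\<phi> (\<lambda>i. (1 - t) * x i + t * y i))" for x y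
      unfolding lin by (rule fgh)
  qed (rule m nonneg bounded)+
qed

section \<open>Relative entropy controls total variation\<close>

text \<open>Jensen's inequality for the exponential, by integrating the tangent at the mean.\<close>

lemma (in prob_space) exp_expectation_le:
  fixes X :: "'a \<Rightarrow> real"
  assumes "integrable M X" "integrable M (\<lambda>x. exp (X x))"
  shows "exp (expectation X) \<le> expectation (\<lambda>x. exp (X x))"
proof -
  let ?m = "expectation X"
  have "exp ?m = expectation (\<lambda>x. exp ?m * (1 + (X x - ?m)))"
    using assms by (simp add: prob_space)
  also have "\<dots> \<le> expectation (\<lambda>x. exp (X x))"
  proof (rule integral_mono)
    fix x
    have "exp ?m * (1 + (X x - ?m)) \<le> exp ?m * exp (X x - ?m)"
      by (intro mult_left_mono exp_ge_add_one_self) simp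
    then show "exp ?m * (1 + (X x - ?m)) \<le> exp (X x)" by (simp flip: exp_add)
  qed (use assms in auto)
  finally show ?thesis .
qed

lemma (in prob_space) integrable_bounded_real:
  fixes X :: "'a \<Rightarrow> real"
  assumes "X \<in> borel_measurable M" "\<And>x. \<bar>X x\<bar> \<le> K"
  shows "integrable M X"
proof (rule integrable_const_bound)
  show "AE x in M. norm (X x) \<le> K" using assms(2) by simp
qed (rule assms)

lemma (in prob_space) integrable_exp_bounded:
  fixes X :: "'a \<Rightarrow> real"
  assumes [measurable]: "X \<in> borel_measurable M" and "\<And>x. \<bar>X x\<bar> \<le> K"
  shows "integrable M (\<lambda>x. exp (X x))"
proof (rule integrable_bounded_real[where K="exp K"])
  show "\<bar>exp (X x)\<bar> \<le> exp K" for x using assms(2)[of x] by simp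
qed measurable

text \<open>Read \<open>exp (- h)\<close>, divided by its mean, as the density of a second probability measure with
  respect to \<open>M\<close>. Then \<open>q\<close> is the probability of \<open>A\<close> under that measure and the right-hand side is
  the relative entropy of \<open>M\<close> with respect to it. The variational formula for relative
  entropy, tested on a multiple of the indicator of \<open>A\<close>, and Hoeffding's bound for the moment
  generating function of an indicator give the estimate.\<close>

lemma (in prob_space) pinsker_event_one_sided:
  fixes h :: "'a \<Rightarrow> real"
  assumes h[measurable]: "h \<in> borel_measurable M" and K: "\<And>x. \<bar>h x\<bar> \<le> K" and A[measurable]: "A \<in> events"
    and q: "q = expectation (\<lambda>x. indicator A x * exp (- h x)) / expectation (\<lambda>x. exp (- h x))"
    and le: "q \<le> prob A"
  shows "2 * (prob A - q)\<^sup>2 \<le> expectation h + ln (expectation (\<lambda>x. exp (- h x)))"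
proof -
  let ?Z = "expectation (\<lambda>x. exp (- h x))"
  \<comment> \<open>This value maximizes \<open>c * (prob A - q) - c^2 / 8\<close>.\<close>
  define c where "c = 4 * (prob A - q)"
  have c: "0 \<le> c" using le by (simp add: c_def)
  have int_h: "integrable M h" by (rule integrable_bounded_real[where K=K]) (use K in auto)
  have int_e: "integrable M (\<lambda>x. exp (- h x))" by (rule integrable_exp_bounded[where K=K]) (use K in auto)
  have int_A: "integrable M (\<lambda>x. indicator A x * exp (- h x))"
    using integrable_mult_indicator[OF A int_e] by simp
  have int_c: "integrable M (\<lambda>x. c * indicator A x - h x)"
    using int_h A by (intro Bochner_Integration.integrable_diff integrable_mult_right) (auto simp: less_top[symmetric])
  have Z: "?Z > 0"
    using exp_expectation_le[of "\<lambda>x. - h x"] int_h int_e by (simp add: less_le_trans[OF exp_gt_zero])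
  have q0: "0 \<le> q" unfolding q using Z by (intro divide_nonneg_pos Bochner_Integration.integral_nonneg) auto
  have split: "exp (c * indicator A x - h x) = exp (- h x) + (exp c - 1) * (indicator A x * exp (- h x))" for x
    by (cases "x \<in> A") (auto simp: algebra_simps exp_diff exp_minus field_simps)
  have "exp (expectation (\<lambda>x. c * indicator A x - h x)) \<le> expectation (\<lambda>x. exp (c * indicator A x - h x))"
    by (rule exp_expectation_le[OF int_c]) (use int_e int_A in \<open>simp add: split\<close>)
  also have "\<dots> = ?Z + (exp c - 1) * expectation (\<lambda>x. indicator A x * exp (- h x))"
    using int_e int_A by (simp add: split)
  also have "\<dots> = ?Z * (1 + q * (exp c - 1))"
    using Z by (simp add: q field_simps)
  also have "expectation (\<lambda>x. c * indicator A x - h x) = c * prob A - expectation h"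
    using int_h A by (subst Bochner_Integration.integral_diff) (auto simp: less_top[symmetric])
  finally have *: "exp (c * prob A - expectation h) \<le> ?Z * (1 + q * (exp c - 1))" .
  have pos: "1 + q * (exp c - 1) > 0" using q0 c by (intro add_pos_nonneg mult_nonneg_nonneg) auto
  have "c * prob A - expectation h \<le> ln (?Z * (1 + q * (exp c - 1)))"
    using * Z pos by (subst ln_ge_iff) auto
  also have "\<dots> = ln ?Z + ln (1 + q * (exp c - 1))"
    using Z pos by (simp add: ln_mult)
  also have "ln (1 + q * (exp c - 1)) \<le> c * q + c\<^sup>2 / 8"
    using Hoeffdings_lemma_aux[OF c q0] by simp
  finally have "c * (prob A - q) - c\<^sup>2 / 8 \<le> expectation h + ln ?Z"
    by (simp add: algebra_simps)
  moreover have "c * (prob A - q) - c\<^sup>2 / 8 = 2 * (prob A - q)\<^sup>2"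
    unfolding c_def by (simp add: power2_eq_square field_simps)
  ultimately show ?thesis by simp
qed

text \<open>Passing to the complement of \<open>A\<close> changes the sign of the difference.\<close>

lemma (in prob_space) pinsker_event:
  fixes h :: "'a \<Rightarrow> real"
  assumes h[measurable]: "h \<in> borel_measurable M" and K: "\<And>x. \<bar>h x\<bar> \<le> K" and A[measurable]: "A \<in> events"
  shows "2 * (prob A - expectation (\<lambda>x. indicator A x * exp (- h x)) / expectation (\<lambda>x. exp (- h x)))\<^sup>2
     \<le> expectation h + ln (expectation (\<lambda>x. exp (- h x)))"
proof -
  let ?Z = "expectation (\<lambda>x. exp (- h x))" and ?q = "\<lambda>A. expectation (\<lambda>x. indicator A x * exp (- h x)) / expectation (\<lambda>x. exp (- h x))"
  show ?thesis
  proof (cases "?q A \<le> prob A")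
    case True
    then show ?thesis by (intro pinsker_event_one_sided[OF h K A refl])
  next
    case False
    let ?C = "space M - A"
    have int_e: "integrable M (\<lambda>x. exp (- h x))" by (rule integrable_exp_bounded[where K=K]) (use K in auto)
    have int_h: "integrable M h" by (rule integrable_bounded_real[where K=K]) (use K in auto)
    have int_A: "integrable M (\<lambda>x. indicator A x * exp (- h x))"
      using integrable_mult_indicator[OF A int_e] by simp
    have Z: "?Z > 0"
      using exp_expectation_le[of "\<lambda>x. - h x"] int_h int_e by (simp add: less_le_trans[OF exp_gt_zero])
    have "expectation (\<lambda>x. indicator ?C x * exp (- h x)) = expectation (\<lambda>x. exp (- h x) - indicator A x * exp (- h x))"
      by (intro Bochner_Integration.integral_cong) (auto simp: indicator_def)
    also have "\<dots> = ?Z - expectation (\<lambda>x. indicator A x * exp (- h x))"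
      using int_e int_A by simp
    finally have qC: "?q ?C = 1 - ?q A" using Z by (simp add: diff_divide_distrib)
    have pC: "prob ?C = 1 - prob A" using A by (rule prob_compl)
    have "2 * (prob ?C - ?q ?C)\<^sup>2 \<le> expectation h + ln ?Z"
      using False by (intro pinsker_event_one_sided[OF h K _ refl]) (auto simp: qC pC)
    then show ?thesis unfolding qC pC by (simp add: power2_commute)
  qed
qed

text \<open>The left-hand side of the hypothesis is at least \<open>exp (s * k)\<close>, where \<open>k\<close> is the relative
  entropy, and the right-hand side is \<open>1 + s * expectation Y\<close> up to second order in \<open>s\<close>; the
  conclusion compares the first-order terms as \<open>s\<close> tends to zero.\<close>

lemma (in prob_space) relative_entropy_le_of_exponential_bound:
  fixes h Y :: "'a \<Rightarrow> real"
  assumes h[measurable]: "h \<in> borel_measurable M" and Y[measurable]: "Y \<in> borel_measurable M"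
    and K: "\<And>x. \<bar>h x\<bar> \<le> K" "\<And>x. 0 \<le> Y x" "\<And>x. Y x \<le> K" and C: "0 \<le> C"
    and bound: "\<And>s. 0 < s \<Longrightarrow> s < 1 \<Longrightarrow>
      expectation (\<lambda>x. exp (s / (1 - s) * h x)) powr (1 - s) * expectation (\<lambda>x. exp (- h x)) powr s
      \<le> exp (C * s\<^sup>2) * expectation (\<lambda>x. exp (s / (1 - s) * Y x))"
  shows "expectation h + ln (expectation (\<lambda>x. exp (- h x))) \<le> expectation Y"
proof -
  let ?Z = "expectation (\<lambda>x. exp (- h x))"
  let ?k = "expectation h + ln ?Z"
  have K0: "0 \<le> K" using K(2,3) order_trans by blast
  have int_h: "integrable M h" by (rule integrable_bounded_real[where K=K]) (use K in auto)
  have int_Y: "integrable M Y" by (rule integrable_bounded_real[where K=K]) (use K in auto)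
  have int_e: "integrable M (\<lambda>x. exp (- h x))" by (rule integrable_exp_bounded[where K=K]) (use K in auto)
  have Z: "?Z > 0"
    using exp_expectation_le[of "\<lambda>x. - h x"] int_h int_e by (simp add: less_le_trans[OF exp_gt_zero])
  have main: "?k \<le> C * s + expectation Y / (1 - s) + s * K\<^sup>2 / (1 - s)\<^sup>2"
    if s: "0 < s" "s < 1" "s / (1 - s) * K \<le> 1" for s
  proof -
    define e where "e = s / (1 - s)"
    have e: "e > 0" "e * (1 - s) = s" using s by (auto simp: e_def)
    have "exp (s * ?k) = exp ((1 - s) * (e * expectation h) + s * ln ?Z)"
    proof -
      have "(1 - s) * (e * expectation h) = (e * (1 - s)) * expectation h"
        by (simp only: ac_simps)
      then show ?thesis by (simp only: e(2) distrib_left)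
    qed
    also have "\<dots> = exp (expectation (\<lambda>x. e * h x)) powr (1 - s) * ?Z powr s"
      using Z by (simp add: powr_def exp_add)
    also have "\<dots> \<le> expectation (\<lambda>x. exp (e * h x)) powr (1 - s) * ?Z powr s"
    proof (intro mult_right_mono powr_mono2 exp_expectation_le)
      show "integrable M (\<lambda>x. exp (e * h x))"
        by (rule integrable_exp_bounded[where K="e * K"]) (use K e in \<open>auto simp: abs_mult\<close>)
    qed (use s int_h in auto)
    also have "\<dots> \<le> exp (C * s\<^sup>2) * expectation (\<lambda>x. exp (e * Y x))"
      unfolding e_def by (rule bound[OF s(1,2)])
    also have "expectation (\<lambda>x. exp (e * Y x)) \<le> expectation (\<lambda>x. 1 + e * Y x + (e * K)\<^sup>2)"
    proof (rule integral_mono)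
      show "integrable M (\<lambda>x. exp (e * Y x))"
        by (rule integrable_exp_bounded[where K="e * K"]) (use K e in \<open>auto simp: abs_mult\<close>)
      fix x
      have "e * Y x \<le> e * K" "0 \<le> e * Y x" using K e by auto
      moreover have "e * K \<le> 1" using s(3) by (simp add: e_def)
      ultimately have "exp (e * Y x) \<le> 1 + e * Y x + (e * Y x)\<^sup>2" "(e * Y x)\<^sup>2 \<le> (e * K)\<^sup>2"
        by (auto intro!: exp_bound power_mono)
      then show "exp (e * Y x) \<le> 1 + e * Y x + (e * K)\<^sup>2" by linarith
    qed (use int_Y in auto)
    also have "\<dots> = 1 + (e * expectation Y + (e * K)\<^sup>2)" using int_Y by (simp add: prob_space)
    also have "\<dots> \<le> exp (e * expectation Y + (e * K)\<^sup>2)" by (rule exp_ge_add_one_self)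
    finally have "exp (s * ?k) \<le> exp (C * s\<^sup>2 + (e * expectation Y + (e * K)\<^sup>2))"
      by (simp add: exp_add)
    then have "s * ?k \<le> s * (C * s + expectation Y / (1 - s) + s * K\<^sup>2 / (1 - s)\<^sup>2)"
      by (simp add: e_def power2_eq_square algebra_simps)
    then show ?thesis using s by simp
  qed
  have "((\<lambda>s. s / (1 - s) * K) \<longlongrightarrow> 0 / (1 - 0) * K) (at_right 0)" by (intro tendsto_intros) auto
  then have small: "eventually (\<lambda>s. s / (1 - s) * K < 1) (at_right 0)"
    by (rule order_tendstoD) simp
  have "((\<lambda>s. C * s + expectation Y / (1 - s) + s * K\<^sup>2 / (1 - s)\<^sup>2) \<longlongrightarrow> C * 0 + expectation Y / (1 - 0) + 0 * K\<^sup>2 / (1 - 0)\<^sup>2) (at_right 0)"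
    by (intro tendsto_intros) auto
  then have "((\<lambda>s. C * s + expectation Y / (1 - s) + s * K\<^sup>2 / (1 - s)\<^sup>2) \<longlongrightarrow> expectation Y) (at_right 0)" by simp
  moreover have "eventually (\<lambda>s. ?k \<le> C * s + expectation Y / (1 - s) + s * K\<^sup>2 / (1 - s)\<^sup>2) (at_right 0)"
    using small eventually_at_right_real[OF zero_less_one]
    by eventually_elim (auto intro!: main)
  ultimately show ?thesis by (rule tendsto_lowerbound) simp
qed

section \<open>Total variation between log-concave measures on a convex set\<close>

text \<open>The Prekopa-Leindler inequality for the exponentials of \<open>h / (1 - s) - V\<close> and \<open>- V\<close>. At an
  intermediate point of \<open>x\<close> and \<open>y\<close> the strong convexity of \<open>V\<close> gains a multiple of
  \<open>norm (x - y)^2\<close>, whereas \<open>h x\<close> exceeds the value of \<open>h\<close> there by at most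
  \<open>s * norm (x - y) * G\<close> up to order \<open>s^2\<close>; completing the square leaves \<open>s * G^2 / (2 * lam * (1 - s))\<close>.\<close>

lemma prekopa_leindler_perturbed_density:
  fixes V h G :: "'a::euclidean_space \<Rightarrow> real"
  assumes B[measurable]: "B \<in> sets borel" and Bc: "convex B" and BD: "\<And>x y. x \<in> B \<Longrightarrow> y \<in> B \<Longrightarrow> norm (x - y) \<le> D"
    and [measurable]: "V \<in> borel_measurable borel" "h \<in> borel_measurable borel" "G \<in> borel_measurable borel"
    and K: "\<And>x. x \<in> B \<Longrightarrow> \<bar>V x\<bar> \<le> K" "\<And>x. x \<in> B \<Longrightarrow> \<bar>h x\<bar> \<le> K" "\<And>x. x \<in> B \<Longrightarrow> \<bar>G x\<bar> \<le> K"
    and lam: "0 < lam" and C: "0 \<le> C"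
    and V: "\<And>x y s. x \<in> B \<Longrightarrow> y \<in> B \<Longrightarrow> 0 < s \<Longrightarrow> s < 1 \<Longrightarrow>
       V ((1 - s) *\<^sub>R x + s *\<^sub>R y) \<le> (1 - s) * V x + s * V y - lam * s * (1 - s) / 2 * (norm (x - y))\<^sup>2"
    and h: "\<And>x z. x \<in> B \<Longrightarrow> z \<in> B \<Longrightarrow> h x \<le> h z + norm (x - z) * G z + C * (norm (x - z))\<^sup>2"
    and s: "0 < s" "s < 1"
  shows "(\<integral>x. indicator B x * exp (h x / (1 - s) - V x) \<partial>lborel) powr (1 - s) * (\<integral>x. indicator B x * exp (- V x) \<partial>lborel) powr s
    \<le> (\<integral>x. indicator B x * exp (h x - V x + s * (G x)\<^sup>2 / (2 * lam * (1 - s)) + C * s\<^sup>2 * D\<^sup>2) \<partial>lborel)"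
proof (cases "B = {}")
  case False
  then obtain b where b: "b \<in> B" by auto
  define R where "R = norm b + D"
  have R: "norm x \<le> R" if "x \<in> B" for x
    using BD[OF that b] norm_triangle_ineq2[of x b] by (simp add: R_def)
  have R0: "0 \<le> R" using R[OF b] norm_ge_zero order_trans by blast
  have K0: "0 \<le> K" using K(1)[OF b] by linarith
  define u where "u = s / (2 * lam * (1 - s))"
  have u: "u \<ge> 0" using s lam by (simp add: u_def)
  define M where "M = exp (K / (1 - s) + K + K + u * K\<^sup>2 + C * s\<^sup>2 * D\<^sup>2)"
  have KK: "K \<le> K / (1 - s)" using K0 s by (simp add: divide_simps mult_left_le)
  show ?thesis
  proof (rule prekopa_leindler[where M=M and R=R])
    fix x
    show "indicator B x * exp (h x / (1 - s) - V x) \<le> M"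
    proof (cases "x \<in> B")
      case True
      have "h x / (1 - s) \<le> K / (1 - s)" using K(2)[OF True] s by (intro divide_right_mono) auto
      moreover have "0 \<le> u * K\<^sup>2 + C * s\<^sup>2 * D\<^sup>2" using u C by simp
      ultimately show ?thesis using K(1)[OF True] K0 True by (simp add: M_def)
    qed (simp add: M_def)
    show "indicator B x * exp (- V x) \<le> M"
    proof (cases "x \<in> B")
      case True
      have "0 \<le> u * K\<^sup>2 + C * s\<^sup>2 * D\<^sup>2" using u C by simp
      then show ?thesis using K(1)[OF True] K0 KK True by (simp add: M_def)
    qed (simp add: M_def)
    show "indicator B x * exp (h x - V x + s * (G x)\<^sup>2 / (2 * lam * (1 - s)) + C * s\<^sup>2 * D\<^sup>2) \<le> M"
    proof (cases "x \<in> B")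
      case True
      have "(G x)\<^sup>2 \<le> K\<^sup>2" using K(3)[OF True] abs_le_square_iff[of "G x" K] by simp
      then have "u * (G x)\<^sup>2 \<le> u * K\<^sup>2" using u by (intro mult_left_mono)
      moreover have "u * (G x)\<^sup>2 = s * (G x)\<^sup>2 / (2 * lam * (1 - s))" by (simp add: u_def)
      ultimately show ?thesis using K(1)[OF True] K(2)[OF True] K0 KK True by (simp add: M_def)
    qed (simp add: M_def)
  next
    fix x y
    show "(indicator B x * exp (h x / (1 - s) - V x)) powr (1 - s) * (indicator B y * exp (- V y)) powr s
      \<le> indicator B ((1 - s) *\<^sub>R x + s *\<^sub>R y) * exp (h ((1 - s) *\<^sub>R x + s *\<^sub>R y) - V ((1 - s) *\<^sub>R x + s *\<^sub>R y)
         + s * (G ((1 - s) *\<^sub>R x + s *\<^sub>R y))\<^sup>2 / (2 * lam * (1 - s)) + C * s\<^sup>2 * D\<^sup>2)"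
    proof (cases "x \<in> B \<and> y \<in> B")
      case True
      define z where "z = (1 - s) *\<^sub>R x + s *\<^sub>R y"
      have z: "z \<in> B" unfolding z_def using True Bc s by (intro convexD) auto
      let ?n = "norm (x - y)"
      have "x - z = s *\<^sub>R (x - y)" by (simp add: z_def algebra_simps)
      then have xz: "norm (x - z) = s * ?n" using s by simp
      have n: "?n\<^sup>2 \<le> D\<^sup>2" using BD[of x y] True by (intro power_mono) auto
      have "h x \<le> h z + s * ?n * G z + C * s\<^sup>2 * ?n\<^sup>2"
        using h[of x z] True z by (simp add: xz power_mult_distrib mult.assoc)
      also have "C * s\<^sup>2 * ?n\<^sup>2 \<le> C * s\<^sup>2 * D\<^sup>2" using n C by (intro mult_left_mono) auto
      finally have 1: "h x \<le> h z + s * ?n * G z + C * s\<^sup>2 * D\<^sup>2" by simp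
      have 2: "V z \<le> (1 - s) * V x + s * V y - lam * s * (1 - s) / 2 * ?n\<^sup>2"
        unfolding z_def using V True s by blast
      \<comment> \<open>Completing the square absorbs the linear growth of \<open>h\<close> into the quadratic gain of \<open>V\<close>.\<close>
      have "0 \<le> u * (G z - lam * (1 - s) * ?n)\<^sup>2" using u by simp
      also have "\<dots> = u * (G z)\<^sup>2 - s * ?n * G z + lam * s * (1 - s) / 2 * ?n\<^sup>2"
        using s lam by (simp add: u_def power2_eq_square field_simps)
      finally have 3: "s * ?n * G z \<le> s * (G z)\<^sup>2 / (2 * lam * (1 - s)) + lam * s * (1 - s) / 2 * ?n\<^sup>2"
        by (simp add: u_def)
      have "exp (h x / (1 - s) - V x) powr (1 - s) * exp (- V y) powr s = exp ((1 - s) * (h x / (1 - s) - V x) + s * (- V y))"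
        by (simp add: powr_def exp_add[symmetric])
      also have "(1 - s) * (h x / (1 - s) - V x) + s * (- V y) = h x - ((1 - s) * V x + s * V y)"
        using s by (simp add: field_simps)
      also have "exp \<dots> \<le> exp (h z - V z + s * (G z)\<^sup>2 / (2 * lam * (1 - s)) + C * s\<^sup>2 * D\<^sup>2)"
        using 1 2 3 by simp
      finally show ?thesis using True z by (simp flip: z_def)
    qed auto
  qed (use R R0 s in \<open>auto simp: indicator_def split: if_splits\<close>)
qed simp

text \<open>Here \<open>G\<close> plays the role of the norm of the gradient of \<open>h\<close>, and
  \<open>Y = G^2 / (2 * lam)\<close> is the integrand of the logarithmic Sobolev inequality. Pinsker's inequality
  contributes the remaining factor 1/2 under the root. Normalizing constants are kept apart from the
  densities so that the result applies to conditioned measures without renormalizing \<open>V\<close>.\<close>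

lemma tv_le_of_strongly_log_concave:
  fixes V h G :: "'a::euclidean_space \<Rightarrow> real"
  assumes B[measurable]: "B \<in> sets borel" and Bc: "convex B" and Bb: "bounded B" and Bpos: "0 < measure lborel B"
    and mV[measurable]: "V \<in> borel_measurable borel" and mh[measurable]: "h \<in> borel_measurable borel" and mG[measurable]: "G \<in> borel_measurable borel"
    and K: "\<And>x. x \<in> B \<Longrightarrow> \<bar>V x\<bar> \<le> K" "\<And>x. x \<in> B \<Longrightarrow> \<bar>h x\<bar> \<le> K" "\<And>x. x \<in> B \<Longrightarrow> \<bar>G x\<bar> \<le> K"
    and lam: "0 < lam" and C: "0 \<le> C"
    and V: "\<And>x y s. x \<in> B \<Longrightarrow> y \<in> B \<Longrightarrow> 0 < s \<Longrightarrow> s < 1 \<Longrightarrow>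
       V ((1 - s) *\<^sub>R x + s *\<^sub>R y) \<le> (1 - s) * V x + s * V y - lam * s * (1 - s) / 2 * (norm (x - y))\<^sup>2"
    and h: "\<And>x z. x \<in> B \<Longrightarrow> z \<in> B \<Longrightarrow> h x \<le> h z + norm (x - z) * G z + C * (norm (x - z))\<^sup>2"
    and Z0: "Z0 = (\<integral>x. indicator B x * exp (- V x) \<partial>lborel)"
    and Z1: "Z1 = (\<integral>x. indicator B x * exp (h x - V x) \<partial>lborel)"
    and A[measurable]: "A \<in> sets borel"
  shows "\<bar>(\<integral>x. indicator A x * (indicator B x * exp (h x - V x)) \<partial>lborel) / Z1 - (\<integral>x. indicator A x * (indicator B x * exp (- V x)) \<partial>lborel) / Z0\<bar>
    \<le> sqrt ((\<integral>x. (G x)\<^sup>2 * (indicator B x * exp (h x - V x)) \<partial>lborel) / (4 * lam * Z1))"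
proof -
  have Bne: "B \<noteq> {}" using Bpos by auto
  have K0: "0 \<le> K" using Bne K(1) abs_ge_zero order_trans by blast
  have Bfin: "emeasure lborel B < \<infinity>" using Bb by (rule emeasure_bounded_finite)
  obtain D where D: "\<And>x y. x \<in> B \<Longrightarrow> y \<in> B \<Longrightarrow> norm (x - y) \<le> D"
    using Bb unfolding bounded_two_points by (auto simp: dist_norm)
  \<comment> \<open>Cutting off outside \<open>B\<close> turns the bounds on \<open>B\<close> into global ones and does not affect integrals over \<open>B\<close>.\<close>
  define h0 where "h0 x = indicator B x * h x" for x
  define G0 where "G0 x = indicator B x * G x" for x
  define Y where "Y x = (G0 x)\<^sup>2 / (2 * lam)" for x
  have [measurable]: "h0 \<in> borel_measurable borel" "G0 \<in> borel_measurable borel" "Y \<in> borel_measurable borel"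
    unfolding h0_def[abs_def] G0_def[abs_def] Y_def[abs_def] by measurable
  define \<psi> where "\<psi> x = indicator B x * exp (h x - V x)" for x
  have [measurable]: "\<psi> \<in> borel_measurable borel" unfolding \<psi>_def[abs_def] by measurable
  have \<psi>0: "0 \<le> \<psi> x" for x by (simp add: \<psi>_def)
  have int\<psi>: "integrable lborel \<psi>"
  proof (rule integrableI_bounded_set[where A=B and B="exp (2 * K)"])
    show "AE x in lborel. x \<in> B \<longrightarrow> norm (\<psi> x) \<le> exp (2 * K)"
    proof (intro AE_I2 impI)
      fix x assume x: "x \<in> B"
      show "norm (\<psi> x) \<le> exp (2 * K)" using K(1)[OF x] K(2)[OF x] x by (simp add: \<psi>_def)
    qed
    show "AE x in lborel. x \<notin> B \<longrightarrow> \<psi> x = 0" by (simp add: \<psi>_def)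
  qed (use Bfin in auto)
  have Z1pos: "Z1 > 0"
  proof -
    have "0 < measure lborel B * exp (- (2 * K))" using Bpos by simp
    also have "\<dots> = (\<integral>x. indicator B x * exp (- (2 * K)) \<partial>lborel)" by simp
    also have "\<dots> \<le> (\<integral>x. \<psi> x \<partial>lborel)"
    proof (rule integral_mono)
      show "integrable lborel (\<lambda>x. indicator B x * exp (- (2 * K)))" using Bfin by (intro integrable_mult_left integrable_real_indicator) auto
      show "indicator B x * exp (- (2 * K)) \<le> \<psi> x" for x
        using K(1)[of x] K(2)[of x] by (cases "x \<in> B") (auto simp: \<psi>_def)
    qed (rule int\<psi>)
    finally show ?thesis by (simp add: Z1 \<psi>_def)
  qed
  \<comment> \<open>All quantities are expressed under \<open>\<nu>\<close>; the other measure has density proportional to \<open>exp (- h0)\<close> with respect to it.\<close>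
  define \<nu> where "\<nu> = density lborel (\<lambda>x. ennreal (\<psi> x / Z1))"
  have E: "integral\<^sup>L \<nu> \<phi> = (\<integral>x. \<phi> x * \<psi> x \<partial>lborel) / Z1" if [measurable]: "\<phi> \<in> borel_measurable borel" for \<phi> :: "'a \<Rightarrow> real"
  proof -
    have "integral\<^sup>L \<nu> \<phi> = (\<integral>x. (\<psi> x / Z1) *\<^sub>R \<phi> x \<partial>lborel)"
      unfolding \<nu>_def using Z1pos \<psi>0 by (intro integral_density) auto
    also have "\<dots> = (\<integral>x. (\<phi> x * \<psi> x) / Z1 \<partial>lborel)" by (simp add: mult.commute)
    finally show ?thesis by simp
  qed
  have "emeasure \<nu> (space \<nu>) = (\<integral>\<^sup>+x. ennreal (\<psi> x / Z1) \<partial>lborel)"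
    unfolding \<nu>_def by (simp add: emeasure_density)
  also have "\<dots> = ennreal ((\<integral>x. \<psi> x \<partial>lborel) / Z1)"
    using int\<psi> \<psi>0 Z1pos by (subst nn_integral_eq_integral) auto
  also have "\<dots> = 1" using Z1pos by (simp add: Z1 \<psi>_def)
  finally interpret \<nu>: prob_space \<nu> by (rule prob_spaceI)
  have sets[simp, measurable_cong]: "sets \<nu> = sets borel" by (simp add: \<nu>_def)
  have e0: "indicator B x * exp (- V x) = exp (- h0 x) * \<psi> x" for x
    by (auto simp: indicator_def \<psi>_def h0_def exp_add[symmetric])
  let ?M0 = "\<nu>.expectation (\<lambda>x. exp (- h0 x))"
  have E0: "?M0 = Z0 / Z1"
    unfolding Z0 by (subst E) (auto simp: e0)
  have EA: "\<nu>.expectation (\<lambda>x. indicator A x * exp (- h0 x)) = (\<integral>x. indicator A x * (indicator B x * exp (- V x)) \<partial>lborel) / Z1"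
    unfolding e0 by (subst E) (auto simp: mult.assoc)
  have PA: "\<nu>.prob A = (\<integral>x. indicator A x * \<psi> x \<partial>lborel) / Z1"
    using E[of "indicator A"] by simp
  have EY: "\<nu>.expectation Y = (\<integral>x. (G x)\<^sup>2 * \<psi> x \<partial>lborel) / (2 * lam * Z1)"
  proof -
    have "\<nu>.expectation Y = (\<integral>x. Y x * \<psi> x \<partial>lborel) / Z1" by (rule E) measurable
    also have "(\<lambda>x. Y x * \<psi> x) = (\<lambda>x. ((G x)\<^sup>2 * \<psi> x) / (2 * lam))"
      by (auto simp: Y_def G0_def \<psi>_def indicator_def)
    finally show ?thesis by (simp add: mult.commute)
  qed
  have h0K: "\<bar>h0 x\<bar> \<le> max K (K\<^sup>2 / (2 * lam))" for x
    using K(2)[of x] K0 by (cases "x \<in> B") (auto simp: h0_def)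
  have Y0: "0 \<le> Y x" for x using lam by (simp add: Y_def)
  have YK: "Y x \<le> max K (K\<^sup>2 / (2 * lam))" for x
  proof -
    have "(G0 x)\<^sup>2 \<le> K\<^sup>2" using K(3)[of x] K0 abs_le_square_iff[of "G0 x" K] by (cases "x \<in> B") (auto simp: G0_def)
    then have "Y x \<le> K\<^sup>2 / (2 * lam)" unfolding Y_def using lam by (intro divide_right_mono) auto
    then show ?thesis by simp
  qed
  have "\<nu>.expectation h0 + ln (?M0) \<le> \<nu>.expectation Y"
  proof (rule \<nu>.relative_entropy_le_of_exponential_bound[where C="C * D\<^sup>2", OF _ _ h0K Y0 YK])
    fix s :: real assume s: "0 < s" "s < 1"
    define e where "e = s / (1 - s)"
    let ?w = "(\<integral>x. indicator B x * exp (h x - V x + s * (G x)\<^sup>2 / (2 * lam * (1 - s)) + C * s\<^sup>2 * D\<^sup>2) \<partial>lborel)"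
    let ?Mh = "\<nu>.expectation (\<lambda>x. exp (e * h0 x))" and ?MY = "\<nu>.expectation (\<lambda>x. exp (e * Y x))"
    have e1: "1 / (1 - s) = 1 + e" using s by (simp add: e_def field_simps)
    have e2: "s * y / (2 * lam * (1 - s)) = e * (y / (2 * lam))" for y by (simp add: e_def)
    have "(\<integral>x. indicator B x * exp (h x / (1 - s) - V x) \<partial>lborel) = (\<integral>x. exp (e * h0 x) * \<psi> x \<partial>lborel)"
    proof (rule Bochner_Integration.integral_cong)
      fix x
      have "h x / (1 - s) = h x + e * h x" using e1 by (metis distrib_right mult_1 times_divide_eq_left)
      then show "indicator B x * exp (h x / (1 - s) - V x) = exp (e * h0 x) * \<psi> x"
        by (auto simp: h0_def \<psi>_def indicator_def exp_add[symmetric])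
    qed simp
    also have "\<dots> = Z1 * ?Mh"
      using Z1pos by (subst E) auto
    finally have i1: "(\<integral>x. indicator B x * exp (h x / (1 - s) - V x) \<partial>lborel) = Z1 * ?Mh" .
    have "?w
       = (\<integral>x. exp (C * D\<^sup>2 * s\<^sup>2) * (exp (e * Y x) * \<psi> x) \<partial>lborel)"
      unfolding e2
      by (rule Bochner_Integration.integral_cong) (auto simp: Y_def G0_def \<psi>_def indicator_def exp_add[symmetric] algebra_simps)
    also have "\<dots> = Z1 * (exp (C * D\<^sup>2 * s\<^sup>2) * ?MY)"
      using Z1pos by (subst E) auto
    finally have i2: "?w
       = Z1 * (exp (C * D\<^sup>2 * s\<^sup>2) * ?MY)" .
    have Z0': "Z0 = Z1 * ?M0" using E0 Z1pos by simp
    have nn: "0 \<le> ?Mh" "0 \<le> ?M0" by simp_all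
    have "Z1 * (?Mh powr (1 - s) * ?M0 powr s)
      = (Z1 powr (1 - s) * Z1 powr s) * (?Mh powr (1 - s) * ?M0 powr s)"
      using Z1pos by (simp flip: powr_add)
    also have "\<dots> = (Z1 * ?Mh) powr (1 - s) * Z0 powr s"
      unfolding Z0' using Z1pos nn by (simp add: powr_mult)
    also have "\<dots> \<le> Z1 * (exp (C * D\<^sup>2 * s\<^sup>2) * ?MY)"
      using prekopa_leindler_perturbed_density[OF B Bc D mV mh mG K lam C V h s] by (simp only: i1 i2 Z0[symmetric])
    finally show "\<nu>.expectation (\<lambda>x. exp (s / (1 - s) * h0 x)) powr (1 - s) * ?M0 powr s
      \<le> exp (C * D\<^sup>2 * s\<^sup>2) * \<nu>.expectation (\<lambda>x. exp (s / (1 - s) * Y x))"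
      using Z1pos by (simp add: e_def)
  qed (use C in auto)
  moreover have "2 * (\<nu>.prob A - \<nu>.expectation (\<lambda>x. indicator A x * exp (- h0 x)) / ?M0)\<^sup>2
     \<le> \<nu>.expectation h0 + ln (?M0)"
    by (rule \<nu>.pinsker_event[OF _ h0K]) auto
  ultimately have "(\<nu>.prob A - \<nu>.expectation (\<lambda>x. indicator A x * exp (- h0 x)) / ?M0)\<^sup>2
     \<le> \<nu>.expectation Y / 2" by simp
  then have "\<bar>\<nu>.prob A - \<nu>.expectation (\<lambda>x. indicator A x * exp (- h0 x)) / ?M0\<bar>
     \<le> sqrt (\<nu>.expectation Y / 2)" by (metis real_sqrt_abs real_sqrt_le_mono)
  moreover have "\<nu>.expectation Y / 2 = (\<integral>x. (G x)\<^sup>2 * \<psi> x \<partial>lborel) / (4 * lam * Z1)" unfolding EY by simp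
  moreover have "\<nu>.expectation (\<lambda>x. indicator A x * exp (- h0 x)) / ?M0
     = (\<integral>x. indicator A x * (indicator B x * exp (- V x)) \<partial>lborel) / Z0"
    unfolding EA E0 using Z1pos by simp
  ultimately show ?thesis unfolding PA \<psi>_def by simp
qed

section \<open>Diagonalization of symmetric matrices\<close>

text \<open>A minimizer of the Rayleigh quotient on the unit sphere of \<open>S\<close> is an eigenvector: a
  variation in the direction of the residual \<open>u = T v - l v\<close> changes the quotient to first
  order by \<open>2 * (u \<bullet> u)\<close>, which has to vanish.\<close>

lemma selfadjoint_eigenvector_in_subspace:
  fixes T :: "'a::euclidean_space \<Rightarrow> 'a"
  assumes lin: "linear T" and sa: "\<And>x y. T x \<bullet> y = x \<bullet> T y"
    and S: "subspace S" "T ` S \<subseteq> S" "\<not> S \<subseteq> {0}"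
  obtains v l where "v \<in> S" "norm v = 1" "T v = l *\<^sub>R v"
proof -
  interpret T: linear T by (rule lin)
  let ?K = "sphere 0 1 \<inter> S"
  obtain w where w: "w \<in> S" "w \<noteq> 0" using S(3) by auto
  then have "(1 / norm w) *\<^sub>R w \<in> ?K" using S(1) by (auto intro: subspace_scale)
  then have ne: "?K \<noteq> {}" by blast
  have K: "compact ?K" using closed_subspace[OF S(1)] by (intro compact_Int_closed compact_sphere)
  have cont: "continuous_on ?K (\<lambda>x. x \<bullet> T x)"
    by (intro continuous_intros linear_continuous_on linear_conv_bounded_linear[THEN iffD1] lin)
  obtain v where v: "v \<in> ?K" "\<And>y. y \<in> ?K \<Longrightarrow> v \<bullet> T v \<le> y \<bullet> T y"
    using continuous_attains_inf[OF K ne cont] by blast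
  define l where "l = v \<bullet> T v"
  have q: "l * (x \<bullet> x) \<le> x \<bullet> T x" if "x \<in> S" for x
  proof (cases "x = 0")
    case False
    have "(1 / norm x) *\<^sub>R x \<in> ?K" using S(1) that False by (auto intro: subspace_scale)
    from v(2)[OF this] have "l \<le> (x \<bullet> T x) / (x \<bullet> x)"
      by (simp add: l_def T.scale dot_square_norm power2_eq_square)
    then show ?thesis using False by (simp add: pos_le_divide_eq)
  qed (simp add: T.zero)
  define u where "u = T v - l *\<^sub>R v"
  have vS: "v \<in> S" "v \<bullet> v = 1" using v(1) by (auto simp: norm_eq_1)
  have uS: "u \<in> S" unfolding u_def using vS S by (auto intro!: subspace_diff subspace_scale)
  define c where "c = u \<bullet> T u - l * (u \<bullet> u)"
  define b where "b = u \<bullet> u"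
  have c: "c \<ge> 0" using q[OF uS] by (simp add: c_def)
  have expand: "(v + e *\<^sub>R u) \<bullet> T (v + e *\<^sub>R u) - l * ((v + e *\<^sub>R u) \<bullet> (v + e *\<^sub>R u)) = 2 * e * b + e\<^sup>2 * c" for e
  proof -
    have "u \<bullet> T v = b + l * (u \<bullet> v)" by (simp add: b_def u_def inner_diff_right inner_diff_left inner_commute algebra_simps)
    moreover have "v \<bullet> T u = u \<bullet> T v" using sa[of v u] by (simp add: inner_commute)
    ultimately show ?thesis
      by (simp add: T.add T.scale inner_add_left inner_add_right l_def[symmetric] vS c_def inner_commute[of v u] power2_eq_square algebra_simps)
  qed
  have "v + e *\<^sub>R u \<in> S" for e using vS uS S by (auto intro!: subspace_add subspace_scale)
  then have ge: "0 \<le> 2 * e * b + e\<^sup>2 * c" for e using q[of "v + e *\<^sub>R u"] expand[of e] by simp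
  have "b = 0"
  proof (rule ccontr)
    assume "b \<noteq> 0"
    then have b: "b > 0" by (simp add: b_def)
    define e where "e = - b / (c + 1)"
    have be: "b = - ((c + 1) * e)" and e: "e \<noteq> 0" using b c by (auto simp: e_def)
    have "2 * e * b + e\<^sup>2 * c = - ((c + 2) * e\<^sup>2)"
      unfolding be by (simp add: power2_eq_square algebra_simps)
    also have "\<dots> < 0" using e c by simp
    finally show False using ge[of e] by simp
  qed
  then have "T v = l *\<^sub>R v" by (simp add: b_def u_def)
  moreover have "norm v = 1" using v(1) by simp
  ultimately show thesis using vS(1) that by blast
qed

text \<open>Induction on the dimension: the orthogonal complement of an eigenvector inside \<open>S\<close> is again
  invariant.\<close>

lemma selfadjoint_orthonormal_eigenbasis:
  fixes T :: "'a::euclidean_space \<Rightarrow> 'a"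
  assumes lin: "linear T" and sa: "\<And>x y. T x \<bullet> y = x \<bullet> T y"
    and "subspace S" "T ` S \<subseteq> S"
  shows "\<exists>B. B \<subseteq> S \<and> pairwise orthogonal B \<and> (\<forall>v\<in>B. norm v = 1 \<and> (\<exists>l. T v = l *\<^sub>R v)) \<and> span B = S"
  using assms(3,4)
proof (induction "dim S" arbitrary: S rule: less_induct)
  case less
  show ?case
  proof (cases "S \<subseteq> {0}")
    case True
    then have "S = {0}" using subspace_0[OF less.prems(1)] by auto
    then show ?thesis by (intro exI[of _ "{}"]) auto
  next
    case False
    obtain v l where v: "v \<in> S" "norm v = 1" "T v = l *\<^sub>R v"
      by (rule selfadjoint_eigenvector_in_subspace[OF lin sa less.prems False])
    have vv: "v \<bullet> v = 1" using v(2) by (simp add: norm_eq_1)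
    define S' where "S' = {x \<in> S. x \<bullet> v = 0}"
    have sub: "subspace S'"
      using less.prems(1) by (auto simp: S'_def subspace_def inner_add_left)
    have inv: "T ` S' \<subseteq> S'" using less.prems(2) by (auto simp: S'_def sa v(3))
    have "v \<notin> S'" using vv by (simp add: S'_def)
    moreover have "S' \<subseteq> S" by (auto simp: S'_def)
    ultimately have "S' \<subset> S" using v(1) by blast
    then have "dim S' < dim S" using sub less.prems(1)
      by (intro dim_psubset) (simp add: span_eq_iff[THEN iffD2])
    from less.hyps[OF this sub inv] obtain B where B: "B \<subseteq> S'" "pairwise orthogonal B"
      "\<forall>v\<in>B. norm v = 1 \<and> (\<exists>l. T v = l *\<^sub>R v)" "span B = S'" by blast
    have "span (insert v B) = S"
    proof
      show "span (insert v B) \<subseteq> S" using B(1) v(1) less.prems(1) by (intro span_minimal) (auto simp: S'_def)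
      show "S \<subseteq> span (insert v B)"
      proof
        fix x assume x: "x \<in> S"
        have "x - (x \<bullet> v) *\<^sub>R v \<in> S'"
          using x v(1) less.prems(1) vv by (auto simp: S'_def inner_diff_left intro!: subspace_diff subspace_scale)
        then show "x \<in> span (insert v B)" unfolding span_insert using B(4) by auto
      qed
    qed
    moreover have "pairwise orthogonal (insert v B)"
      using B(1,2) by (auto simp: pairwise_insert S'_def orthogonal_def inner_commute)
    ultimately show ?thesis using B(1,3) v
      by (intro exI[of _ "insert v B"]) (auto simp: S'_def)
  qed
qed

definition diagonal_matrix :: "('n::finite \<Rightarrow> real) \<Rightarrow> real^'n^'n" where
  "diagonal_matrix d = (\<chi> i j. if i = j then d i else 0)"

lemma diagonal_matrix_vector [simp]: "(diagonal_matrix d *v y) $ i = d i * y $ i"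
proof -
  have "(diagonal_matrix d *v y) $ i = (\<Sum>j\<in>UNIV. if i = j then d i * y $ j else 0)"
    unfolding matrix_vector_mult_def diagonal_matrix_def vec_lambda_beta by (intro sum.cong) auto
  then show ?thesis by simp
qed

lemma diagonal_matrix_mult: "diagonal_matrix c ** diagonal_matrix d = diagonal_matrix (\<lambda>i. c i * d i)"
proof (rule matrix_eq[THEN iffD2], rule allI)
  fix x
  show "(diagonal_matrix c ** diagonal_matrix d) *v x = diagonal_matrix (\<lambda>i. c i * d i) *v x"
    by (simp only: matrix_vector_mul_assoc[symmetric] vec_eq_iff diagonal_matrix_vector mult.assoc) simp
qed

lemma matrix_inv_eqI:
  fixes A B :: "real^'n::finite^'n"
  assumes "A ** B = mat 1" "B ** A = mat 1"
  shows "matrix_inv A = B"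
proof -
  have "A ** matrix_inv A = mat 1 \<and> matrix_inv A ** A = mat 1"
    unfolding matrix_inv_def by (rule someI[of _ B]) (simp add: assms)
  then have "matrix_inv A = (B ** A) ** matrix_inv A" "A ** matrix_inv A = mat 1" by (simp_all add: assms)
  then show ?thesis by (simp only: matrix_mul_assoc[symmetric] matrix_mul_rid)
qed

lemma symmetric_matrix_diagonalization:
  fixes J :: "real^'n::finite^'n"
  assumes sym: "transpose J = J"
  obtains Q d where "orthogonal_matrix Q" "J = transpose Q ** diagonal_matrix d ** Q"
proof -
  have sa: "(J *v x) \<bullet> y = x \<bullet> (J *v y)" for x y
    by (metis sym dot_lmul_matrix vector_transpose_matrix)
  obtain B where B: "pairwise orthogonal B" "\<forall>v\<in>B. norm v = 1 \<and> (\<exists>l. J *v v = l *\<^sub>R v)" "span B = UNIV"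
    using selfadjoint_orthonormal_eigenbasis[of "(*v) J" UNIV] sa by auto
  have "0 \<notin> B" using B(2) by force
  then have ind: "independent B" using B(1) by (intro pairwise_orthogonal_independent)
  have "card B = CARD('n)"
    using dim_eq_card_independent[OF ind] dim_span[of B] B(3) by simp
  moreover have "finite B" using ind by (rule finiteI_independent)
  ultimately obtain f where f: "bij_betw f (UNIV :: 'n set) B"
    using finite_same_card_bij[of "UNIV::'n set" B] by auto
  have fB: "f i \<in> B" for i using f by (auto simp: bij_betw_def)
  have "\<forall>i. \<exists>l. J *v f i = l *\<^sub>R f i" using B(2) fB by blast
  from choice[OF this] obtain d where d: "\<And>i. J *v f i = d i *\<^sub>R f i" by blast
  define Q :: "real^'n^'n" where "Q = (\<chi> i. f i)"
  have row: "row i Q = f i" for i by (simp add: row_def Q_def)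
  have Q: "orthogonal_matrix Q"
    unfolding orthogonal_matrix_orthonormal_rows row
  proof (intro conjI allI impI)
    show "norm (f i) = 1" for i using B(2) fB by blast
    show "orthogonal (f i) (f j)" if "i \<noteq> j" for i j
    proof -
      have "f i \<noteq> f j" using f that by (auto simp: bij_betw_def inj_on_def)
      then show ?thesis using B(1) fB by (auto simp: pairwise_def)
    qed
  qed
  have comp: "(Q *v x) $ i = f i \<bullet> x" for x i by (simp add: Q_def matrix_vector_mul_component)
  have "Q ** J = diagonal_matrix d ** Q"
  proof (rule matrix_eq[THEN iffD2], rule allI)
    fix x
    show "(Q ** J) *v x = (diagonal_matrix d ** Q) *v x"
      by (simp only: matrix_vector_mul_assoc[symmetric] vec_eq_iff diagonal_matrix_vector comp sa[symmetric] d inner_scaleR_left) simp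
  qed
  then have "transpose Q ** (Q ** J) = transpose Q ** diagonal_matrix d ** Q"
    by (simp add: matrix_mul_assoc)
  moreover have "transpose Q ** (Q ** J) = J"
    using Q by (simp add: matrix_mul_assoc orthogonal_matrix)
  ultimately have "J = transpose Q ** diagonal_matrix d ** Q" by simp
  then show thesis by (rule that[OF Q])
qed

context
  fixes J Q :: "real^'n::finite^'n" and d :: "'n \<Rightarrow> real"
  assumes Q: "orthogonal_matrix Q" and J: "J = transpose Q ** diagonal_matrix d ** Q"
begin

lemma diagonalized_quadratic_form: "x \<bullet> (J *v x) = (\<Sum>i\<in>UNIV. d i * ((Q *v x) $ i)\<^sup>2)"
proof -
  have "x \<bullet> (J *v x) = (Q *v x) \<bullet> (diagonal_matrix d *v (Q *v x))"
    unfolding J by (simp add: matrix_vector_mul_assoc[symmetric] dot_lmul_matrix[symmetric])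
      (metis dot_lmul_matrix vector_transpose_matrix transpose_transpose inner_commute)
  also have "\<dots> = (\<Sum>i\<in>UNIV. d i * ((Q *v x) $ i)\<^sup>2)"
    by (simp add: inner_vec_def power2_eq_square algebra_simps)
  finally show ?thesis .
qed

lemma diagonalized_det: "det J = (\<Prod>i\<in>UNIV. d i)"
proof -
  have "det (diagonal_matrix d) = (\<Prod>i\<in>UNIV. d i)"
    by (subst det_diagonal) (auto simp: diagonal_matrix_def)
  moreover have "det Q * det Q = 1" using det_orthogonal_matrix[OF Q] by auto
  ultimately show ?thesis unfolding J by (simp add: det_mul algebra_simps)
qed

lemma diagonalized_eigenvalue_iff: "(\<exists>v. v \<noteq> 0 \<and> J *v v = l *\<^sub>R v) \<longleftrightarrow> l \<in> range d"
proof
  assume "\<exists>v. v \<noteq> 0 \<and> J *v v = l *\<^sub>R v"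
  then obtain v where v: "v \<noteq> 0" "J *v v = l *\<^sub>R v" by blast
  have "Q *v (J *v v) = diagonal_matrix d *v (Q *v v)"
    unfolding J using Q by (simp add: matrix_vector_mul_assoc matrix_mul_assoc orthogonal_matrix_def)
  then have *: "l * (Q *v v) $ i = d i * (Q *v v) $ i" for i
  proof -
    have "l * (Q *v v) $ i = (Q *v (l *\<^sub>R v)) $ i"
      unfolding matrix_vector_mult_scaleR by simp
    also have "\<dots> = (diagonal_matrix d *v (Q *v v)) $ i"
      using \<open>Q *v (J *v v) = _\<close> unfolding v(2) by simp
    finally show ?thesis by simp
  qed
  have "Q *v v \<noteq> 0"
  proof
    assume "Q *v v = 0"
    then have "transpose Q *v (Q *v v) = 0" by simp
    then show False using v(1) Q by (simp add: matrix_vector_mul_assoc orthogonal_matrix)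
  qed
  then obtain i where "(Q *v v) $ i \<noteq> 0" by (auto simp: vec_eq_iff)
  then have "l = d i" using *[of i] by simp
  then show "l \<in> range d" by simp
next
  assume "l \<in> range d"
  then obtain i where l: "l = d i" by auto
  let ?v = "transpose Q *v axis i 1"
  have Qv: "Q *v ?v = axis i 1"
    using Q by (simp only: matrix_vector_mul_assoc orthogonal_matrix_def matrix_vector_mul_lid)
  have "diagonal_matrix d *v axis i 1 = d i *\<^sub>R axis i 1"
    by (simp add: vec_eq_iff axis_def)
  then have "J *v ?v = l *\<^sub>R ?v" unfolding J l
    by (simp only: matrix_vector_mul_assoc[symmetric] Qv matrix_vector_mult_scaleR)
  moreover have "?v \<noteq> 0"
  proof
    assume "?v = 0"
    then have "axis i 1 = (0 :: real^'n)" using Qv by (simp only: matrix_vector_mult_0_right)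
    then show False by (simp add: axis_eq_0_iff)
  qed
  ultimately show "\<exists>v. v \<noteq> 0 \<and> J *v v = l *\<^sub>R v" by blast
qed

lemma diagonalized_min_eigenvalue: "min_eigenvalue J = Min (range d)"
  unfolding min_eigenvalue_def diagonalized_eigenvalue_iff by simp

lemma diagonalized_inverse:
  assumes d: "\<And>i. d i \<noteq> 0"
  shows "matrix_inv J = transpose Q ** diagonal_matrix (\<lambda>i. 1 / d i) ** Q" "invertible J"
proof -
  let ?I = "transpose Q ** diagonal_matrix (\<lambda>i. 1 / d i) ** Q"
  have one: "diagonal_matrix (\<lambda>i. 1) = mat 1" by (simp add: diagonal_matrix_def mat_def)
  have QQ: "Q ** transpose Q = mat 1" "transpose Q ** Q = mat 1" using Q by (auto simp: orthogonal_matrix_def)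
  have conj: "(transpose Q ** A ** Q) ** (transpose Q ** B ** Q) = transpose Q ** (A ** B) ** Q" for A B
    by (metis QQ(1) matrix_mul_assoc matrix_mul_rid)
  have inv: "J ** ?I = mat 1" "?I ** J = mat 1"
    unfolding J conj diagonal_matrix_mult using d by (simp_all add: one QQ)
  then show "invertible J" unfolding invertible_def by blast
  show "matrix_inv J = ?I" using inv by (rule matrix_inv_eqI)
qed

lemma diagonalized_trace_inverse:
  assumes d: "\<And>i. d i \<noteq> 0"
  shows "trace (matrix_inv J) = (\<Sum>i\<in>UNIV. 1 / d i)"
proof -
  have "trace (matrix_inv J) = trace (Q ** (transpose Q ** diagonal_matrix (\<lambda>i. 1 / d i)))"
    unfolding diagonalized_inverse(1)[OF d] by (rule trace_mul_sym)
  also have "\<dots> = trace (diagonal_matrix (\<lambda>i. 1 / d i))"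
    using Q by (simp add: matrix_mul_assoc orthogonal_matrix_def)
  finally show ?thesis by (simp add: trace_def diagonal_matrix_def)
qed

end

lemma min_eigenvalue_le_quadratic_form:
  fixes J :: "real^'n::finite^'n"
  assumes sym: "transpose J = J"
  shows "min_eigenvalue J * (norm x)\<^sup>2 \<le> x \<bullet> (J *v x)"
proof -
  obtain Q d where Qd: "orthogonal_matrix Q" "J = transpose Q ** diagonal_matrix d ** Q"
    by (rule symmetric_matrix_diagonalization[OF sym])
  have "norm (Q *v x) = norm x" using Qd(1) orthogonal_transformation_matrix[of "(*v) Q"]
    by (simp add: orthogonal_transformation)
  moreover have "(norm y)\<^sup>2 = (\<Sum>i\<in>UNIV. (y $ i)\<^sup>2)" for y :: "real^'n"
    unfolding power2_norm_eq_inner inner_vec_def by (simp add: power2_eq_square)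
  ultimately have "min_eigenvalue J * (norm x)\<^sup>2 = (\<Sum>i\<in>UNIV. Min (range d) * ((Q *v x) $ i)\<^sup>2)"
    by (metis diagonalized_min_eigenvalue[OF Qd] sum_distrib_left)
  also have "\<dots> \<le> (\<Sum>i\<in>UNIV. d i * ((Q *v x) $ i)\<^sup>2)" by (intro sum_mono mult_right_mono) auto
  also have "\<dots> = x \<bullet> (J *v x)" by (rule diagonalized_quadratic_form[OF Qd, symmetric])
  finally show ?thesis .
qed

section \<open>Gaussian integrals\<close>

lemma nn_integral_lborel_translate:
  fixes f :: "'a::euclidean_space \<Rightarrow> ennreal"
  assumes [measurable]: "f \<in> borel_measurable borel"
  shows "(\<integral>\<^sup>+x. f (t + x) \<partial>lborel) = (\<integral>\<^sup>+x. f x \<partial>lborel)"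
proof -
  have "(\<integral>\<^sup>+x. f x \<partial>lborel) = (\<integral>\<^sup>+x. f x \<partial>density (distr lborel borel (\<lambda>x. t + (1) *\<^sub>R x)) (\<lambda>_. ennreal (\<bar>1\<bar> ^ DIM('a))))"
    by (rule arg_cong[OF lborel_affine]) simp
  then show ?thesis by (simp add: nn_integral_density nn_integral_distr)
qed

lemma nn_integral_lborel_reflect:
  fixes f :: "'a::euclidean_space \<Rightarrow> ennreal"
  assumes [measurable]: "f \<in> borel_measurable borel"
  shows "(\<integral>\<^sup>+x. f (t - x) \<partial>lborel) = (\<integral>\<^sup>+x. f x \<partial>lborel)"
proof -
  have "(\<integral>\<^sup>+x. f x \<partial>lborel) = (\<integral>\<^sup>+x. f x \<partial>density (distr lborel borel (\<lambda>x. t + (- 1) *\<^sub>R x)) (\<lambda>_. ennreal (\<bar>- 1\<bar> ^ DIM('a))))"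
    by (rule arg_cong[OF lborel_affine]) simp
  then show ?thesis by (simp add: nn_integral_density nn_integral_distr)
qed

text \<open>The image of Lebesgue measure under \<open>Q\<close> is invariant under translations. Fubini's theorem shows that
  two translation invariant measures are proportional, as expressed by \<open>key\<close>, and the unit ball, which \<open>Q\<close>
  preserves, fixes the constant to be 1.\<close>

lemma nn_integral_lborel_orthogonal_matrix:
  fixes Q :: "real^'n::finite^'n" and f :: "real^'n \<Rightarrow> ennreal"
  assumes Q: "orthogonal_matrix Q" and f[measurable]: "f \<in> borel_measurable borel"
  shows "(\<integral>\<^sup>+x. f (Q *v x) \<partial>lborel) = (\<integral>\<^sup>+x. f x \<partial>lborel)"
proof -
  have [measurable]: "(*v) Q \<in> borel_measurable borel"
    by (intro borel_measurable_continuous_onI linear_continuous_on matrix_vector_mul_bounded_linear)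
  have inv: "Q *v (transpose Q *v x) = x" for x
    using Q by (simp only: matrix_vector_mul_assoc orthogonal_matrix_def matrix_vector_mul_lid)
  have transl: "(\<integral>\<^sup>+x. F (Q *v x) \<partial>lborel) = (\<integral>\<^sup>+x. F (Q *v x - t) \<partial>lborel)"
    if [measurable]: "F \<in> borel_measurable borel" for F :: "real^'n \<Rightarrow> ennreal" and t
  proof -
    have "(\<integral>\<^sup>+x. F (Q *v x) \<partial>lborel) = (\<integral>\<^sup>+x. F (Q *v (transpose Q *v (- t) + x)) \<partial>lborel)"
      by (rule nn_integral_lborel_translate[symmetric]) measurable
    also have "\<dots> = (\<integral>\<^sup>+x. F (Q *v x - t) \<partial>lborel)"
      by (simp only: matrix_vector_right_distrib inv) (simp add: algebra_simps)
    finally show ?thesis .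
  qed
  have key: "(\<integral>\<^sup>+x. f (Q *v x) \<partial>lborel) * (\<integral>\<^sup>+y. g y \<partial>lborel) = (\<integral>\<^sup>+x. g (Q *v x) \<partial>lborel) * (\<integral>\<^sup>+y. f y \<partial>lborel)"
    if g[measurable]: "g \<in> borel_measurable borel" for g :: "real^'n \<Rightarrow> ennreal"
  proof -
    have "(\<integral>\<^sup>+x. f (Q *v x) \<partial>lborel) * (\<integral>\<^sup>+y. g y \<partial>lborel) = (\<integral>\<^sup>+x. f (Q *v x) * (\<integral>\<^sup>+y. g (Q *v x + y) \<partial>lborel) \<partial>lborel)"
      by (simp add: nn_integral_lborel_translate[OF g] nn_integral_multc)
    also have "\<dots> = (\<integral>\<^sup>+x. (\<integral>\<^sup>+y. f (Q *v x) * g (Q *v x + y) \<partial>lborel) \<partial>lborel)"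
      by (intro nn_integral_cong nn_integral_cmult[symmetric]) measurable
    also have "\<dots> = (\<integral>\<^sup>+y. (\<integral>\<^sup>+x. f (Q *v x) * g (Q *v x + y) \<partial>lborel) \<partial>lborel)"
      by (rule lborel_pair.Fubini'[symmetric]) measurable
    also have "\<dots> = (\<integral>\<^sup>+y. (\<integral>\<^sup>+x. f (Q *v x - y) * g (Q *v x - y + y) \<partial>lborel) \<partial>lborel)"
      by (intro nn_integral_cong transl) measurable
    also have "\<dots> = (\<integral>\<^sup>+x. (\<integral>\<^sup>+y. f (Q *v x - y) * g (Q *v x) \<partial>lborel) \<partial>lborel)"
      unfolding diff_add_cancel by (rule lborel_pair.Fubini') measurable
    also have "\<dots> = (\<integral>\<^sup>+x. (\<integral>\<^sup>+y. f (Q *v x - y) \<partial>lborel) * g (Q *v x) \<partial>lborel)"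
      by (intro nn_integral_cong nn_integral_multc) measurable
    also have "\<dots> = (\<integral>\<^sup>+x. g (Q *v x) \<partial>lborel) * (\<integral>\<^sup>+y. f y \<partial>lborel)"
      by (simp add: nn_integral_lborel_reflect[OF f] nn_integral_cmult mult.commute)
    finally show ?thesis .
  qed
  have "norm (Q *v x) = norm x" for x
    using Q orthogonal_transformation_matrix[of "(*v) Q"] by (simp add: orthogonal_transformation)
  then have "indicator (ball 0 1) (Q *v x) = (indicator (ball 0 1) x :: ennreal)" for x
    by (simp add: indicator_def)
  then have ball: "(\<integral>\<^sup>+x. indicator (ball 0 1) (Q *v x) \<partial>lborel) = emeasure lborel (ball (0::real^'n) 1)"
    by simp
  have ind: "(indicator (ball (0::real^'n) 1) :: _ \<Rightarrow> ennreal) \<in> borel_measurable borel"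
    by (rule borel_measurable_indicator) (simp add: borel_open)
  have fin: "emeasure lborel (ball (0::real^'n) 1) < \<infinity>"
    by (intro emeasure_bounded_finite bounded_ball)
  have "measure lborel (ball (0::real^'n) 1) \<noteq> 0"
    using content_ball_pos[of 1 "0::real^'n"] by simp
  then have ne: "emeasure lborel (ball (0::real^'n) 1) \<noteq> 0" by (auto simp: measure_def)
  have "emeasure lborel (ball (0::real^'n) 1) * (\<integral>\<^sup>+x. f (Q *v x) \<partial>lborel)
     = emeasure lborel (ball (0::real^'n) 1) * (\<integral>\<^sup>+x. f x \<partial>lborel)"
    using key[OF ind] unfolding ball by (simp add: mult.commute)
  then show ?thesis using fin ne unfolding ennreal_mult_cancel_left by auto
qed

lemma nn_integral_lborel_vec_prod:
  fixes f :: "'n::finite \<Rightarrow> real \<Rightarrow> ennreal"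
  assumes f: "\<And>i. f i \<in> borel_measurable borel"
  shows "(\<integral>\<^sup>+x. (\<Prod>i\<in>UNIV. f i (x $ i)) \<partial>(lborel :: (real^'n) measure)) = (\<Prod>i\<in>UNIV. \<integral>\<^sup>+y. f i y \<partial>lborel)"
proof -
  have B: "Basis = (\<lambda>i. axis i (1::real) :: real^'n) ` UNIV" by (auto simp: Basis_vec_def)
  have inj: "inj (\<lambda>i. axis i (1::real) :: real^'n)" by (auto simp: inj_on_def axis_eq_axis)
  have reindex: "(\<Prod>b\<in>(Basis :: (real^'n) set). F b) = (\<Prod>i\<in>UNIV. F (axis i 1))" for F :: "real^'n \<Rightarrow> ennreal"
    unfolding B by (subst prod.reindex[OF inj]) simp
  show ?thesis
    using nn_integral_lborel_prod[of "\<lambda>b::real^'n. f (axis_index b)"] f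
    by (simp add: reindex inner_axis)
qed

lemma gaussian_as_normal_density:
  assumes "a > 0"
  shows "exp (- (a * y\<^sup>2 / 2)) = sqrt (2 * pi / a) * normal_density 0 (1 / sqrt a) y"
proof -
  have "(1 / sqrt a)\<^sup>2 = 1 / a" using assms by (simp add: power_divide)
  moreover have "2 * pi * (1 / a) = 2 * pi / a" by simp
  moreover have "- (y - 0)\<^sup>2 / (2 * (1 / a)) = - (a * y\<^sup>2 / 2)" using assms by (simp add: field_simps)
  moreover have "sqrt (2 * pi / a) \<noteq> 0" using assms by simp
  ultimately show ?thesis unfolding normal_density_def by (simp only:) simp
qed

lemma nn_integral_gaussian:
  assumes "a > 0"
  shows "(\<integral>\<^sup>+y. ennreal (exp (- (a * y\<^sup>2 / 2))) \<partial>lborel) = ennreal (sqrt (2 * pi / a))"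
proof -
  have s: "0 < 1 / sqrt a" using assms by simp
  have "integrable lborel (\<lambda>y. exp (- (a * y\<^sup>2 / 2)))" "(\<integral>y. exp (- (a * y\<^sup>2 / 2)) \<partial>lborel) = sqrt (2 * pi / a)"
    unfolding gaussian_as_normal_density[OF assms] using s integrable_normal_density[OF s] integral_normal_density[OF s] by simp_all
  then show ?thesis by (subst nn_integral_eq_integral) auto
qed

lemma nn_integral_gaussian_fourth_moment:
  assumes "a > 0"
  shows "(\<integral>\<^sup>+y. ennreal (y ^ 4 * exp (- (a * y\<^sup>2 / 2))) \<partial>lborel) = ennreal (3 / a\<^sup>2 * sqrt (2 * pi / a))"
proof -
  have s: "0 < 1 / sqrt a" using assms by simp
  have eq: "y ^ 4 * exp (- (a * y\<^sup>2 / 2)) = sqrt (2 * pi / a) * (normal_density 0 (1 / sqrt a) y * (y - 0) ^ (2 * 2))" for y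
    by (simp add: gaussian_as_normal_density[OF assms])
  have m: "fact (2 * 2) / ((2 / (1 / sqrt a)\<^sup>2) ^ 2 * fact 2) = 3 / a\<^sup>2"
    using assms by (simp add: power_divide fact_numeral field_simps)
  have "integrable lborel (\<lambda>y. y ^ 4 * exp (- (a * y\<^sup>2 / 2)))" "(\<integral>y. y ^ 4 * exp (- (a * y\<^sup>2 / 2)) \<partial>lborel) = sqrt (2 * pi / a) * (3 / a\<^sup>2)"
    unfolding eq m[symmetric] using integrable_normal_moment[OF s, of 0 "2*2"] integral_normal_moment_even[OF s, of 0 2]
    by (simp_all only: integrable_mult_right integral_mult_right_zero)
  then show ?thesis by (subst nn_integral_eq_integral) (auto simp: mult.commute)
qed

abbreviation diag_gauss :: "('n::finite \<Rightarrow> real) \<Rightarrow> real^'n \<Rightarrow> real" where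
  "diag_gauss d y \<equiv> exp (- ((\<Sum>i\<in>UNIV. d i * (y $ i)\<^sup>2) / 2))"

abbreviation diag_mass :: "('n::finite \<Rightarrow> real) \<Rightarrow> real" where
  "diag_mass d \<equiv> \<Prod>i\<in>UNIV. sqrt (2 * pi / d i)"

lemma sum_ennreal_mult:
  assumes "\<And>k. 0 \<le> a k" "\<And>k. 0 \<le> b k"
  shows "(\<Sum>k\<in>A. ennreal (a k) * ennreal (b k)) = ennreal (\<Sum>k\<in>A. a k * b k)"
proof -
  have "(\<Sum>k\<in>A. ennreal (a k) * ennreal (b k)) = (\<Sum>k\<in>A. ennreal (a k * b k))"
    using assms by (intro sum.cong refl ennreal_mult[symmetric]) auto
  also have "\<dots> = ennreal (\<Sum>k\<in>A. a k * b k)"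
    using assms by (intro sum_ennreal) auto
  finally show ?thesis .
qed

context
  fixes d :: "'n::finite \<Rightarrow> real"
  assumes d: "\<And>i. 0 < d i"
begin

lemma diagonal_gaussian_eq_prod:
  "exp (- ((\<Sum>i\<in>UNIV. d i * (y i)\<^sup>2) / 2)) = (\<Prod>i\<in>UNIV. exp (- (d i * (y i)\<^sup>2 / 2)))"
  by (simp only: exp_sum[OF finite, symmetric] sum_negf sum_divide_distrib)

lemma nn_integral_diagonal_gaussian:
  "(\<integral>\<^sup>+y. ennreal (diag_gauss d y) \<partial>lborel) = ennreal (diag_mass d)"
proof -
  have "(\<integral>\<^sup>+y. ennreal (diag_gauss d y) \<partial>lborel)
     = (\<integral>\<^sup>+y. (\<Prod>i\<in>UNIV. ennreal (exp (- (d i * (y $ i)\<^sup>2 / 2)))) \<partial>lborel)"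
    unfolding diagonal_gaussian_eq_prod by (simp add: prod_ennreal)
  also have "\<dots> = (\<Prod>i\<in>UNIV. \<integral>\<^sup>+y. ennreal (exp (- (d i * y\<^sup>2 / 2))) \<partial>lborel)"
    by (rule nn_integral_lborel_vec_prod) measurable
  also have "\<dots> = (\<Prod>i\<in>UNIV. ennreal (sqrt (2 * pi / d i)))"
    by (intro prod.cong refl nn_integral_gaussian d)
  also have "\<dots> = ennreal (diag_mass d)"
    using d by (intro prod_ennreal) (simp add: less_imp_le)
  finally show ?thesis .
qed

lemma nn_integral_diagonal_gaussian_coordinate:
  "(\<integral>\<^sup>+y. ennreal ((y $ k) ^ 4 * diag_gauss d y) \<partial>lborel)
     = ennreal (3 / (d k)\<^sup>2 * diag_mass d)"
proof -
  let ?f = "\<lambda>i y. (if i = k then y ^ 4 else 1) * exp (- (d i * y\<^sup>2 / 2))"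
  have "(\<integral>\<^sup>+y. ennreal ((y $ k) ^ 4 * diag_gauss d y) \<partial>lborel)
     = (\<integral>\<^sup>+y. (\<Prod>i\<in>UNIV. ennreal (?f i (y $ i))) \<partial>lborel)"
  proof (rule nn_integral_cong)
    fix y :: "real^'n"
    have "(\<Prod>i\<in>UNIV. ennreal (?f i (y $ i))) = ennreal (\<Prod>i\<in>UNIV. ?f i (y $ i))"
      by (rule prod_ennreal) auto
    also have "(\<Prod>i\<in>UNIV. ?f i (y $ i)) = (y $ k) ^ 4 * diag_gauss d y"
      unfolding diagonal_gaussian_eq_prod by (simp only: prod.distrib prod.delta finite UNIV_I if_True)
    finally show "ennreal ((y $ k) ^ 4 * diag_gauss d y) = (\<Prod>i\<in>UNIV. ennreal (?f i (y $ i)))" ..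
  qed
  also have "\<dots> = (\<Prod>i\<in>UNIV. \<integral>\<^sup>+y. ennreal (?f i y) \<partial>lborel)"
    by (rule nn_integral_lborel_vec_prod) measurable
  also have "\<dots> = (\<Prod>i\<in>UNIV. ennreal ((if i = k then 3 / (d i)\<^sup>2 else 1) * sqrt (2 * pi / d i)))"
  proof (intro prod.cong refl)
    fix i
    show "(\<integral>\<^sup>+y. ennreal (?f i y) \<partial>lborel) = ennreal ((if i = k then 3 / (d i)\<^sup>2 else 1) * sqrt (2 * pi / d i))"
      using nn_integral_gaussian[OF d, of i] nn_integral_gaussian_fourth_moment[OF d, of i] by (cases "i = k") simp_all
  qed
  also have "\<dots> = ennreal (\<Prod>i\<in>UNIV. (if i = k then 3 / (d i)\<^sup>2 else 1) * sqrt (2 * pi / d i))"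
    using d by (intro prod_ennreal) (auto simp: less_imp_le)
  also have "(\<Prod>i\<in>UNIV. (if i = k then 3 / (d i)\<^sup>2 else 1) * sqrt (2 * pi / d i)) = 3 / (d k)\<^sup>2 * diag_mass d"
    by (simp only: prod.distrib prod.delta finite UNIV_I if_True)
  finally show ?thesis .
qed

text \<open>By the Cauchy-Schwarz inequality with weights \<open>1 / d i\<close>, the fourth power of the norm is at most
  the trace times \<open>d i * y_i^4\<close> summed over \<open>i\<close>. Hence one-dimensional moments are enough, without the
  mixed ones, and the constant 3 is that of the one-dimensional fourth moment.\<close>

lemma nn_integral_diagonal_gaussian_norm4:
  "(\<integral>\<^sup>+y. ennreal (norm y ^ 4 * diag_gauss d y) \<partial>lborel)
     \<le> ennreal (3 * (\<Sum>i\<in>UNIV. 1 / d i)\<^sup>2 * diag_mass d)"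
proof -
  let ?T = "\<Sum>i\<in>UNIV. 1 / d i" and ?c = "diag_mass d"
  let ?g = "\<lambda>y::real^'n. diag_gauss d y"
  have T: "0 \<le> ?T" using d by (intro sum_nonneg) (simp add: less_imp_le)
  have c: "0 \<le> ?c" using d by (intro prod_nonneg) (simp add: less_imp_le)
  have Td: "0 \<le> ?T * d k" for k using T d[of k] by simp
  have le: "norm y ^ 4 \<le> (\<Sum>k\<in>UNIV. ?T * d k * (y $ k) ^ 4)" for y :: "real^'n"
  proof -
    have "norm y ^ 4 = ((norm y)\<^sup>2)\<^sup>2" by simp
    also have "(norm y)\<^sup>2 = (\<Sum>i\<in>UNIV. (1 / sqrt (d i)) * (sqrt (d i) * (y $ i)\<^sup>2))"
      unfolding power2_norm_eq_inner inner_vec_def using d by (intro sum.cong) (auto simp: power2_eq_square less_imp_neq[symmetric])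
    also have "\<dots>\<^sup>2 \<le> (\<Sum>i\<in>UNIV. (1 / sqrt (d i))\<^sup>2) * (\<Sum>i\<in>UNIV. (sqrt (d i) * (y $ i)\<^sup>2)\<^sup>2)"
      by (rule Cauchy_Schwarz_ineq_sum)
    also have "\<dots> = ?T * (\<Sum>k\<in>UNIV. d k * (y $ k) ^ 4)"
      using d by (simp add: power_divide power_mult_distrib less_imp_le)
    also have "\<dots> = (\<Sum>k\<in>UNIV. ?T * d k * (y $ k) ^ 4)" by (simp add: sum_distrib_left mult.assoc)
    finally show ?thesis .
  qed
  have "(\<integral>\<^sup>+y. ennreal (norm y ^ 4 * ?g y) \<partial>lborel)
     \<le> (\<integral>\<^sup>+y. (\<Sum>k\<in>UNIV. ennreal (?T * d k) * ennreal ((y $ k) ^ 4 * ?g y)) \<partial>lborel)"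
  proof (rule nn_integral_mono)
    fix y :: "real^'n"
    have "norm y ^ 4 * ?g y \<le> (\<Sum>k\<in>UNIV. (?T * d k) * ((y $ k) ^ 4 * ?g y))"
      using mult_right_mono[OF le[of y], of "?g y"] by (simp add: sum_distrib_right mult.assoc)
    then have "ennreal (norm y ^ 4 * ?g y) \<le> ennreal (\<Sum>k\<in>UNIV. (?T * d k) * ((y $ k) ^ 4 * ?g y))"
      by (rule ennreal_leI)
    also have "\<dots> = (\<Sum>k\<in>UNIV. ennreal (?T * d k) * ennreal ((y $ k) ^ 4 * ?g y))"
      using Td by (intro sum_ennreal_mult[symmetric]) auto
    finally show "ennreal (norm y ^ 4 * ?g y) \<le> (\<Sum>k\<in>UNIV. ennreal (?T * d k) * ennreal ((y $ k) ^ 4 * ?g y))" .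
  qed
  also have "\<dots> = (\<Sum>k\<in>UNIV. ennreal (?T * d k) * ennreal (3 / (d k)\<^sup>2 * ?c))"
    by (simp add: nn_integral_sum nn_integral_cmult nn_integral_diagonal_gaussian_coordinate)
  also have "\<dots> = ennreal (\<Sum>k\<in>UNIV. (?T * d k) * (3 / (d k)\<^sup>2 * ?c))"
    using Td c by (intro sum_ennreal_mult) auto
  also have "(\<Sum>k\<in>UNIV. (?T * d k) * (3 / (d k)\<^sup>2 * ?c)) = (\<Sum>k\<in>UNIV. (3 * ?T * ?c) * (1 / d k))"
    using d by (intro sum.cong) (auto simp: power2_eq_square less_imp_neq[symmetric])
  also have "\<dots> = 3 * ?T\<^sup>2 * ?c"
    by (simp only: sum_distrib_left[symmetric]) (simp add: power2_eq_square)
  finally show ?thesis .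
qed

end

text \<open>A Chernoff bound with the moment generating function of the squared norm. The parameter
  \<open>s = m * (1 - sqrt T / r) / 2\<close> makes the exponent exactly \<open>- (r - sqrt T)^2 * m / 2\<close>.\<close>

lemma nn_integral_diagonal_gaussian_tail:
  fixes d :: "'n::finite \<Rightarrow> real"
  assumes d: "\<And>i. 0 < d i" and m: "0 < m" "\<And>i. m \<le> d i" and T: "T = (\<Sum>i\<in>UNIV. 1 / d i)" and r: "sqrt T < r"
  shows "(\<integral>\<^sup>+y. indicator {y. r < norm y} y * ennreal (diag_gauss d y) \<partial>lborel)
     \<le> ennreal (exp (- (1 / 2) * (r - sqrt T)\<^sup>2 * m) * diag_mass d)"
proof -
  have Tpos: "T > 0" unfolding T using d by (intro sum_pos) auto
  have r0: "r > 0" using r Tpos by (meson less_trans real_sqrt_gt_zero)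
  define q where "q = sqrt T / r"
  have q: "0 < q" "q < 1" using Tpos r r0 by (auto simp: q_def)
  define s where "s = m * (1 - q) / 2"
  have s: "s > 0" using m q by (simp add: s_def)
  have dq: "d i * q \<le> d i - 2 * s" for i
  proof -
    have "m * (1 - q) \<le> d i * (1 - q)" using m(2)[of i] q by (intro mult_right_mono) auto
    moreover have "2 * s = m * (1 - q)" by (simp add: s_def)
    ultimately show ?thesis by (simp add: algebra_simps)
  qed
  have ds: "0 < d i - 2 * s" for i using dq[of i] d[of i] q by (meson less_le_trans mult_pos_pos)
  let ?g = "\<lambda>y::real^'n. diag_gauss d y"
  let ?c = "diag_mass d"
  have c: "0 \<le> ?c" using d by (intro prod_nonneg) (simp add: less_imp_le)
  have "(\<integral>\<^sup>+y. indicator {y. r < norm y} y * ennreal (?g y) \<partial>lborel)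
     \<le> (\<integral>\<^sup>+y. ennreal (exp (- s * r\<^sup>2)) * ennreal (diag_gauss (\<lambda>i. d i - 2 * s) y) \<partial>lborel)"
  proof (rule nn_integral_mono)
    fix y :: "real^'n"
    have n2: "(norm y)\<^sup>2 = (\<Sum>i\<in>UNIV. (y $ i)\<^sup>2)"
      unfolding power2_norm_eq_inner inner_vec_def by (simp add: power2_eq_square)
    have eq: "diag_gauss (\<lambda>i. d i - 2 * s) y = exp (s * (norm y)\<^sup>2) * ?g y"
      by (simp add: n2 exp_add[symmetric] left_diff_distrib sum_subtractf sum_distrib_left[symmetric] mult.assoc)
        (simp add: field_simps)
    show "indicator {y. r < norm y} y * ennreal (?g y) \<le> ennreal (exp (- s * r\<^sup>2)) * ennreal (diag_gauss (\<lambda>i. d i - 2 * s) y)"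
    proof (cases "r < norm y")
      case True
      then have "r\<^sup>2 \<le> (norm y)\<^sup>2" using r0 by (intro power_mono) auto
      then have "s * r\<^sup>2 \<le> s * (norm y)\<^sup>2" using s by simp
      then have "1 \<le> exp (- s * r\<^sup>2) * exp (s * (norm y)\<^sup>2)" by (simp add: exp_add[symmetric])
      from mult_right_mono[OF this, of "?g y"] have "?g y \<le> exp (- s * r\<^sup>2) * (exp (s * (norm y)\<^sup>2) * ?g y)" by (simp add: mult.assoc)
      then show ?thesis using True unfolding eq by (simp add: ennreal_mult[symmetric] ennreal_leI)
    qed simp
  qed
  also have "\<dots> = ennreal (exp (- s * r\<^sup>2)) * (\<integral>\<^sup>+y. ennreal (diag_gauss (\<lambda>i. d i - 2 * s) y) \<partial>lborel)"
    by (rule nn_integral_cmult) measurable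
  also have "\<dots> = ennreal (exp (- s * r\<^sup>2) * diag_mass (\<lambda>i. d i - 2 * s))"
    using nn_integral_diagonal_gaussian[of "\<lambda>i. d i - 2 * s", OF ds] by (simp add: ennreal_mult')
  also have "\<dots> \<le> ennreal (exp (- (1 / 2) * (r - sqrt T)\<^sup>2 * m) * ?c)"
  proof (rule ennreal_leI)
    have "diag_mass (\<lambda>i. d i - 2 * s) \<le> (\<Prod>i\<in>UNIV. exp (s / q * (1 / d i)) * sqrt (2 * pi / d i))"
    proof (rule prod_mono, intro conjI)
      fix i
      let ?e = "d i - 2 * s"
      show "0 \<le> sqrt (2 * pi / ?e)" using ds[of i] by simp
      have "d i / ?e = 1 + 2 * s / ?e" using ds[of i] by (simp add: field_simps)
      also have "\<dots> \<le> exp (2 * s / ?e)" by (rule exp_ge_add_one_self)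
      also have "2 * s / ?e \<le> 2 * s / (d i * q)"
        using dq[of i] d[of i] q s by (intro divide_left_mono mult_pos_pos ds) auto
      also have "2 * s / (d i * q) = 2 * (s / q * (1 / d i))" by simp
      finally have "d i / ?e \<le> exp (2 * (s / q * (1 / d i)))" by simp
      also have "\<dots> = (exp (s / q * (1 / d i)))\<^sup>2" by (simp add: power2_eq_square exp_add[symmetric])
      finally have "d i / ?e * (2 * pi / d i) \<le> (exp (s / q * (1 / d i)))\<^sup>2 * (2 * pi / d i)"
        using d[of i] by (intro mult_right_mono) auto
      then have "2 * pi / ?e \<le> (exp (s / q * (1 / d i)))\<^sup>2 * (2 * pi / d i)" using d[of i] by simp
      then have "sqrt (2 * pi / ?e) \<le> sqrt ((exp (s / q * (1 / d i)))\<^sup>2 * (2 * pi / d i))" by simp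
      then show "sqrt (2 * pi / ?e) \<le> exp (s / q * (1 / d i)) * sqrt (2 * pi / d i)" by (simp add: real_sqrt_mult real_sqrt_divide)
    qed
    also have "\<dots> = exp (s / q * T) * ?c"
      unfolding prod.distrib exp_sum[OF finite, symmetric] T by (simp only: sum_distrib_left[symmetric])
    finally have "exp (- s * r\<^sup>2) * diag_mass (\<lambda>i. d i - 2 * s) \<le> exp (- s * r\<^sup>2) * (exp (s / q * T) * ?c)"
      by (rule mult_left_mono) simp
    also have "\<dots> = exp (- s * r\<^sup>2 + s / q * T) * ?c" by (simp only: exp_add mult.assoc)
    also have "- s * r\<^sup>2 + s / q * T = - (1 / 2) * (r - sqrt T)\<^sup>2 * m"
    proof -
      have "s / q * T = s * r * sqrt T"
        using Tpos r0 by (simp add: q_def field_simps)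
      then have "- s * r\<^sup>2 + s / q * T = - (s * r) * (r - sqrt T)" by (simp add: power2_eq_square algebra_simps)
      moreover have "s * r = m / 2 * (r - sqrt T)" using r0 by (simp add: s_def q_def field_simps)
      ultimately show ?thesis by (simp add: power2_eq_square)
    qed
    finally show "exp (- s * r\<^sup>2) * diag_mass (\<lambda>i. d i - 2 * s) \<le> exp (- (1 / 2) * (r - sqrt T)\<^sup>2 * m) * ?c" .
  qed
  finally show ?thesis .
qed

lemma sqrt_prod: "finite A \<Longrightarrow> sqrt (\<Prod>i\<in>A. f i) = (\<Prod>i\<in>A. sqrt (f i))"
  by (induction A rule: finite_induct) (simp_all add: real_sqrt_mult)

abbreviation gauss :: "real^'n::finite^'n \<Rightarrow> real^'n \<Rightarrow> real" where
  "gauss J x \<equiv> exp (- (x \<bullet> (J *v x)) / 2)"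

text \<open>The integral of \<open>gauss J\<close> for symmetric positive definite \<open>J\<close>.\<close>

definition gaussian_mass :: "real^'n::finite^'n \<Rightarrow> real" where
  "gaussian_mass J = sqrt ((2 * pi) ^ CARD('n) / det J)"

context
  fixes J :: "real^'n::finite^'n"
  assumes sym: "transpose J = J" and pos: "0 < min_eigenvalue J"
begin

lemma diagonal_form:
  "\<exists>Q d. orthogonal_matrix Q \<and> J = transpose Q ** diagonal_matrix d ** Q \<and> (\<forall>i. 0 < d i) \<and>
    (\<forall>i. min_eigenvalue J \<le> d i) \<and> trace (matrix_inv J) = (\<Sum>i\<in>UNIV. 1 / d i) \<and> det J = (\<Prod>i\<in>UNIV. d i) \<and>
    gaussian_mass J = diag_mass d"
proof -
  obtain Q d where Qd: "orthogonal_matrix Q" "J = transpose Q ** diagonal_matrix d ** Q"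
    by (rule symmetric_matrix_diagonalization[OF sym])
  have min: "min_eigenvalue J \<le> d i" for i
    unfolding diagonalized_min_eigenvalue[OF Qd] by (intro Min_le) auto
  have d: "0 < d i" for i using pos min by (rule less_le_trans)
  then have "d i \<noteq> 0" for i by (metis less_irrefl)
  note tr = diagonalized_trace_inverse[OF Qd this]
  have "gaussian_mass J = diag_mass d"
    unfolding gaussian_mass_def diagonalized_det[OF Qd] by (simp add: sqrt_prod[symmetric] prod_dividef)
  then show ?thesis using Qd d min tr diagonalized_det[OF Qd] by blast
qed

lemma gaussian_mass_pos: "0 < gaussian_mass J" "0 < det J"
proof -
  obtain Q d where d: "orthogonal_matrix Q" "J = transpose Q ** diagonal_matrix d ** Q" "\<And>i. 0 < d i"
    "\<And>i. min_eigenvalue J \<le> d i" "trace (matrix_inv J) = (\<Sum>i\<in>UNIV. 1 / d i)" "det J = (\<Prod>i\<in>UNIV. d i)"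
    "gaussian_mass J = diag_mass d" using diagonal_form by blast
  show "0 < det J" unfolding d(6) using d(3) by (intro prod_pos) auto
  then show "0 < gaussian_mass J" unfolding gaussian_mass_def by simp
qed

lemma trace_inverse_nonneg: "0 \<le> trace (matrix_inv J)"
proof -
  obtain Q d where d: "orthogonal_matrix Q" "J = transpose Q ** diagonal_matrix d ** Q" "\<And>i. 0 < d i"
    "\<And>i. min_eigenvalue J \<le> d i" "trace (matrix_inv J) = (\<Sum>i\<in>UNIV. 1 / d i)" "det J = (\<Prod>i\<in>UNIV. d i)"
    "gaussian_mass J = diag_mass d" using diagonal_form by blast
  show ?thesis unfolding d(5) using d(3) by (intro sum_nonneg) (simp add: less_imp_le)
qed

lemma gaussian_rotate:
  assumes Qd: "orthogonal_matrix Q" "J = transpose Q ** diagonal_matrix d ** Q"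
    and [measurable]: "\<phi> \<in> borel_measurable borel"
  shows "(\<integral>\<^sup>+x. \<phi> (norm x) * ennreal (gauss J x) \<partial>lborel)
    = (\<integral>\<^sup>+y. \<phi> (norm y) * ennreal (diag_gauss d y) \<partial>lborel)"
proof -
  let ?f = "\<lambda>y::real^'n. \<phi> (norm y) * ennreal (diag_gauss d y)"
  have [measurable]: "?f \<in> borel_measurable borel" by measurable
  have "norm (Q *v x) = norm x" for x
    using Qd(1) orthogonal_transformation_matrix[of "(*v) Q"] by (simp add: orthogonal_transformation)
  then have "\<phi> (norm x) * ennreal (gauss J x) = ?f (Q *v x)" for x
    unfolding diagonalized_quadratic_form[OF Qd] by simp
  then show ?thesis using nn_integral_lborel_orthogonal_matrix[OF Qd(1), of ?f] by simp
qed

lemma nn_integral_gaussian_mass: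
  "(\<integral>\<^sup>+x. ennreal (gauss J x) \<partial>lborel) = ennreal (gaussian_mass J)"
proof -
  obtain Q d where d: "orthogonal_matrix Q" "J = transpose Q ** diagonal_matrix d ** Q" "\<And>i. 0 < d i"
    "\<And>i. min_eigenvalue J \<le> d i" "trace (matrix_inv J) = (\<Sum>i\<in>UNIV. 1 / d i)" "det J = (\<Prod>i\<in>UNIV. d i)"
    "gaussian_mass J = diag_mass d" using diagonal_form by blast
  show ?thesis
    using gaussian_rotate[OF d(1,2), of "\<lambda>_. 1"] nn_integral_diagonal_gaussian[of d, OF d(3)] by (simp add: d(7))
qed

lemma nn_integral_gaussian_norm4:
  "(\<integral>\<^sup>+x. ennreal (norm x ^ 4 * gauss J x) \<partial>lborel)
    \<le> ennreal (3 * (trace (matrix_inv J))\<^sup>2 * gaussian_mass J)"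
proof -
  obtain Q d where d: "orthogonal_matrix Q" "J = transpose Q ** diagonal_matrix d ** Q" "\<And>i. 0 < d i"
    "\<And>i. min_eigenvalue J \<le> d i" "trace (matrix_inv J) = (\<Sum>i\<in>UNIV. 1 / d i)" "det J = (\<Prod>i\<in>UNIV. d i)"
    "gaussian_mass J = diag_mass d" using diagonal_form by blast
  have "(\<integral>\<^sup>+x. ennreal (norm x ^ 4 * gauss J x) \<partial>lborel)
     = (\<integral>\<^sup>+x. ennreal (norm x ^ 4) * ennreal (gauss J x) \<partial>lborel)"
    by (intro nn_integral_cong ennreal_mult) auto
  also have "\<dots> = (\<integral>\<^sup>+y. ennreal (norm y ^ 4) * ennreal (diag_gauss d y) \<partial>lborel)"
    by (rule gaussian_rotate[OF d(1,2), of "\<lambda>r. ennreal (r ^ 4)"]) measurable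
  also have "\<dots> = (\<integral>\<^sup>+y. ennreal (norm y ^ 4 * diag_gauss d y) \<partial>lborel)"
    by (intro nn_integral_cong ennreal_mult[symmetric]) auto
  also have "\<dots> \<le> ennreal (3 * (trace (matrix_inv J))\<^sup>2 * gaussian_mass J)"
    unfolding d(5,7) by (rule nn_integral_diagonal_gaussian_norm4[of d, OF d(3)])
  finally show ?thesis .
qed

lemma nn_integral_gaussian_tail:
  assumes r: "sqrt (trace (matrix_inv J)) < r"
  shows "(\<integral>\<^sup>+x. indicator {x. r < norm x} x * ennreal (gauss J x) \<partial>lborel)
    \<le> ennreal (exp (- (1 / 2) * (r - sqrt (trace (matrix_inv J)))\<^sup>2 * min_eigenvalue J) * gaussian_mass J)"
proof -
  obtain Q d where d: "orthogonal_matrix Q" "J = transpose Q ** diagonal_matrix d ** Q" "\<And>i. 0 < d i"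
    "\<And>i. min_eigenvalue J \<le> d i" "trace (matrix_inv J) = (\<Sum>i\<in>UNIV. 1 / d i)" "det J = (\<Prod>i\<in>UNIV. d i)"
    "gaussian_mass J = diag_mass d" using diagonal_form by blast
  have ind: "indicator {x. r < norm x} y = (indicator {r<..} (norm y) :: ennreal)" for y :: "real^'n"
    by (simp add: indicator_def)
  show ?thesis unfolding ind
    by (subst gaussian_rotate[OF d(1,2)]) (use nn_integral_diagonal_gaussian_tail[of d, OF d(3) pos d(4) d(5) r] in \<open>simp_all add: ind d(7)\<close>)
qed

end

section \<open>Taylor estimates from a bounded third derivative\<close>

text \<open>The partial derivatives are defined as derivatives along coordinate axes; at a point of total
  differentiability they are the coefficients of the derivative.\<close>

lemma has_derivative_partial_deriv:
  fixes f :: "real^'n::finite \<Rightarrow> real"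
  assumes "f differentiable (at x)"
  shows "(f has_derivative (\<lambda>v. \<Sum>i\<in>UNIV. partial_deriv i f x * v $ i)) (at x)"
proof -
  obtain f' where f': "(f has_derivative f') (at x)" using assms by (auto simp: differentiable_def)
  interpret f': bounded_linear f' using f' by (rule has_derivative_bounded_linear)
  have pd: "partial_deriv i f x = f' (axis i 1)" for i
  proof -
    have "((\<lambda>t. x + t *\<^sub>R axis i 1) has_derivative (\<lambda>t. t *\<^sub>R axis i 1)) (at (0::real))"
      by (auto intro!: derivative_eq_intros)
    then have "((\<lambda>t. f (x + t *\<^sub>R axis i 1)) has_derivative (\<lambda>t. f' (t *\<^sub>R axis i 1))) (at 0)"
      by (rule has_derivative_compose) (simp add: f')
    moreover have "(\<lambda>t. f' (t *\<^sub>R axis i 1)) = (*) (f' (axis i 1))" by (simp add: fun_eq_iff f'.scaleR)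
    ultimately have "((\<lambda>t. f (x + t *\<^sub>R axis i 1)) has_real_derivative f' (axis i 1)) (at 0)"
      unfolding has_field_derivative_def by simp
    then show ?thesis unfolding partial_deriv_def by (rule DERIV_imp_deriv)
  qed
  have "f' v = (\<Sum>i\<in>UNIV. partial_deriv i f x * v $ i)" for v
  proof -
    have "v = (\<Sum>i\<in>UNIV. (v $ i) *\<^sub>R axis i 1)"
      using basis_expansion[of v] by (simp add: scalar_mult_eq_scaleR)
    then have "f' v = (\<Sum>i\<in>UNIV. f' ((v $ i) *\<^sub>R axis i 1))" using f'.sum[of "\<lambda>i. (v $ i) *\<^sub>R axis i 1" UNIV] by simp
    then show ?thesis by (simp add: f'.scaleR pd mult.commute)
  qed
  then have "f' = (\<lambda>v. \<Sum>i\<in>UNIV. partial_deriv i f x * v $ i)" by (rule ext)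
  then show ?thesis using f' by simp
qed

definition dir_deriv :: "(real^'n::finite \<Rightarrow> real) \<Rightarrow> real^'n \<Rightarrow> real^'n \<Rightarrow> real" where
  "dir_deriv f x v = (\<Sum>i\<in>UNIV. partial_deriv i f x * v $ i)"

lemma has_real_derivative_along_line:
  fixes f :: "real^'n::finite \<Rightarrow> real"
  assumes "f differentiable (at (y + t *\<^sub>R v))"
  shows "((\<lambda>t. f (y + t *\<^sub>R v)) has_real_derivative dir_deriv f (y + t *\<^sub>R v) v) (at t)"
proof -
  have "((\<lambda>t. y + t *\<^sub>R v) has_derivative (\<lambda>t. t *\<^sub>R v)) (at t)"
    by (auto intro!: derivative_eq_intros)
  from has_derivative_compose[OF this has_derivative_partial_deriv[OF assms]]
  have "((\<lambda>t. f (y + t *\<^sub>R v)) has_derivative (\<lambda>s. \<Sum>i\<in>UNIV. partial_deriv i f (y + t *\<^sub>R v) * (s *\<^sub>R v) $ i)) (at t)" .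
  moreover have "(\<lambda>s. \<Sum>i\<in>UNIV. partial_deriv i f (y + t *\<^sub>R v) * (s *\<^sub>R v) $ i) = (*) (dir_deriv f (y + t *\<^sub>R v) v)"
    by (simp add: fun_eq_iff dir_deriv_def sum_distrib_left mult_ac)
  ultimately show ?thesis unfolding has_field_derivative_def by simp
qed

lemma dir_deriv_scaleR: "dir_deriv f x (a *\<^sub>R v) = a * dir_deriv f x v"
  by (simp add: dir_deriv_def sum_distrib_left mult.assoc mult.left_commute)

lemma hessian_form:
  "u \<bullet> (hessian f x *v w) = (\<Sum>j\<in>UNIV. \<Sum>k\<in>UNIV. partial_deriv j (partial_deriv k f) x * u $ j * w $ k)"
  by (simp add: hessian_def inner_vec_def matrix_vector_mult_def sum_distrib_left mult.assoc mult.left_commute)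

lemma third_deriv_scaleR:
  "third_deriv f x (a *\<^sub>R u) (b *\<^sub>R v) (c *\<^sub>R w) = a * b * c * third_deriv f x u v w"
  by (simp add: third_deriv_def sum_distrib_left mult.assoc mult.left_commute)

text \<open>By trilinearity it suffices to consider unit vectors; the supremum that defines the norm is finite
  because the form is bounded on products of unit balls by the sum of the absolute values of its coefficients.\<close>

lemma abs_third_deriv_le:
  fixes f :: "real^'n::finite \<Rightarrow> real"
  shows "\<bar>third_deriv f x u v w\<bar> \<le> norm_third_deriv f x * norm u * norm v * norm w"
proof (cases "u = 0 \<or> v = 0 \<or> w = 0")
  case True
  then have "third_deriv f x u v w = 0" by (auto simp: third_deriv_def)
  then show ?thesis using True by auto
next
  case False
  let ?S = "cball 0 1 \<times> cball 0 1 \<times> cball 0 1 :: ((real^'n) \<times> (real^'n) \<times> (real^'n)) set"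
  let ?F = "\<lambda>(u, v, w). \<bar>third_deriv f x u v w\<bar>"
  have "bdd_above (?F ` ?S)"
  proof (rule bdd_aboveI2)
    fix p assume "p \<in> ?S"
    then obtain u v w where p: "p = (u, v, w)" "norm u \<le> 1" "norm v \<le> 1" "norm w \<le> 1" by (auto simp: dist_norm)
    have c: "\<bar>u $ i\<bar> \<le> 1" "\<bar>v $ i\<bar> \<le> 1" "\<bar>w $ i\<bar> \<le> 1" for i
      using p component_le_norm_cart order_trans by blast+
    have "\<bar>third_deriv f x u v w\<bar> \<le> (\<Sum>i\<in>UNIV. \<Sum>j\<in>UNIV. \<Sum>k\<in>UNIV. \<bar>partial_deriv i (partial_deriv j (partial_deriv k f)) x * u $ i * v $ j * w $ k\<bar>)"
      unfolding third_deriv_def by (intro order_trans[OF sum_abs] sum_mono order_refl)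
    also have "\<dots> \<le> (\<Sum>i\<in>UNIV. \<Sum>j\<in>UNIV. \<Sum>k\<in>UNIV. \<bar>partial_deriv i (partial_deriv j (partial_deriv k f)) x\<bar>)"
    proof (intro sum_mono)
      fix i j k
      have "\<bar>u $ i\<bar> * \<bar>v $ j\<bar> * \<bar>w $ k\<bar> \<le> 1 * 1 * 1" using c by (intro mult_mono) auto
      then show "\<bar>partial_deriv i (partial_deriv j (partial_deriv k f)) x * u $ i * v $ j * w $ k\<bar> \<le> \<bar>partial_deriv i (partial_deriv j (partial_deriv k f)) x\<bar>"
        using mult_left_mono[of "\<bar>u $ i\<bar> * \<bar>v $ j\<bar> * \<bar>w $ k\<bar>" 1 "\<bar>partial_deriv i (partial_deriv j (partial_deriv k f)) x\<bar>"]
        by (simp add: abs_mult mult.assoc)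
    qed
    finally show "?F p \<le> (\<Sum>i\<in>UNIV. \<Sum>j\<in>UNIV. \<Sum>k\<in>UNIV. \<bar>partial_deriv i (partial_deriv j (partial_deriv k f)) x\<bar>)"
      by (simp add: p)
  qed
  moreover have "((1 / norm u) *\<^sub>R u, (1 / norm v) *\<^sub>R v, (1 / norm w) *\<^sub>R w) \<in> ?S" by simp
  ultimately have "?F ((1 / norm u) *\<^sub>R u, (1 / norm v) *\<^sub>R v, (1 / norm w) *\<^sub>R w) \<le> norm_third_deriv f x"
    unfolding norm_third_deriv_def by (intro cSUP_upper)
  then have "\<bar>third_deriv f x u v w\<bar> / (norm u * norm v * norm w) \<le> norm_third_deriv f x"
    by (simp add: third_deriv_scaleR abs_mult)
  then show ?thesis using False by (simp add: pos_divide_le_eq mult.assoc)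
qed

lemma second_order_upper_bound:
  fixes \<phi> \<phi>' \<phi>'' :: "real \<Rightarrow> real"
  assumes "\<And>t. 0 \<le> t \<Longrightarrow> t \<le> 1 \<Longrightarrow> (\<phi> has_real_derivative \<phi>' t) (at t)"
    and "\<And>t. 0 \<le> t \<Longrightarrow> t \<le> 1 \<Longrightarrow> (\<phi>' has_real_derivative \<phi>'' t) (at t)"
    and "\<And>t. 0 \<le> t \<Longrightarrow> t \<le> 1 \<Longrightarrow> \<phi>'' t \<le> B"
  shows "\<phi> 1 \<le> \<phi> 0 + \<phi>' 0 + B / 2"
proof -
  have 1: "\<phi>' t - B * t \<le> \<phi>' 0 - B * 0" if "0 \<le> t" "t \<le> 1" for t
  proof (rule DERIV_nonpos_imp_nonincreasing[where f="\<lambda>t. \<phi>' t - B * t"])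
    fix x assume x: "0 \<le> x" "x \<le> t"
    then show "\<exists>y. ((\<lambda>t. \<phi>' t - B * t) has_real_derivative y) (at x) \<and> y \<le> 0"
      using assms(2,3)[of x] that by (intro exI[of _ "\<phi>'' x - B"]) (auto intro!: derivative_eq_intros)
  qed (use that in auto)
  have "\<phi> 1 - \<phi>' 0 * 1 - B * 1\<^sup>2 / 2 \<le> \<phi> 0 - \<phi>' 0 * 0 - B * 0\<^sup>2 / 2"
  proof (rule DERIV_nonpos_imp_nonincreasing[where f="\<lambda>t. \<phi> t - \<phi>' 0 * t - B * t\<^sup>2 / 2"])
    fix x :: real assume x: "0 \<le> x" "x \<le> 1"
    then show "\<exists>y. ((\<lambda>t. \<phi> t - \<phi>' 0 * t - B * t\<^sup>2 / 2) has_real_derivative y) (at x) \<and> y \<le> 0"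
      using assms(1)[of x] 1[of x] by (intro exI[of _ "\<phi>' x - \<phi>' 0 - B * x"]) (auto intro!: derivative_eq_intros)
  qed auto
  then show ?thesis by simp
qed

lemma strongly_convex_of_second_deriv:
  fixes \<phi> \<phi>' \<phi>'' :: "real \<Rightarrow> real"
  assumes 1: "\<And>t. 0 \<le> t \<Longrightarrow> t \<le> 1 \<Longrightarrow> (\<phi> has_real_derivative \<phi>' t) (at t)"
    and 2: "\<And>t. 0 \<le> t \<Longrightarrow> t \<le> 1 \<Longrightarrow> (\<phi>' has_real_derivative \<phi>'' t) (at t)"
    and 3: "\<And>t. 0 \<le> t \<Longrightarrow> t \<le> 1 \<Longrightarrow> m \<le> \<phi>'' t"
    and s: "0 \<le> s" "s \<le> 1"
  shows "\<phi> s \<le> (1 - s) * \<phi> 0 + s * \<phi> 1 - m * s * (1 - s) / 2"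
proof -
  have "convex_on {0..1} (\<lambda>t. \<phi> t - m * t\<^sup>2 / 2)"
  proof (rule f''_ge0_imp_convex)
    fix x :: real assume x: "x \<in> {0..1}"
    show "((\<lambda>t. \<phi> t - m * t\<^sup>2 / 2) has_real_derivative (\<phi>' x - m * x)) (at x)"
      using 1[of x] x by (auto intro!: derivative_eq_intros)
    show "((\<lambda>x. \<phi>' x - m * x) has_real_derivative (\<phi>'' x - m)) (at x)"
      using 2[of x] x by (auto intro!: derivative_eq_intros)
    show "0 \<le> \<phi>'' x - m" using 3[of x] x by simp
  qed simp
  from convex_onD[OF this, of s 0 1] s
  have "\<phi> s - m * s\<^sup>2 / 2 \<le> (1 - s) * \<phi> 0 + s * (\<phi> 1 - m / 2)" by simp
  then show ?thesis by (simp add: power2_eq_square algebra_simps diff_divide_distrib)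
qed

text \<open>Both orders of differentiation evaluate the same second difference of \<open>f\<close> over a small square,
  by two applications of the mean value theorem; continuity at \<open>x\<close> removes the intermediate points.\<close>

lemma hessian_symmetric:
  fixes f :: "real^'n::finite \<Rightarrow> real"
  assumes "0 < R" and f: "\<And>y. y \<in> ball x R \<Longrightarrow> f differentiable (at y)"
    and f1: "\<And>y i. y \<in> ball x R \<Longrightarrow> partial_deriv i f differentiable (at y)"
    and f2: "\<And>i j. isCont (partial_deriv i (partial_deriv j f)) x"
  shows "transpose (hessian f x) = hessian f x"
proof -
  have double_difference: "\<exists>y. norm (y - x) \<le> 2 * h \<and>
      f (x + h *\<^sub>R axis i 1 + h *\<^sub>R axis j 1) - f (x + h *\<^sub>R axis i 1) - f (x + h *\<^sub>R axis j 1) + f x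
        = h\<^sup>2 * partial_deriv j (partial_deriv i f) y"
    if h: "0 < h" "2 * h < R" for h i j
  proof -
    let ?p = "\<lambda>s t. x + s *\<^sub>R axis i 1 + t *\<^sub>R (axis j 1 :: real^'n)"
    have np: "norm (?p s t - x) \<le> 2 * h" if "0 \<le> s" "s \<le> h" "0 \<le> t" "t \<le> h" for s t
    proof -
      have "norm (?p s t - x) \<le> norm (s *\<^sub>R (axis i 1 :: real^'n)) + norm (t *\<^sub>R (axis j 1 :: real^'n))"
        using norm_triangle_ineq[of "s *\<^sub>R (axis i 1 :: real^'n)" "t *\<^sub>R (axis j 1 :: real^'n)"] by (simp only: add.assoc add_diff_cancel_left')
      also have "\<dots> \<le> h + h" using that by (simp add: norm_axis_1)
      finally show ?thesis by simp
    qed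
    have inb: "?p s t \<in> ball x R" if "0 \<le> s" "s \<le> h" "0 \<le> t" "t \<le> h" for s t
      using np[OF that] h unfolding mem_ball dist_norm norm_minus_commute[of x] by linarith
    have dd: "dir_deriv g y (axis i 1) = partial_deriv i g y" for g i and y :: "real^'n"
      by (simp add: dir_deriv_def axis_def if_distrib cong: if_cong)
    have "\<exists>s>0. s < h \<and> (f (?p h h) - f (?p h 0)) - (f (?p 0 h) - f (?p 0 0)) = (h - 0) * (partial_deriv i f (?p s h) - partial_deriv i f (?p s 0))"
    proof (rule MVT2[OF h(1)])
      fix s assume s: "0 \<le> s" "s \<le> h"
      have "((\<lambda>s. f ((x + t *\<^sub>R axis j 1) + s *\<^sub>R axis i 1)) has_real_derivative partial_deriv i f ((x + t *\<^sub>R axis j 1) + s *\<^sub>R axis i 1)) (at s)"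
        if "0 \<le> t" "t \<le> h" for t
        unfolding dd[symmetric] by (rule has_real_derivative_along_line, rule f) (use inb[OF s that] in \<open>simp add: algebra_simps\<close>)
      from DERIV_diff[OF this[of h] this[of 0]] show "((\<lambda>s. f (?p s h) - f (?p s 0)) has_real_derivative partial_deriv i f (?p s h) - partial_deriv i f (?p s 0)) (at s)"
        using h by (simp add: algebra_simps)
    qed
    then obtain s where s: "0 < s" "s < h" "(f (?p h h) - f (?p h 0)) - (f (?p 0 h) - f (?p 0 0)) = h * (partial_deriv i f (?p s h) - partial_deriv i f (?p s 0))"
      by auto
    have "\<exists>t>0. t < h \<and> partial_deriv i f (?p s h) - partial_deriv i f (?p s 0) = (h - 0) * partial_deriv j (partial_deriv i f) (?p s t)"
    proof (rule MVT2[OF h(1)])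
      fix t assume t: "0 \<le> t" "t \<le> h"
      show "((\<lambda>t. partial_deriv i f (?p s t)) has_real_derivative partial_deriv j (partial_deriv i f) (?p s t)) (at t)"
        unfolding dd[symmetric, where i=j] by (rule has_real_derivative_along_line, rule f1) (use inb[of s t] s t in simp)
    qed
    then obtain t where t: "0 < t" "t < h" "partial_deriv i f (?p s h) - partial_deriv i f (?p s 0) = h * partial_deriv j (partial_deriv i f) (?p s t)"
      by auto
    have "f (x + h *\<^sub>R axis i 1 + h *\<^sub>R axis j 1) - f (x + h *\<^sub>R axis i 1) - f (x + h *\<^sub>R axis j 1) + f x
        = h\<^sup>2 * partial_deriv j (partial_deriv i f) (?p s t)"
      using s(3) unfolding t(3) by (simp add: power2_eq_square mult.assoc)
    then show ?thesis using np[of s t] s t by (intro exI[of _ "?p s t"]) auto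
  qed
  have "partial_deriv i (partial_deriv j f) x = partial_deriv j (partial_deriv i f) x" for i j
  proof (rule ccontr)
    let ?a = "partial_deriv i (partial_deriv j f)" and ?b = "partial_deriv j (partial_deriv i f)"
    assume "?a x \<noteq> ?b x"
    then have e: "0 < \<bar>?a x - ?b x\<bar> / 2" by simp
    obtain r1 where r1: "0 < r1" "\<And>y. dist y x < r1 \<Longrightarrow> dist (?a y) (?a x) < \<bar>?a x - ?b x\<bar> / 2"
      using f2[of i j] e unfolding continuous_at_eps_delta by blast
    obtain r2 where r2: "0 < r2" "\<And>y. dist y x < r2 \<Longrightarrow> dist (?b y) (?b x) < \<bar>?a x - ?b x\<bar> / 2"
      using f2[of j i] e unfolding continuous_at_eps_delta by blast
    define h where "h = min R (min r1 r2) / 3"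
    have h: "0 < h" "2 * h < R" "2 * h < r1" "2 * h < r2" using \<open>0 < R\<close> r1(1) r2(1) by (auto simp: h_def)
    obtain y where y: "norm (y - x) \<le> 2 * h" "f (x + h *\<^sub>R axis i 1 + h *\<^sub>R axis j 1) - f (x + h *\<^sub>R axis i 1) - f (x + h *\<^sub>R axis j 1) + f x = h\<^sup>2 * ?b y"
      using double_difference[OF h(1,2), of i j] by blast
    obtain z where z: "norm (z - x) \<le> 2 * h" "f (x + h *\<^sub>R axis j 1 + h *\<^sub>R axis i 1) - f (x + h *\<^sub>R axis j 1) - f (x + h *\<^sub>R axis i 1) + f x = h\<^sup>2 * ?a z"
      using double_difference[OF h(1,2), of j i] by blast
    have "x + h *\<^sub>R axis j 1 + h *\<^sub>R axis i 1 = x + h *\<^sub>R axis i 1 + h *\<^sub>R (axis j 1 :: real^'n)" by (simp add: algebra_simps)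
    then have "h\<^sup>2 * ?b y = h\<^sup>2 * ?a z" using y(2) z(2) by (simp only:)
    then have "?b y = ?a z" using h(1) by simp
    moreover have "dist (?a z) (?a x) < \<bar>?a x - ?b x\<bar> / 2" using r1(2)[of z] z(1) h by (simp add: dist_norm)
    moreover have "dist (?b y) (?b x) < \<bar>?a x - ?b x\<bar> / 2" using r2(2)[of y] y(1) h by (simp add: dist_norm)
    moreover have False if "v = w" "dist w p < \<bar>p - q\<bar> / 2" "dist v q < \<bar>p - q\<bar> / 2" for v w p q :: real
      using that by (auto simp: dist_real_def abs_if split: if_splits)
    ultimately show False by blast
  qed
  then show ?thesis by (simp add: hessian_def transpose_def vec_eq_iff)
qed

text \<open>Both the log-likelihood around the MLE and the log-posterior around the MAP are of this kind.\<close>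

locale bounded_third_derivative =
  fixes f :: "real^'n::finite \<Rightarrow> real" and c :: "real^'n" and R K :: real
  assumes R: "0 < R" and K: "0 \<le> K"
    and regular: "\<And>x. x \<in> cball c R \<Longrightarrow> thrice_differentiable_at f x"
    and bound: "\<And>x. x \<in> cball c R \<Longrightarrow> norm_third_deriv f x \<le> K"
begin

lemma differentiable:
  assumes "x \<in> cball c R"
  shows "f differentiable (at x)" "partial_deriv i f differentiable (at x)"
    "partial_deriv i (partial_deriv j f) differentiable (at x)"
  using regular[OF assms] by (auto simp: thrice_differentiable_at_def dest: eventually_nhds_x_imp_x)

lemma hessian_center_symmetric: "transpose (hessian f c) = hessian f c"
proof (rule hessian_symmetric[OF R])
  show "isCont (partial_deriv i (partial_deriv j f)) c" for i j
    using R by (intro differentiable_imp_continuous_within differentiable) simp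
qed (auto intro: differentiable)

text \<open>The direction of the line is the first argument of \<open>third_deriv\<close>, since the first index of that
  form belongs to the outermost partial derivative.\<close>

lemma deriv_line:
  assumes "y + t *\<^sub>R v \<in> cball c R"
  shows "((\<lambda>t. f (y + t *\<^sub>R v)) has_real_derivative dir_deriv f (y + t *\<^sub>R v) v) (at t)"
    and "((\<lambda>t. dir_deriv f (y + t *\<^sub>R v) w) has_real_derivative v \<bullet> (hessian f (y + t *\<^sub>R v) *v w)) (at t)"
    and "((\<lambda>t. u \<bullet> (hessian f (y + t *\<^sub>R v) *v w)) has_real_derivative third_deriv f (y + t *\<^sub>R v) v u w) (at t)"
proof -
  show "((\<lambda>t. f (y + t *\<^sub>R v)) has_real_derivative dir_deriv f (y + t *\<^sub>R v) v) (at t)"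
    by (rule has_real_derivative_along_line[OF differentiable(1)[OF assms]])
  have "((\<lambda>t. dir_deriv f (y + t *\<^sub>R v) w) has_real_derivative
      (\<Sum>k\<in>UNIV. dir_deriv (partial_deriv k f) (y + t *\<^sub>R v) v * w $ k)) (at t)"
    unfolding dir_deriv_def[of f]
    by (intro DERIV_sum DERIV_cmult_right has_real_derivative_along_line differentiable(2)[OF assms])
  also have "(\<Sum>k\<in>UNIV. dir_deriv (partial_deriv k f) (y + t *\<^sub>R v) v * w $ k) = v \<bullet> (hessian f (y + t *\<^sub>R v) *v w)"
    unfolding hessian_form dir_deriv_def sum_distrib_right by (rule sum.swap)
  finally show "((\<lambda>t. dir_deriv f (y + t *\<^sub>R v) w) has_real_derivative v \<bullet> (hessian f (y + t *\<^sub>R v) *v w)) (at t)" .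
  have "((\<lambda>t. u \<bullet> (hessian f (y + t *\<^sub>R v) *v w)) has_real_derivative
      (\<Sum>j\<in>UNIV. \<Sum>k\<in>UNIV. dir_deriv (partial_deriv j (partial_deriv k f)) (y + t *\<^sub>R v) v * u $ j * w $ k)) (at t)"
    unfolding hessian_form
    by (intro DERIV_sum DERIV_cmult_right has_real_derivative_along_line differentiable(3)[OF assms])
  also have "(\<Sum>j\<in>UNIV. \<Sum>k\<in>UNIV. dir_deriv (partial_deriv j (partial_deriv k f)) (y + t *\<^sub>R v) v * u $ j * w $ k)
    = (\<Sum>j\<in>UNIV. \<Sum>i\<in>UNIV. \<Sum>k\<in>UNIV. partial_deriv i (partial_deriv j (partial_deriv k f)) (y + t *\<^sub>R v) * v $ i * u $ j * w $ k)"
    unfolding dir_deriv_def sum_distrib_right by (intro sum.cong refl sum.swap)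
  also have "\<dots> = third_deriv f (y + t *\<^sub>R v) v u w"
    unfolding third_deriv_def by (rule sum.swap)
  finally show "((\<lambda>t. u \<bullet> (hessian f (y + t *\<^sub>R v) *v w)) has_real_derivative third_deriv f (y + t *\<^sub>R v) v u w) (at t)" .
qed

lemma segment_in_ball:
  assumes "x \<in> cball c R" "y \<in> cball c R" "0 \<le> t" "t \<le> 1"
  shows "x + t *\<^sub>R (y - x) \<in> cball c R"
proof -
  have "x + t *\<^sub>R (y - x) = (1 - t) *\<^sub>R x + t *\<^sub>R y" by (simp add: algebra_simps)
  then show ?thesis using convexD_alt[OF convex_cball assms] by simp
qed

lemma center_in_ball: "c \<in> cball c R" using R by simp

lemma hessian_lipschitz:
  assumes x: "x \<in> cball c R"
  shows "\<bar>u \<bullet> (hessian f x *v w) - u \<bullet> (hessian f c *v w)\<bar> \<le> K * norm (x - c) * norm u * norm w"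
proof -
  let ?v = "x - c"
  have "\<exists>z>0. z < 1 \<and> u \<bullet> (hessian f (c + 1 *\<^sub>R ?v) *v w) - u \<bullet> (hessian f (c + 0 *\<^sub>R ?v) *v w) = (1 - 0) * third_deriv f (c + z *\<^sub>R ?v) ?v u w"
    by (rule MVT2) (auto intro!: deriv_line(3) segment_in_ball x center_in_ball simp del: mem_cball)
  then obtain z where z: "0 < z" "z < 1" "u \<bullet> (hessian f x *v w) - u \<bullet> (hessian f c *v w) = third_deriv f (c + z *\<^sub>R ?v) ?v u w"
    by auto
  have "c + z *\<^sub>R ?v \<in> cball c R" using z x center_in_ball by (intro segment_in_ball) auto
  then have "norm_third_deriv f (c + z *\<^sub>R ?v) * norm ?v * norm u * norm w \<le> K * norm ?v * norm u * norm w"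
    by (intro mult_right_mono bound) auto
  then show ?thesis using abs_third_deriv_le[of f "c + z *\<^sub>R ?v" ?v u w] by (simp add: z(3))
qed

lemma gradient_taylor:
  assumes x: "x \<in> cball c R"
  shows "dir_deriv f x w \<le> dir_deriv f c w + (x - c) \<bullet> (hessian f c *v w) + K / 2 * (norm (x - c))\<^sup>2 * norm w"
proof -
  let ?v = "x - c"
  let ?A = "?v \<bullet> (hessian f c *v w)" and ?B = "K * (norm ?v)\<^sup>2 * norm w"
  let ?g = "\<lambda>t. dir_deriv f (c + t *\<^sub>R ?v) w - t * ?A - ?B * t\<^sup>2 / 2"
  have "?g 1 \<le> ?g 0"
  proof (rule DERIV_nonpos_imp_nonincreasing[where f="?g"])
    fix t :: real assume t: "0 \<le> t" "t \<le> 1"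
    have ct: "c + t *\<^sub>R ?v \<in> cball c R" using t x center_in_ball by (intro segment_in_ball) auto
    have "(?g has_real_derivative ?v \<bullet> (hessian f (c + t *\<^sub>R ?v) *v w) - ?A - ?B * t) (at t)"
      using deriv_line(2)[OF ct, of w] by (auto intro!: derivative_eq_intros)
    moreover have "?v \<bullet> (hessian f (c + t *\<^sub>R ?v) *v w) - ?A \<le> ?B * t"
      using hessian_lipschitz[OF ct, of ?v w] t by (simp add: power2_eq_square mult_ac)
    ultimately show "\<exists>y. (?g has_real_derivative y) (at t) \<and> y \<le> 0" by fastforce
  qed simp
  then show ?thesis by (simp add: algebra_simps)
qed

text \<open>Along a segment the second derivative is at most \<open>- m\<close> times the squared length.\<close>

lemma strongly_concave:
  assumes hess: "\<And>x v. x \<in> cball c R \<Longrightarrow> v \<bullet> (hessian f x *v v) \<le> - m * (norm v)\<^sup>2"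
    and x: "x \<in> cball c R" and y: "y \<in> cball c R" and s: "0 \<le> s" "s \<le> 1"
  shows "(1 - s) * f x + s * f y + m * s * (1 - s) / 2 * (norm (x - y))\<^sup>2 \<le> f ((1 - s) *\<^sub>R x + s *\<^sub>R y)"
proof -
  let ?v = "y - x"
  have "- f (x + s *\<^sub>R ?v) \<le> (1 - s) * - f (x + 0 *\<^sub>R ?v) + s * - f (x + 1 *\<^sub>R ?v) - (m * (norm ?v)\<^sup>2) * s * (1 - s) / 2"
  proof (rule strongly_convex_of_second_deriv[OF _ _ _ s, where \<phi>="\<lambda>t. - f (x + t *\<^sub>R ?v)"
        and \<phi>'="\<lambda>t. - dir_deriv f (x + t *\<^sub>R ?v) ?v"
        and \<phi>''="\<lambda>t. - (?v \<bullet> (hessian f (x + t *\<^sub>R ?v) *v ?v))"])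
    fix t :: real assume t: "0 \<le> t" "t \<le> 1"
    have xt: "x + t *\<^sub>R ?v \<in> cball c R" by (rule segment_in_ball[OF x y t])
    show "((\<lambda>t. - f (x + t *\<^sub>R ?v)) has_real_derivative - dir_deriv f (x + t *\<^sub>R ?v) ?v) (at t)"
      by (intro DERIV_minus deriv_line xt)
    show "((\<lambda>t. - dir_deriv f (x + t *\<^sub>R ?v) ?v) has_real_derivative - (?v \<bullet> (hessian f (x + t *\<^sub>R ?v) *v ?v))) (at t)"
      by (intro DERIV_minus deriv_line xt)
    show "m * (norm ?v)\<^sup>2 \<le> - (?v \<bullet> (hessian f (x + t *\<^sub>R ?v) *v ?v))" using hess[OF xt, of ?v] by simp
  qed
  moreover have "x + s *\<^sub>R ?v = (1 - s) *\<^sub>R x + s *\<^sub>R y" by (simp add: algebra_simps)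
  ultimately show ?thesis by (simp add: norm_minus_commute algebra_simps)
qed

text \<open>The function \<open>D\<close> is the second-order Taylor polynomial of \<open>f\<close> at the critical point \<open>c\<close>
  minus \<open>f\<close>, up to a constant. Its gradient at \<open>z\<close> is at most \<open>K / 2 * norm (z - c)^2\<close> and its
  Hessian at most \<open>K * R\<close>.\<close>

lemma taylor_remainder_growth:
  assumes crit: "\<And>w. dir_deriv f c w = 0" and x: "x \<in> cball c R" and z: "z \<in> cball c R"
  defines "D \<equiv> \<lambda>x. (x - c) \<bullet> (hessian f c *v (x - c)) / 2 - f x"
  shows "D x \<le> D z + norm (x - z) * (K / 2 * (norm (z - c))\<^sup>2) + K * R / 2 * (norm (x - z))\<^sup>2"
proof -
  let ?H = "hessian f c" and ?v = "x - z"
  have sa: "u \<bullet> (?H *v w) = w \<bullet> (?H *v u)" for u w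
    by (metis hessian_center_symmetric dot_lmul_matrix vector_transpose_matrix inner_commute)
  let ?g = "\<lambda>t. D (z + t *\<^sub>R ?v)"
  let ?g1 = "\<lambda>t. (z - c + t *\<^sub>R ?v) \<bullet> (?H *v ?v) - dir_deriv f (z + t *\<^sub>R ?v) ?v"
  let ?g2 = "\<lambda>t. ?v \<bullet> (?H *v ?v) - ?v \<bullet> (hessian f (z + t *\<^sub>R ?v) *v ?v)"
  have quad: "(z + t *\<^sub>R ?v - c) \<bullet> (?H *v (z + t *\<^sub>R ?v - c)) =
     (z - c) \<bullet> (?H *v (z - c)) + 2 * t * ((z - c) \<bullet> (?H *v ?v)) + t\<^sup>2 * (?v \<bullet> (?H *v ?v))" for t
  proof -
    have e: "z + t *\<^sub>R ?v - c = (z - c) + t *\<^sub>R ?v" by simp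
    show ?thesis unfolding e matrix_vector_right_distrib inner_add_left inner_add_right matrix_vector_mult_scaleR
        inner_scaleR_left inner_scaleR_right sa[of ?v "z - c"]
      by (simp add: power2_eq_square algebra_simps)
  qed
  have "?g 1 \<le> ?g 0 + ?g1 0 + (K * R * (norm ?v)\<^sup>2) / 2"
  proof (rule second_order_upper_bound[where \<phi>="?g" and \<phi>'="?g1" and \<phi>''="?g2"])
    fix t :: real assume t: "0 \<le> t" "t \<le> 1"
    have zt: "z + t *\<^sub>R ?v \<in> cball c R" by (rule segment_in_ball[OF z x t])
    show "(?g has_real_derivative ?g1 t) (at t)"
      unfolding D_def quad
      using deriv_line(1)[OF zt] by (auto intro!: derivative_eq_intros simp: inner_add_left)
    show "(?g1 has_real_derivative ?g2 t) (at t)"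
      using deriv_line(2)[OF zt, of ?v] by (auto intro!: derivative_eq_intros simp: inner_add_left)
    have "norm (z + t *\<^sub>R ?v - c) \<le> R" using zt by (simp add: dist_norm norm_minus_commute)
    then have "K * norm (z + t *\<^sub>R ?v - c) * norm ?v * norm ?v \<le> K * R * norm ?v * norm ?v"
      using K by (intro mult_right_mono mult_left_mono) auto
    then show "?g2 t \<le> K * R * (norm ?v)\<^sup>2"
      using hessian_lipschitz[OF zt, of ?v ?v] by (simp add: power2_eq_square mult.assoc)
  qed
  moreover have "?g1 0 \<le> norm ?v * (K / 2 * (norm (z - c))\<^sup>2)"
  proof -
    have m: "(z - c) \<bullet> (?H *v (- ?v)) = - ((z - c) \<bullet> (?H *v ?v))" "dir_deriv f z (- ?v) = - dir_deriv f z ?v"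
      using matrix_vector_mult_scaleR[of ?H "-1" ?v] dir_deriv_scaleR[of f z "-1" ?v] by simp_all
    have "dir_deriv f z (- ?v) \<le> 0 + (z - c) \<bullet> (?H *v (- ?v)) + K / 2 * (norm (z - c))\<^sup>2 * norm (- ?v)"
      using gradient_taylor[OF z, of "- ?v"] crit by simp
    then show ?thesis unfolding m norm_minus_cancel by (simp add: mult_ac)
  qed
  ultimately show ?thesis by simp
qed

lemma taylor_lower_bound:
  assumes x: "x \<in> cball c R" and crit: "\<And>w. dir_deriv f c w = 0"
  shows "f c + (x - c) \<bullet> (hessian f c *v (x - c)) / 2 - K / 6 * norm (x - c) ^ 3 \<le> f x"
proof -
  let ?v = "x - c"
  let ?A = "?v \<bullet> (hessian f c *v ?v)"
  let ?g = "\<lambda>t. - f (c + t *\<^sub>R ?v) + t\<^sup>2 / 2 * ?A - t ^ 3 * (K / 6 * norm ?v ^ 3)"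
  have "?g 1 \<le> ?g 0"
  proof (rule DERIV_nonpos_imp_nonincreasing[where f="?g"])
    fix t :: real assume t: "0 \<le> t" "t \<le> 1"
    have ct: "c + t *\<^sub>R ?v \<in> cball c R" using t x center_in_ball by (intro segment_in_ball) auto
    have "(?g has_real_derivative - dir_deriv f (c + t *\<^sub>R ?v) ?v + t * ?A - t\<^sup>2 * (K / 2 * norm ?v ^ 3)) (at t)"
      using deriv_line(1)[OF ct] by (auto intro!: derivative_eq_intros)
    moreover have "- dir_deriv f (c + t *\<^sub>R ?v) ?v + t * ?A - t\<^sup>2 * (K / 2 * norm ?v ^ 3) \<le> 0"
    proof -
      have m: "hessian f c *v (- ?v) = - (hessian f c *v ?v)" "dir_deriv f (c + t *\<^sub>R ?v) (- ?v) = - dir_deriv f (c + t *\<^sub>R ?v) ?v"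
        using matrix_vector_mult_scaleR[of "hessian f c" "-1" ?v] dir_deriv_scaleR[of f "c + t *\<^sub>R ?v" "-1" ?v] by simp_all
      show ?thesis using gradient_taylor[OF ct, of "- ?v"] t unfolding m crit norm_minus_cancel
        by (simp add: power_mult_distrib power2_eq_square power3_eq_cube mult_ac)
    qed
    ultimately show "\<exists>y. (?g has_real_derivative y) (at t) \<and> y \<le> 0" by blast
  qed simp
  then show ?thesis by simp
qed

lemma dir_deriv_eq_0_at_local_max:
  assumes "eventually (\<lambda>y. f y \<le> f c) (nhds c)"
  shows "dir_deriv f c w = 0"
proof -
  obtain S where S: "open S" "c \<in> S" "\<And>y. y \<in> S \<Longrightarrow> f y \<le> f c"
    using assms unfolding eventually_nhds by blast
  have "(\<lambda>v. \<Sum>i\<in>UNIV. partial_deriv i f c * v $ i) = (\<lambda>v. 0)"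
    by (rule differential_zero_maxmin[OF S(2,1) has_derivative_partial_deriv[OF differentiable(1)[OF center_in_ball]]]) (use S(3) in blast)
  then show ?thesis unfolding dir_deriv_def by meson
qed

text \<open>In the cubic lower bound at \<open>c + t v\<close>, the quadratic term dominates the cubic one for small \<open>t\<close>,
  so a positive quadratic term would contradict maximality.\<close>

lemma hessian_nonpos_at_max:
  assumes max: "\<And>y. f y \<le> f c"
  shows "v \<bullet> (hessian f c *v v) \<le> 0"
proof (cases "v = 0")
  case False
  have crit: "dir_deriv f c w = 0" for w by (rule dir_deriv_eq_0_at_local_max) (simp add: max)
  let ?A = "v \<bullet> (hessian f c *v v)"
  have le: "?A \<le> K / 3 * norm v ^ 3 * t" if t: "0 < t" "t * norm v \<le> R" for t
  proof -
    have "f c + t\<^sup>2 * ?A / 2 - K / 6 * (t ^ 3 * norm v ^ 3) \<le> f c"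
      using order_trans[OF taylor_lower_bound[of "c + t *\<^sub>R v", OF _ crit] max] t
      by (simp add: dist_norm matrix_vector_mult_scaleR power_mult_distrib power2_eq_square mult.assoc)
    then have "t\<^sup>2 * ?A \<le> t\<^sup>2 * (K / 3 * norm v ^ 3 * t)"
      by (simp add: power2_eq_square power3_eq_cube algebra_simps)
    then show ?thesis using t by simp
  qed
  have "((\<lambda>t. K / 3 * norm v ^ 3 * t) \<longlongrightarrow> K / 3 * norm v ^ 3 * 0) (at_right 0)" by (intro tendsto_intros)
  then have "((\<lambda>t. K / 3 * norm v ^ 3 * t) \<longlongrightarrow> 0) (at_right 0)" by simp
  moreover have "0 < R / norm v" using R False by simp
  then have "eventually (\<lambda>t. ?A \<le> K / 3 * norm v ^ 3 * t) (at_right 0)"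
  proof (intro eventually_mono[OF eventually_at_right_real])
    fix t assume "t \<in> {0<..<R / norm v}"
    then have "0 < t" "t * norm v \<le> R" using False by (auto simp: pos_less_divide_eq)
    then show "?A \<le> K / 3 * norm v ^ 3 * t" by (rule le)
  qed
  ultimately show ?thesis by (rule tendsto_lowerbound) simp
qed simp

end

section \<open>Posterior mass away from the mode\<close>

text \<open>For two probability measures, \<open>a\<close> and \<open>a'\<close> are the masses of the parts of an event inside
  and outside the conditioning event, which has mass \<open>b\<close>; likewise for \<open>c\<close>, \<open>c'\<close> and \<open>e\<close>.
  Conditioning moves the probability of an event by at most the mass that it discards.\<close>

lemma abs_diff_le_conditional_diff:
  fixes a a' b c c' e :: real
  assumes "0 \<le> a" "a \<le> b" "0 < b" "0 \<le> a'" "a' \<le> 1 - b"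
    and "0 \<le> c" "c \<le> e" "0 < e" "0 \<le> c'" "c' \<le> 1 - e"
  shows "\<bar>(a + a') - (c + c')\<bar> \<le> \<bar>c / e - a / b\<bar> + (1 - b) + (1 - e)"
proof -
  have *: "\<bar>(x + x') - x / y\<bar> \<le> 1 - y" if "0 \<le> x" "x \<le> y" "0 < y" "0 \<le> x'" "x' \<le> 1 - y" for x x' y :: real
  proof -
    have eq: "(x / y) * (1 - y) = x / y - x" using that by (simp add: field_simps)
    have q: "0 \<le> x / y" "x / y \<le> 1" "0 \<le> 1 - y" using that by auto
    have "0 \<le> x / y - x" unfolding eq[symmetric] using q by (intro mult_nonneg_nonneg)
    moreover have "x / y - x \<le> 1 - y" unfolding eq[symmetric] using q by (intro mult_left_le_one_le)
    ultimately show ?thesis using that by linarith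
  qed
  have "\<bar>(a + a') - a / b\<bar> \<le> 1 - b" "\<bar>(c + c') - c / e\<bar> \<le> 1 - e"
    by (rule *; rule assms)+
  then show ?thesis by linarith
qed

lemma min_eigenvalue_ge:
  fixes J :: "real^'n::finite^'n"
  assumes sym: "transpose J = J" and ge: "\<And>x. m * (norm x)\<^sup>2 \<le> x \<bullet> (J *v x)"
  shows "m \<le> min_eigenvalue J"
proof -
  obtain Q d where Qd: "orthogonal_matrix Q" "J = transpose Q ** diagonal_matrix d ** Q"
    by (rule symmetric_matrix_diagonalization[OF sym])
  have "min_eigenvalue J \<in> range d"
    unfolding diagonalized_min_eigenvalue[OF Qd] by (intro Min_in) auto
  then obtain v where v: "v \<noteq> 0" "J *v v = min_eigenvalue J *\<^sub>R v"
    unfolding diagonalized_eigenvalue_iff[OF Qd, symmetric] by blast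
  have "m * (norm v)\<^sup>2 \<le> min_eigenvalue J * (norm v)\<^sup>2"
    using ge[of v] unfolding v(2) by (simp add: power2_norm_eq_inner)
  then show ?thesis using v(1) by simp
qed

lemma nn_integral_lborel_affine:
  fixes f :: "real^'n::finite \<Rightarrow> ennreal"
  assumes [measurable]: "f \<in> borel_measurable borel" and c: "0 < c"
  shows "(\<integral>\<^sup>+x. f x \<partial>lborel) = ennreal (c ^ CARD('n)) * (\<integral>\<^sup>+x. f (t + c *\<^sub>R x) \<partial>lborel)"
proof -
  have "(\<integral>\<^sup>+x. f x \<partial>lborel) = (\<integral>\<^sup>+x. f x \<partial>density (distr lborel borel (\<lambda>x. t + c *\<^sub>R x)) (\<lambda>_. ennreal (\<bar>c\<bar> ^ DIM(real^'n))))"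
    using c by (intro arg_cong[OF lborel_affine]) simp
  then show ?thesis using c by (simp add: nn_integral_density nn_integral_distr nn_integral_cmult)
qed

lemma borel_measurable_quadratic_form [measurable]:
  fixes J :: "real^'n::finite^'n"
  shows "(\<lambda>x. x \<bullet> (J *v x)) \<in> borel_measurable borel"
  by (rule borel_measurable_continuous_onI)
    (rule continuous_on_inner[OF continuous_on_id linear_continuous_on[OF matrix_vector_mul_bounded_linear]])

context
  fixes J :: "real^'n::finite^'n"
  assumes sym: "transpose J = J" and pos: "0 < min_eigenvalue J"
begin

lemma integrable_gaussian: "integrable lborel (\<lambda>x. gauss J x)"
  and integral_gaussian: "(\<integral>x. gauss J x \<partial>lborel) = gaussian_mass J"
proof -
  have "has_bochner_integral lborel (\<lambda>x. gauss J x) (gaussian_mass J)"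
    using nn_integral_gaussian_mass[OF sym pos] gaussian_mass_pos[OF sym pos]
    by (intro has_bochner_integral_nn_integral) (auto intro: less_imp_le)
  then show "integrable lborel (\<lambda>x. gauss J x)" "(\<integral>x. gauss J x \<partial>lborel) = gaussian_mass J"
    by (auto simp: has_bochner_integral_iff)
qed

lemma gaussian_ball_mass_ge:
  assumes r: "sqrt (trace (matrix_inv J)) < r"
  shows "(1 - exp (- (1 / 2) * (r - sqrt (trace (matrix_inv J)))\<^sup>2 * min_eigenvalue J)) * gaussian_mass J
    \<le> (\<integral>x. indicator (cball 0 r) x * gauss J x \<partial>lborel)"
proof -
  let ?g = "\<lambda>x. gauss J x" and ?T = "{x::real^'n. r < norm x}"
  let ?D = "exp (- (1 / 2) * (r - sqrt (trace (matrix_inv J)))\<^sup>2 * min_eigenvalue J)"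
  have T[measurable]: "?T \<in> sets borel" by measurable
  have int: "integrable lborel (\<lambda>x. indicator (cball 0 r) x * ?g x)" "integrable lborel (\<lambda>x. indicator ?T x * ?g x)"
    using integrable_mult_indicator[OF _ integrable_gaussian] by auto
  have "ennreal (\<integral>x. indicator ?T x * ?g x \<partial>lborel) = (\<integral>\<^sup>+x. ennreal (indicator ?T x * ?g x) \<partial>lborel)"
    by (rule nn_integral_eq_integral[symmetric, OF int(2)]) simp
  also have "\<dots> = (\<integral>\<^sup>+x. indicator ?T x * ennreal (?g x) \<partial>lborel)"
    by (intro nn_integral_cong) (auto simp: indicator_def)
  also have "\<dots> \<le> ennreal (?D * gaussian_mass J)" by (rule nn_integral_gaussian_tail[OF sym pos r])
  finally have tail: "(\<integral>x. indicator ?T x * ?g x \<partial>lborel) \<le> ?D * gaussian_mass J"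
    using gaussian_mass_pos(1)[OF sym pos] by (subst (asm) ennreal_le_iff) auto
  have "gaussian_mass J = (\<integral>x. indicator (cball 0 r) x * ?g x + indicator ?T x * ?g x \<partial>lborel)"
    unfolding integral_gaussian[symmetric] by (intro Bochner_Integration.integral_cong) (auto simp: indicator_def)
  also have "\<dots> = (\<integral>x. indicator (cball 0 r) x * ?g x \<partial>lborel) + (\<integral>x. indicator ?T x * ?g x \<partial>lborel)"
    by (rule Bochner_Integration.integral_add[OF int])
  finally show ?thesis using tail by (simp add: algebra_simps)
qed

lemma gaussian_norm4_integral_le:
  "integrable lborel (\<lambda>x. norm x ^ 4 * gauss J x)"
  "(\<integral>x. norm x ^ 4 * gauss J x \<partial>lborel) \<le> 3 * (trace (matrix_inv J))\<^sup>2 * gaussian_mass J"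
proof -
  let ?F = "\<lambda>x. norm x ^ 4 * gauss J x"
  have le: "(\<integral>\<^sup>+x. ennreal (?F x) \<partial>lborel) \<le> ennreal (3 * (trace (matrix_inv J))\<^sup>2 * gaussian_mass J)"
    by (rule nn_integral_gaussian_norm4[OF sym pos])
  show int: "integrable lborel ?F"
  proof (rule integrableI_bounded)
    show "(\<integral>\<^sup>+x. ennreal (norm (?F x)) \<partial>lborel) < \<infinity>" using le by (simp add: le_less_trans)
  qed measurable
  have "ennreal (integral\<^sup>L lborel ?F) = (\<integral>\<^sup>+x. ennreal (?F x) \<partial>lborel)"
    by (rule nn_integral_eq_integral[symmetric, OF int]) simp
  with le have "ennreal (integral\<^sup>L lborel ?F) \<le> ennreal (3 * (trace (matrix_inv J))\<^sup>2 * gaussian_mass J)" by (simp only:)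
  then show "integral\<^sup>L lborel ?F \<le> 3 * (trace (matrix_inv J))\<^sup>2 * gaussian_mass J"
    using gaussian_mass_pos(1)[OF sym pos] by (subst (asm) ennreal_le_iff) auto
qed

lemma matrix_inv_matrix_inv: "matrix_inv (matrix_inv J) = J"
  and det_matrix_inv: "det (matrix_inv J) = 1 / det J"
proof -
  obtain Q d where Qd: "orthogonal_matrix Q" "J = transpose Q ** diagonal_matrix d ** Q" "\<And>i. 0 < d i"
    using diagonal_form[OF sym pos] by blast
  have "d i \<noteq> 0" for i using Qd(3)[of i] by simp
  then have inv: "invertible J" by (rule diagonalized_inverse(2)[OF Qd(1,2)])
  have JJ: "J ** matrix_inv J = mat 1" "matrix_inv J ** J = mat 1"
    using someI_ex[OF inv[unfolded invertible_def]] unfolding matrix_inv_def[symmetric] by auto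
  then show "matrix_inv (matrix_inv J) = J" by (intro matrix_inv_eqI)
  have "det J * det (matrix_inv J) = 1" using JJ(1) by (metis det_I det_mul)
  then show "det (matrix_inv J) = 1 / det J" using gaussian_mass_pos(2)[OF sym pos] by (simp add: field_simps)
qed

lemma multivariate_normal_eq_gaussian:
  "multivariate_normal 0 (matrix_inv J) = density lborel (\<lambda>x. ennreal (gauss J x / gaussian_mass J))"
  unfolding multivariate_normal_def gaussian_mass_def matrix_inv_matrix_inv det_matrix_inv by simp

end

lemma gauss_tail_less_1:
  assumes "sqrt (trace (matrix_inv J)) < r * sqrt (real n)" "0 < min_eigenvalue J"
  shows "gauss_tail n r J < 1"
proof -
  have "0 < (r * sqrt (real n) - sqrt (trace (matrix_inv J)))\<^sup>2 * min_eigenvalue J"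
    using assms by (intro mult_pos_pos) auto
  then show ?thesis unfolding gauss_tail_def by simp
qed

text \<open>The density is at most \<open>exp (L \<theta>hat - n * \<kappa>) / z\<close> times the prior on \<open>S\<close>, so only
  \<open>exp (L \<theta>hat) / z\<close> has to be bounded. Near \<open>\<theta>hat\<close> the cubic Taylor remainder is absorbed
  into the quadratic term by the shift \<open>\<delta> * M2 / 3\<close> in \<open>Jp\<close>, so there the posterior density is at least
  \<open>exp (L \<theta>hat) / (M1 * z)\<close> times a Gaussian with precision \<open>n * Jp\<close>. Integrating, and using that the total
  posterior mass is 1, gives the bound.\<close>

lemma posterior_tail_le:
  fixes L \<pi> :: "real^'d::finite \<Rightarrow> real" and \<theta>hat :: "real^'d" and z \<kappa> :: real
  assumes n: "n \<ge> 1" and prior: "prob_density \<pi>" and z: "z > 0"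
    and posterior: "prob_density (posterior L \<pi> z)"
    and Jp: "Jp = observed_information n L \<theta>hat + (\<delta> * M2 / 3) *\<^sub>R mat 1"
    and max: "\<And>\<theta>. L \<theta> \<le> L \<theta>hat" and \<delta>: "\<delta> > 0" and M2: "M2 > 0"
    and regular: "\<And>\<theta>. \<theta> \<in> cball \<theta>hat \<delta> \<Longrightarrow> thrice_differentiable_at L \<theta> \<and> norm_third_deriv L \<theta> / real n \<le> M2"
    and M1: "M1 > 0" and prior_lb: "\<And>\<theta>. \<theta> \<in> cball \<theta>hat \<delta> \<Longrightarrow> \<pi> \<theta> \<noteq> 0 \<and> \<bar>1 / \<pi> \<theta>\<bar> \<le> M1"
    and tr: "sqrt (trace (matrix_inv Jp) / real n) < \<delta>"
    and S[measurable]: "S \<in> sets borel" and far: "\<And>\<theta>. \<theta> \<in> S \<Longrightarrow> L \<theta> \<le> L \<theta>hat - real n * \<kappa>"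
  shows "gauss_tail n \<delta> Jp < 1"
    and "(\<integral>\<^sup>+\<theta>. indicator S \<theta> * ennreal (posterior L \<pi> z \<theta>) \<partial>lborel)
    \<le> ennreal (\<bar>det Jp\<bar> powr (1 / 2) * M1 / ((2 * pi) powr (real CARD('d) / 2) * (1 - gauss_tail n \<delta> Jp))
        * real n powr (real CARD('d) / 2) * exp (- real n * \<kappa>))"
proof -
  interpret bounded_third_derivative L \<theta>hat \<delta> "real n * M2"
  proof
    show "norm_third_deriv L x \<le> real n * M2" if "x \<in> cball \<theta>hat \<delta>" for x
      using regular[OF that] n by (simp add: pos_divide_le_eq mult.commute)
  qed (use \<delta> M2 regular in \<open>auto simp del: mem_cball\<close>)
  have n0: "0 < real n" using n by simp
  let ?H = "hessian L \<theta>hat"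
  have crit: "dir_deriv L \<theta>hat w = 0" for w by (rule dir_deriv_eq_0_at_local_max) (simp add: max)
  have quad: "x \<bullet> (Jp *v x) = - (1 / real n) * (x \<bullet> (?H *v x)) + \<delta> * M2 / 3 * (norm x)\<^sup>2" for x
    unfolding Jp observed_information_def
    by (simp add: matrix_vector_mult_add_rdistrib matrix_vector_mult_diff_rdistrib inner_add_right inner_diff_right scaleR_matrix_vector_assoc[symmetric] power2_norm_eq_inner)
  have sym: "transpose Jp = Jp"
    using hessian_center_symmetric unfolding Jp observed_information_def
    by (simp add: vec_eq_iff transpose_def mat_def)
  have "\<delta> * M2 / 3 * (norm x)\<^sup>2 \<le> x \<bullet> (Jp *v x)" for x
    using hessian_nonpos_at_max[OF max, of x] n0 unfolding quad by (simp add: mult_le_0_iff zero_le_divide_iff divide_le_0_iff)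
  then have "\<delta> * M2 / 3 \<le> min_eigenvalue Jp" by (intro min_eigenvalue_ge[OF sym])
  moreover have "0 < \<delta> * M2 / 3" using \<delta> M2 by simp
  ultimately have pos: "0 < min_eigenvalue Jp" by linarith
  have r: "sqrt (trace (matrix_inv Jp)) < \<delta> * sqrt (real n)"
    using tr n0 by (simp add: real_sqrt_divide pos_divide_less_eq)
  let ?D = "gauss_tail n \<delta> Jp"
  show D1: "?D < 1" by (rule gauss_tail_less_1[OF r pos])
  let ?g = "\<lambda>x. gauss Jp x" and ?m = "gaussian_mass Jp"
  have m: "0 < ?m" "0 < det Jp" by (rule gaussian_mass_pos[OF sym pos])+
  define a where "a = exp (L \<theta>hat) / (M1 * z)"
  have a: "a > 0" using M1 z by (simp add: a_def)
  define c where "c = 1 / sqrt (real n)"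
  have c: "c > 0" "c\<^sup>2 = 1 / real n" using n0 by (auto simp: c_def power_divide)
  have post_lb: "a * ?g x \<le> posterior L \<pi> z (\<theta>hat + c *\<^sub>R x)" if x: "x \<in> cball 0 (\<delta> * sqrt (real n))" for x
  proof -
    let ?\<theta> = "\<theta>hat + c *\<^sub>R x"
    have nx: "norm (c *\<^sub>R x) \<le> \<delta>" using x n0 by (simp add: c_def pos_divide_le_eq)
    then have \<theta>: "?\<theta> \<in> cball \<theta>hat \<delta>" by (simp add: dist_norm)
    have "norm (c *\<^sub>R x) ^ 3 \<le> \<delta> * norm (c *\<^sub>R x) ^ 2"
      using nx mult_right_mono[OF nx, of "norm (c *\<^sub>R x) ^ 2"] by (simp add: power3_eq_cube power2_eq_square mult.assoc)
    then have "real n * M2 / 6 * norm (c *\<^sub>R x) ^ 3 \<le> real n * M2 / 6 * (\<delta> * norm (c *\<^sub>R x) ^ 2)"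
      using M2 by (intro mult_left_mono) auto
    also have "\<dots> = \<delta> * M2 / 6 * (norm x)\<^sup>2"
      using c n0 by (simp add: power_mult_distrib)
    finally have 3: "real n * M2 / 6 * norm (c *\<^sub>R x) ^ 3 \<le> \<delta> * M2 / 6 * (norm x)\<^sup>2" .
    have 2: "(c *\<^sub>R x) \<bullet> (?H *v (c *\<^sub>R x)) = 1 / real n * (x \<bullet> (?H *v x))"
    proof -
      have "(c *\<^sub>R x) \<bullet> (?H *v (c *\<^sub>R x)) = c\<^sup>2 * (x \<bullet> (?H *v x))"
        by (simp add: matrix_vector_mult_scaleR power2_eq_square)
      then show ?thesis by (simp only: c(2))
    qed
    have "L \<theta>hat - x \<bullet> (Jp *v x) / 2 \<le> L ?\<theta>"
    proof -
      have "L \<theta>hat + 1 / real n * (x \<bullet> (?H *v x)) / 2 - real n * M2 / 6 * norm (c *\<^sub>R x) ^ 3 \<le> L ?\<theta>"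
        using taylor_lower_bound[OF \<theta> crit] unfolding add_diff_cancel_left' 2 .
      moreover have "x \<bullet> (Jp *v x) / 2 = - (1 / real n * (x \<bullet> (?H *v x)) / 2) + \<delta> * M2 / 6 * (norm x)\<^sup>2"
        unfolding quad by (simp add: field_simps)
      ultimately show ?thesis using 3 by linarith
    qed
    then have 4: "exp (L \<theta>hat) * ?g x \<le> exp (L ?\<theta>)" by (simp add: exp_add[symmetric])
    have "0 \<le> \<pi> ?\<theta>" using prior by (simp add: prob_density_def)
    then have "0 < \<pi> ?\<theta>" "1 / \<pi> ?\<theta> \<le> M1" using prior_lb[OF \<theta>] by auto
    then have 5: "1 / M1 \<le> \<pi> ?\<theta>" using M1 by (simp add: field_simps)
    have "a * ?g x = (exp (L \<theta>hat) * ?g x) * (1 / M1) / z" by (simp add: a_def)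
    also have "\<dots> \<le> exp (L ?\<theta>) * \<pi> ?\<theta> / z"
      using 4 5 z M1 by (intro divide_right_mono mult_mono) auto
    finally show ?thesis by (simp add: posterior_def)
  qed
  have post0: "0 \<le> posterior L \<pi> z x" for x using posterior by (simp add: prob_density_def)
  have [measurable]: "posterior L \<pi> z \<in> borel_measurable borel" "\<pi> \<in> borel_measurable borel"
    using posterior prior by (auto simp: prob_density_def)
  have total: "(\<integral>\<^sup>+x. ennreal (f x) \<partial>lborel) = 1" if f: "prob_density f" for f :: "real^'d \<Rightarrow> real"
  proof -
    have [measurable]: "f \<in> borel_measurable borel" using f by (simp add: prob_density_def)
    interpret prob_space "density lborel (\<lambda>x. ennreal (f x))" using f by (simp add: prob_density_def)
    show ?thesis using emeasure_space_1 by (simp add: emeasure_density)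
  qed
  let ?B = "cball 0 (\<delta> * sqrt (real n)) :: (real^'d) set"
  have intB: "integrable lborel (\<lambda>x. indicator ?B x * ?g x)"
    using integrable_mult_indicator[OF _ integrable_gaussian[OF sym pos], of ?B] by simp
  \<comment> \<open>The Gaussian lower bound on the rescaled ball against the total posterior mass 1.\<close>
  have "ennreal (c ^ CARD('d) * (a * ((1 - ?D) * ?m))) \<le> ennreal (c ^ CARD('d) * (a * (\<integral>x. indicator ?B x * ?g x \<partial>lborel)))"
    using gaussian_ball_mass_ge[OF sym pos r] a c unfolding gauss_tail_def
    by (intro ennreal_leI mult_left_mono) auto
  also have "\<dots> = ennreal (c ^ CARD('d)) * (\<integral>\<^sup>+x. ennreal (a * (indicator ?B x * ?g x)) \<partial>lborel)"
    using a c intB by (subst nn_integral_eq_integral) (auto simp: ennreal_mult')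
  also have "\<dots> \<le> ennreal (c ^ CARD('d)) * (\<integral>\<^sup>+x. ennreal (posterior L \<pi> z (\<theta>hat + c *\<^sub>R x)) \<partial>lborel)"
  proof (intro mult_left_mono nn_integral_mono ennreal_leI)
    fix x
    show "a * (indicator ?B x * ?g x) \<le> posterior L \<pi> z (\<theta>hat + c *\<^sub>R x)"
      using post_lb[of x] post0 by (cases "x \<in> ?B") auto
  qed simp
  also have "\<dots> = 1"
    using nn_integral_lborel_affine[of "\<lambda>x. ennreal (posterior L \<pi> z x)" c \<theta>hat] c total[OF posterior] by simp
  finally have "c ^ CARD('d) * (a * ((1 - ?D) * ?m)) \<le> 1" by simp
  then have ub: "exp (L \<theta>hat) / z \<le> M1 / ((1 - ?D) * ?m) * (1 / c) ^ CARD('d)"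
    using a c D1 m M1 z by (simp add: a_def field_simps power_divide)
  have "(\<integral>\<^sup>+\<theta>. indicator S \<theta> * ennreal (posterior L \<pi> z \<theta>) \<partial>lborel)
     \<le> (\<integral>\<^sup>+\<theta>. ennreal (exp (L \<theta>hat) / z * exp (- real n * \<kappa>)) * ennreal (\<pi> \<theta>) \<partial>lborel)"
  proof (rule nn_integral_mono)
    fix \<theta>
    have p0: "0 \<le> \<pi> \<theta>" using prior by (simp add: prob_density_def)
    show "indicator S \<theta> * ennreal (posterior L \<pi> z \<theta>) \<le> ennreal (exp (L \<theta>hat) / z * exp (- real n * \<kappa>)) * ennreal (\<pi> \<theta>)"
    proof (cases "\<theta> \<in> S")
      case True
      have "exp (L \<theta>) \<le> exp (L \<theta>hat) * exp (- real n * \<kappa>)" using far[OF True] by (simp add: exp_add[symmetric])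
      then have "exp (L \<theta>) * \<pi> \<theta> / z \<le> (exp (L \<theta>hat) * exp (- real n * \<kappa>)) * \<pi> \<theta> / z"
        using p0 z by (intro divide_right_mono mult_right_mono) auto
      then show ?thesis using True p0 z by (simp add: posterior_def ennreal_mult[symmetric] ennreal_leI)
    qed simp
  qed
  also have "\<dots> = ennreal (exp (L \<theta>hat) / z * exp (- real n * \<kappa>))"
    by (simp add: nn_integral_cmult total[OF prior])
  also have "\<dots> \<le> ennreal (M1 / ((1 - ?D) * ?m) * (1 / c) ^ CARD('d) * exp (- real n * \<kappa>))"
    using ub by (intro ennreal_leI mult_right_mono) auto
  also have "(1 / c) ^ CARD('d) = real n powr (real CARD('d) / 2)"
    using n0 by (simp add: c_def powr_half_sqrt[symmetric] powr_power)
  also have "M1 / ((1 - ?D) * ?m) = \<bar>det Jp\<bar> powr (1 / 2) * M1 / ((2 * pi) powr (real CARD('d) / 2) * (1 - ?D))"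
  proof -
    have pp: "0 < 2 * pi" by simp
    have "(2 * pi) powr (real CARD('d) / 2) = ((2 * pi) powr real CARD('d)) powr (1 / 2)"
      by (simp only: powr_powr times_divide_eq_right mult_1_right)
    also have "\<dots> = sqrt ((2 * pi) ^ CARD('d))"
      unfolding powr_realpow[OF pp] by (rule powr_half_sqrt) simp
    finally have "sqrt ((2 * pi) ^ CARD('d)) = (2 * pi) powr (real CARD('d) / 2)" ..
    then show ?thesis using m(2) by (simp add: gaussian_mass_def real_sqrt_divide powr_half_sqrt mult.commute)
  qed
  finally show "(\<integral>\<^sup>+\<theta>. indicator S \<theta> * ennreal (posterior L \<pi> z \<theta>) \<partial>lborel)
    \<le> ennreal (\<bar>det Jp\<bar> powr (1 / 2) * M1 / ((2 * pi) powr (real CARD('d) / 2) * (1 - ?D))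
        * real n powr (real CARD('d) / 2) * exp (- real n * \<kappa>))" .
qed

section \<open>The total variation bound\<close>

lemma measure_density_lborel:
  fixes f :: "'a::euclidean_space \<Rightarrow> real"
  assumes "integrable lborel f" "\<And>x. 0 \<le> f x" and A[measurable]: "A \<in> sets borel"
  shows "measure (density lborel (\<lambda>x. ennreal (f x))) A = (\<integral>x. indicator A x * f x \<partial>lborel)"
proof -
  have [measurable]: "f \<in> borel_measurable borel" using assms(1) by (simp add: integrable_iff_bounded)
  have "emeasure (density lborel (\<lambda>x. ennreal (f x))) A = (\<integral>\<^sup>+x. ennreal (indicator A x * f x) \<partial>lborel)"
    by (subst emeasure_density) (auto intro!: nn_integral_cong simp: indicator_def)
  also have "\<dots> = ennreal (\<integral>x. indicator A x * f x \<partial>lborel)"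
    using integrable_mult_indicator[of A lborel f] assms by (intro nn_integral_eq_integral) auto
  finally show ?thesis using assms(2) by (simp add: measure_def)
qed

lemma continuous_on_compact_bounded:
  fixes F :: "'a::metric_space \<Rightarrow> real"
  assumes "compact B" "continuous_on B F"
  shows "\<exists>K. \<forall>x\<in>B. \<bar>F x\<bar> \<le> K"
  using compact_imp_bounded[OF compact_continuous_image[OF assms(2,1)]] unfolding bounded_iff by auto

theorem theorem17:
  fixes n :: nat
    and L \<pi> Lbar :: "real^'d::finite \<Rightarrow> real"
    and z \<delta> M2 M1_hat \<delta>bar M2_bar \<kappa>bar :: real
    and \<theta>hat \<theta>bar :: "real^'d"
    and P :: "'w measure"
    and \<theta>tilde :: "'w \<Rightarrow> real^'d"
    and Jbar Jp :: "real^'d^'d"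
    and lam_bar Dbar Dp A1 A2 :: real
  assumes n: "n \<ge> 1"
    and prior: "prob_density \<pi>"
    and z: "z > 0"
    and posterior: "prob_density (posterior L \<pi> z)"
    and P: "prob_space P"
    and \<theta>tilde: "distributed P lborel \<theta>tilde (\<lambda>\<theta>. ennreal (posterior L \<pi> z \<theta>))"
    and Lbar: "Lbar = (\<lambda>\<theta>. ln (posterior L \<pi> z \<theta>))"
    and Jbar: "Jbar = observed_information n Lbar \<theta>bar"
    and lam_bar: "lam_bar = min_eigenvalue Jbar"
    and Jp: "Jp = observed_information n L \<theta>hat + (\<delta> * M2 / 3) *\<^sub>R mat 1"
    and Dbar: "Dbar = gauss_tail n \<delta>bar Jbar"
    and Dp: "Dp = gauss_tail n \<delta> Jp"
    and A1: "A1 = sqrt 3 * trace (matrix_inv Jbar) * M2_bar /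
               (4 * sqrt ((lam_bar - \<delta>bar * M2_bar) * (1 - Dbar)))"
    and A2: "A2 = 2 * \<bar>det Jp\<bar> powr (1 / 2) * M1_hat /
               ((2 * pi) powr (real CARD('d) / 2) * (1 - Dp))"
    and assm1: "is_unique_arg_max L \<theta>hat" "\<delta> > 0" "M2 > 0"
      "\<forall>\<theta>\<in>cball \<theta>hat \<delta>. thrice_differentiable_at L \<theta> \<and> norm_third_deriv L \<theta> / real n \<le> M2"
    and assm2: "M1_hat > 0"
      "\<forall>\<theta>\<in>cball \<theta>hat \<delta>. \<pi> \<theta> \<noteq> 0 \<and> \<bar>1 / \<pi> \<theta>\<bar> \<le> M1_hat"
    and assm3: "is_unique_arg_max (\<lambda>\<theta>. log_ext (posterior L \<pi> z \<theta>)) \<theta>bar" "\<delta>bar > 0" "M2_bar > 0"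
      "\<forall>\<theta>\<in>cball \<theta>bar \<delta>bar. (\<forall>\<^sub>F \<theta>' in nhds \<theta>. \<pi> \<theta>' > 0) \<and>
         thrice_differentiable_at (\<lambda>\<theta>. ln (\<pi> \<theta>)) \<theta> \<and>
         thrice_differentiable_at Lbar \<theta> \<and> norm_third_deriv Lbar \<theta> / real n \<le> M2_bar"
    and assm4: "max (norm (\<theta>hat - \<theta>bar)) (sqrt (trace (matrix_inv Jbar) / real n)) < \<delta>bar"
      "sqrt (trace (matrix_inv Jp) / real n) < \<delta>"
    and assm5: "lam_bar > \<delta>bar * M2_bar"
    and assm6: "\<kappa>bar > 0"
      "\<forall>\<theta>. norm (\<theta> - \<theta>hat) > \<delta>bar - norm (\<theta>hat - \<theta>bar) \<longrightarrow>
         (L \<theta> - L \<theta>hat) / real n \<le> - \<kappa>bar"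
  shows "total_variation
           (distr P borel (\<lambda>\<omega>. sqrt (real n) *\<^sub>R (\<theta>tilde \<omega> - \<theta>bar)))
           (multivariate_normal 0 (matrix_inv Jbar))
         \<le> A1 * real n powr (- 1 / 2) + 2 * Dbar
           + A2 * real n powr (real CARD('d) / 2) * exp (- real n * \<kappa>bar)"
proof -
  have n0: "0 < real n" using n by simp
  define s where "s = sqrt (real n)"
  have s: "0 < s" "s\<^sup>2 = real n" using n0 by (auto simp: s_def)
  define c where "c = 1 / s"
  have c: "0 < c" "c\<^sup>2 = 1 / real n" "s * c = 1" using s n0 by (auto simp: c_def power_divide)
  let ?d = "CARD('d)"
  let ?post = "posterior L \<pi> z"
  have post[measurable]: "?post \<in> borel_measurable borel" and post0: "\<And>x. 0 \<le> ?post x"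
    using posterior by (auto simp: prob_density_def)
  have Lbar_meas[measurable]: "Lbar \<in> borel_measurable borel" unfolding Lbar by measurable
  interpret b: bounded_third_derivative Lbar \<theta>bar \<delta>bar "real n * M2_bar"
  proof
    show "norm_third_deriv Lbar x \<le> real n * M2_bar" if "x \<in> cball \<theta>bar \<delta>bar" for x
      using assm3(4) that n0 by (auto simp: pos_divide_le_eq mult.commute simp del: mem_cball)
  qed (use assm3 in \<open>auto simp del: mem_cball\<close>)
  let ?H = "hessian Lbar \<theta>bar"
  have quad: "x \<bullet> (Jbar *v y) = - (1 / real n) * (x \<bullet> (?H *v y))" for x y
    unfolding Jbar observed_information_def using scaleR_matrix_vector_assoc[of "- (1 / real n)" ?H y, symmetric] by simp
  have sym: "transpose Jbar = Jbar"
    using b.hessian_center_symmetric unfolding Jbar observed_information_def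
    by (simp add: vec_eq_iff transpose_def)
  define lam where "lam = lam_bar - \<delta>bar * M2_bar"
  have lam: "0 < lam" using assm5 by (simp add: lam_def)
  have "0 < \<delta>bar * M2_bar" using assm3(2,3) by simp
  then have pos: "0 < min_eigenvalue Jbar" using assm5 unfolding lam_bar by linarith
  let ?T = "trace (matrix_inv Jbar)"
  have T0: "0 \<le> ?T" by (rule trace_inverse_nonneg[OF sym pos])
  have r: "sqrt ?T < \<delta>bar * s"
    using assm4(1) s n0 by (simp add: real_sqrt_divide s_def[symmetric] pos_divide_less_eq)
  have D: "0 \<le> Dbar" "Dbar < 1"
    using gauss_tail_less_1[OF r[unfolded s_def] pos] by (auto simp: Dbar gauss_tail_def)
  let ?m = "gaussian_mass Jbar"
  have m: "0 < ?m" by (rule gaussian_mass_pos[OF sym pos])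
  have post_pos: "0 < ?post x" if "x \<in> cball \<theta>bar \<delta>bar" for x
  proof -
    have "0 < \<pi> x" using assm3(4) that eventually_nhds_x_imp_x by blast
    then show ?thesis using z by (simp add: posterior_def)
  qed
  have crit: "dir_deriv Lbar \<theta>bar w = 0" for w
  proof (rule b.dir_deriv_eq_0_at_local_max)
    have "eventually (\<lambda>y. 0 < \<pi> y) (nhds \<theta>bar)" using assm3(4) b.center_in_ball by blast
    then show "eventually (\<lambda>y. Lbar y \<le> Lbar \<theta>bar) (nhds \<theta>bar)"
    proof (rule eventually_mono)
      fix y assume "0 < \<pi> y"
      then have y: "0 < ?post y" using z by (simp add: posterior_def)
      have "\<not> log_ext (?post \<theta>bar) < log_ext (?post y)"
        using assm3(1) unfolding is_unique_arg_max_def is_arg_max_def by blast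
      then show "Lbar y \<le> Lbar \<theta>bar"
        using y post_pos[OF b.center_in_ball] by (simp add: log_ext_def Lbar not_less)
    qed
  qed

  \<comment> \<open>In rescaled coordinates the posterior density is proportional to \<open>exp (- V)\<close> on the ball, and \<open>h\<close> is, up to a constant, the log-ratio of the Gaussian to the posterior.\<close>
  let ?B = "cball 0 (\<delta>bar * s) :: (real^'d) set"
  define V where "V x = - Lbar (\<theta>bar + c *\<^sub>R x)" for x
  define h where "h x = V x - (x \<bullet> (Jbar *v x)) / 2" for x
  define G where "G x = M2_bar / (2 * s) * (norm x)\<^sup>2" for x :: "real^'d"
  define g where "g x = gauss Jbar x" for x
  have [measurable]: "V \<in> borel_measurable borel" "h \<in> borel_measurable borel" "G \<in> borel_measurable borel"
    unfolding V_def[abs_def] h_def[abs_def] G_def[abs_def] by measurable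
  have g: "exp (h x - V x) = g x" for x by (simp add: h_def g_def)
  have inB: "\<theta>bar + c *\<^sub>R x \<in> cball \<theta>bar \<delta>bar \<longleftrightarrow> x \<in> ?B" for x
    using s by (simp add: dist_norm c_def pos_divide_le_eq)
  have Bpos: "0 < measure lborel ?B" using assm3(2) s by (simp add: content_cball_pos)
  obtain K where K: "\<And>x. x \<in> ?B \<Longrightarrow> \<bar>V x\<bar> \<le> K" "\<And>x. x \<in> ?B \<Longrightarrow> \<bar>h x\<bar> \<le> K" "\<And>x. x \<in> ?B \<Longrightarrow> \<bar>G x\<bar> \<le> K"
  proof -
    have cL: "continuous_on (cball \<theta>bar \<delta>bar) Lbar"
      by (rule continuous_at_imp_continuous_on) (auto intro: differentiable_imp_continuous_within b.differentiable simp del: mem_cball)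
    have "continuous_on ?B (\<lambda>x. Lbar (\<theta>bar + c *\<^sub>R x))"
    proof (rule continuous_on_compose2[OF cL])
      show "continuous_on ?B (\<lambda>x. \<theta>bar + c *\<^sub>R x)" by (intro continuous_intros)
    qed (use inB in blast)
    then have cV: "continuous_on ?B V" unfolding V_def by (rule continuous_on_minus)
    have "continuous_on ?B (\<lambda>x. x \<bullet> (Jbar *v x))"
      by (rule continuous_on_inner[OF continuous_on_id linear_continuous_on[OF matrix_vector_mul_bounded_linear]])
    then have ch: "continuous_on ?B h"
      unfolding h_def by (intro continuous_on_diff cV continuous_on_divide continuous_on_const) simp_all
    have cG: "continuous_on ?B G" unfolding G_def by (intro continuous_intros)
    obtain K1 where K1: "\<And>x. x \<in> ?B \<Longrightarrow> \<bar>V x\<bar> \<le> K1" using continuous_on_compact_bounded[OF compact_cball cV] by blast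
    obtain K2 where K2: "\<And>x. x \<in> ?B \<Longrightarrow> \<bar>h x\<bar> \<le> K2" using continuous_on_compact_bounded[OF compact_cball ch] by blast
    obtain K3 where K3: "\<And>x. x \<in> ?B \<Longrightarrow> \<bar>G x\<bar> \<le> K3" using continuous_on_compact_bounded[OF compact_cball cG] by blast
    show thesis
    proof (rule that[of "max K1 (max K2 K3)"])
      fix x assume "x \<in> ?B"
      from K1[OF this] K2[OF this] K3[OF this]
      show "\<bar>V x\<bar> \<le> max K1 (max K2 K3)" "\<bar>h x\<bar> \<le> max K1 (max K2 K3)" "\<bar>G x\<bar> \<le> max K1 (max K2 K3)" by linarith+
    qed
  qed
  have V_convex: "V ((1 - t) *\<^sub>R x + t *\<^sub>R y) \<le> (1 - t) * V x + t * V y - lam * t * (1 - t) / 2 * (norm (x - y))\<^sup>2"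
    if x: "x \<in> ?B" and y: "y \<in> ?B" and t: "0 < t" "t < 1" for x y t
  proof -
    let ?x = "\<theta>bar + c *\<^sub>R x" and ?y = "\<theta>bar + c *\<^sub>R y"
    have hess: "v \<bullet> (hessian Lbar \<theta> *v v) \<le> - (real n * lam) * (norm v)\<^sup>2" if \<theta>: "\<theta> \<in> cball \<theta>bar \<delta>bar" for \<theta> v
    proof -
      have "v \<bullet> (hessian Lbar \<theta> *v v) \<le> v \<bullet> (?H *v v) + real n * M2_bar * norm (\<theta> - \<theta>bar) * norm v * norm v"
        using b.hessian_lipschitz[OF \<theta>, of v v] by linarith
      also have "real n * M2_bar * norm (\<theta> - \<theta>bar) * norm v * norm v \<le> real n * M2_bar * \<delta>bar * norm v * norm v"
        using \<theta> assm3(3) by (intro mult_right_mono mult_left_mono) (auto simp: dist_norm norm_minus_commute)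
      also have "v \<bullet> (?H *v v) = - real n * (v \<bullet> (Jbar *v v))" using n0 by (simp add: quad)
      also have "\<dots> \<le> - real n * (lam_bar * (norm v)\<^sup>2)"
        using min_eigenvalue_le_quadratic_form[OF sym, of v] n0 unfolding lam_bar by simp
      finally show ?thesis by (simp add: lam_def power2_eq_square algebra_simps)
    qed
    have "(1 - t) * Lbar ?x + t * Lbar ?y + real n * lam * t * (1 - t) / 2 * (norm (?x - ?y))\<^sup>2 \<le> Lbar ((1 - t) *\<^sub>R ?x + t *\<^sub>R ?y)"
      using t x y inB by (intro b.strongly_concave hess) auto
    moreover have "(1 - t) *\<^sub>R ?x + t *\<^sub>R ?y = \<theta>bar + c *\<^sub>R ((1 - t) *\<^sub>R x + t *\<^sub>R y)"
      by (simp add: algebra_simps)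
    moreover have "(norm (?x - ?y))\<^sup>2 = (norm (x - y))\<^sup>2 / real n"
      using c(1) by (simp add: scaleR_diff_right[symmetric] power_mult_distrib c(2))
    ultimately show ?thesis using n0 by (simp add: V_def algebra_simps)
  qed
  have h_growth: "h x \<le> h y + norm (x - y) * G y + (M2_bar * \<delta>bar / 2) * (norm (x - y))\<^sup>2"
    if x: "x \<in> ?B" and y: "y \<in> ?B" for x y
  proof -
    have hD: "h x = ((\<theta>bar + c *\<^sub>R x) - \<theta>bar) \<bullet> (?H *v ((\<theta>bar + c *\<^sub>R x) - \<theta>bar)) / 2 - Lbar (\<theta>bar + c *\<^sub>R x)" for x
    proof -
      have "(c *\<^sub>R x) \<bullet> (?H *v (c *\<^sub>R x)) = c\<^sup>2 * (x \<bullet> (?H *v x))"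
        by (simp add: matrix_vector_mult_scaleR power2_eq_square)
      then have "(c *\<^sub>R x) \<bullet> (?H *v (c *\<^sub>R x)) = - (x \<bullet> (Jbar *v x))" unfolding quad c(2) by simp
      then show ?thesis unfolding add_diff_cancel_left' h_def V_def by simp
    qed
    have nd: "norm ((\<theta>bar + c *\<^sub>R x) - (\<theta>bar + c *\<^sub>R y)) = c * norm (x - y)"
      using c(1) by (simp add: scaleR_diff_right[symmetric])
    have ny: "norm ((\<theta>bar + c *\<^sub>R y) - \<theta>bar) = c * norm y" using c(1) by simp
    have "h x \<le> h y + c * norm (x - y) * (real n * M2_bar / 2 * (c * norm y)\<^sup>2) + real n * M2_bar * \<delta>bar / 2 * (c * norm (x - y))\<^sup>2"
      unfolding hD nd[symmetric] ny[symmetric] using x y inB by (intro b.taylor_remainder_growth crit) auto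
    also have "c * norm (x - y) * (real n * M2_bar / 2 * (c * norm y)\<^sup>2) = norm (x - y) * G y"
      using n0 by (simp add: power_mult_distrib c(2) G_def) (simp add: c_def)
    also have "real n * M2_bar * \<delta>bar / 2 * (c * norm (x - y))\<^sup>2 = (M2_bar * \<delta>bar / 2) * (norm (x - y))\<^sup>2"
      using n0 by (simp add: power_mult_distrib c(2))
    finally show ?thesis .
  qed

  define Z0 where "Z0 = (\<integral>x. indicator ?B x * exp (- V x) \<partial>lborel)"
  define Z1 where "Z1 = (\<integral>x. indicator ?B x * exp (h x - V x) \<partial>lborel)"
  \<comment> \<open>The quotients are the conditional probabilities of \<open>A\<close> given the ball, for the Gaussian and for the posterior.\<close>
  have cond: "\<bar>(\<integral>x. indicator A x * (indicator ?B x * exp (h x - V x)) \<partial>lborel) / Z1 - (\<integral>x. indicator A x * (indicator ?B x * exp (- V x)) \<partial>lborel) / Z0\<bar>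
    \<le> sqrt ((\<integral>x. (G x)\<^sup>2 * (indicator ?B x * exp (h x - V x)) \<partial>lborel) / (4 * lam * Z1))"
    if "A \<in> sets borel" for A
    by (rule tv_le_of_strongly_log_concave[where K=K and C="M2_bar * \<delta>bar / 2"])
      (use Bpos K lam assm3(2,3) V_convex h_growth that in \<open>auto simp: Z0_def Z1_def simp del: mem_cball\<close>)

  have Z1_ge: "(1 - Dbar) * ?m \<le> Z1"
    using gaussian_ball_mass_ge[OF sym pos r] unfolding Z1_def g g_def Dbar gauss_tail_def s_def by simp
  have Z1_pos: "0 < Z1" using Z1_ge D m by (meson less_le_trans diff_gt_0_iff_gt mult_pos_pos)

  let ?F = "(\<integral>x. (G x)\<^sup>2 * (indicator ?B x * exp (h x - V x)) \<partial>lborel)"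
  \<comment> \<open>The bound extends the integral to the whole space and uses that \<open>Z1\<close> is at least \<open>1 - Dbar\<close> times the full Gaussian mass.\<close>
  have fisher: "sqrt (?F / (4 * lam * Z1)) \<le> A1 * real n powr (- 1 / 2)"
  proof -
    have G2: "(G x)\<^sup>2 = M2_bar\<^sup>2 / (4 * real n) * norm x ^ 4" for x
      by (simp add: G_def power_mult_distrib power_divide s(2))
    note n4 = gaussian_norm4_integral_le[OF sym pos, folded g_def]
    have "?F \<le> (\<integral>x. M2_bar\<^sup>2 / (4 * real n) * (norm x ^ 4 * g x) \<partial>lborel)"
      unfolding G2 g
    proof (rule integral_mono)
      have "integrable lborel (\<lambda>x. M2_bar\<^sup>2 / (4 * real n) * (indicator ?B x * (norm x ^ 4 * g x)))"
        using integrable_mult_indicator[OF _ n4(1), of ?B] by (intro integrable_mult_right) simp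
      then show "integrable lborel (\<lambda>x. M2_bar\<^sup>2 / (4 * real n) * norm x ^ 4 * (indicator ?B x * g x))"
        by (simp only: mult_ac)
      show "M2_bar\<^sup>2 / (4 * real n) * norm x ^ 4 * (indicator ?B x * g x) \<le> M2_bar\<^sup>2 / (4 * real n) * (norm x ^ 4 * g x)" for x
        by (simp add: indicator_def g_def)
    qed (intro integrable_mult_right n4(1))
    also have "\<dots> = M2_bar\<^sup>2 / (4 * real n) * (\<integral>x. norm x ^ 4 * g x \<partial>lborel)" by simp
    also have "\<dots> \<le> M2_bar\<^sup>2 / (4 * real n) * (3 * ?T\<^sup>2 * ?m)"
      by (intro mult_left_mono n4(2)) simp
    finally have "?F / (4 * lam * Z1)
      \<le> M2_bar\<^sup>2 / (4 * real n) * (3 * ?T\<^sup>2 * ?m) / (4 * lam * ((1 - Dbar) * ?m))"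
      using Z1_ge Z1_pos lam D m by (intro frac_le) (auto intro!: mult_pos_pos)
    also have "\<dots> = 3 * (?T * M2_bar / (4 * s))\<^sup>2 / (lam * (1 - Dbar))"
    proof -
      have eq: "a / (4 * k) * (3 * b * \<mu>) / (4 * l * (e * \<mu>)) = 3 * (b * a / (16 * k)) / (l * e)"
        if "\<mu> \<noteq> 0" "k \<noteq> 0" "l \<noteq> 0" "e \<noteq> 0" for a b e k l \<mu> :: real
        using that by (simp add: field_simps)
      have sq: "(?T * M2_bar / (4 * s))\<^sup>2 = ?T\<^sup>2 * M2_bar\<^sup>2 / (16 * real n)"
        using s by (simp add: power_mult_distrib power_divide)
      show ?thesis unfolding sq by (rule eq) (use m n0 lam D in auto)
    qed
    finally have "sqrt (?F / (4 * lam * Z1))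
      \<le> sqrt (3 * (?T * M2_bar / (4 * s))\<^sup>2 / (lam * (1 - Dbar)))" by (rule real_sqrt_le_mono)
    also have "\<dots> = sqrt 3 * (?T * M2_bar / (4 * s)) / sqrt (lam * (1 - Dbar))"
      using T0 assm3(3) s by (simp add: real_sqrt_mult real_sqrt_divide)
    also have "\<dots> = A1 * (1 / s)" unfolding A1 lam_def[symmetric] by (simp add: mult_ac)
    also have "1 / s = real n powr (- 1 / 2)"
      using n0 by (simp add: s_def powr_minus_divide powr_half_sqrt)
    finally show ?thesis .
  qed

  let ?\<rho> = "distr P borel (\<lambda>\<omega>. s *\<^sub>R (\<theta>tilde \<omega> - \<theta>bar))"
  define p where "p x = c ^ ?d * ?post (\<theta>bar + c *\<^sub>R x)" for x
  have [measurable]: "p \<in> borel_measurable borel" unfolding p_def[abs_def] by measurable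
  have p0: "0 \<le> p x" for x using c post0 by (simp add: p_def)
  have p_subst: "(\<integral>\<^sup>+x. ennreal (p x) * indicator A x \<partial>lborel) = (\<integral>\<^sup>+\<theta>. ennreal (?post \<theta>) * indicator A (s *\<^sub>R (\<theta> - \<theta>bar)) \<partial>lborel)"
    if [measurable]: "A \<in> sets borel" for A
  proof -
    have "(\<integral>\<^sup>+\<theta>. ennreal (?post \<theta>) * indicator A (s *\<^sub>R (\<theta> - \<theta>bar)) \<partial>lborel)
      = ennreal (c ^ ?d) * (\<integral>\<^sup>+x. ennreal (?post (\<theta>bar + c *\<^sub>R x)) * indicator A (s *\<^sub>R ((\<theta>bar + c *\<^sub>R x) - \<theta>bar)) \<partial>lborel)"
      by (rule nn_integral_lborel_affine[OF _ c(1)]) measurable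
    also have "\<dots> = (\<integral>\<^sup>+x. ennreal (c ^ ?d) * (ennreal (?post (\<theta>bar + c *\<^sub>R x)) * indicator A (s *\<^sub>R ((\<theta>bar + c *\<^sub>R x) - \<theta>bar))) \<partial>lborel)"
      by (rule nn_integral_cmult[symmetric]) measurable
    also have "\<dots> = (\<integral>\<^sup>+x. ennreal (p x) * indicator A x \<partial>lborel)"
      using c post0 by (intro nn_integral_cong) (simp add: p_def ennreal_mult mult.assoc)
    finally show ?thesis ..
  qed
  have \<theta>m[measurable]: "\<theta>tilde \<in> P \<rightarrow>\<^sub>M borel" and \<theta>d: "distr P lborel \<theta>tilde = density lborel (\<lambda>\<theta>. ennreal (?post \<theta>))"
    using \<theta>tilde by (auto simp: distributed_def)
  have \<rho>: "?\<rho> = density lborel (\<lambda>x. ennreal (p x))"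
  proof (rule measure_eqI)
    fix A assume "A \<in> sets ?\<rho>"
    then have A[measurable]: "A \<in> sets borel" by simp
    have "?\<rho> = distr (distr P lborel \<theta>tilde) borel (\<lambda>\<theta>. s *\<^sub>R (\<theta> - \<theta>bar))"
      by (subst distr_distr) (auto simp: comp_def)
    then have "emeasure ?\<rho> A = emeasure (density lborel (\<lambda>\<theta>. ennreal (?post \<theta>))) ((\<lambda>\<theta>. s *\<^sub>R (\<theta> - \<theta>bar)) -` A)"
      unfolding \<theta>d by (simp add: emeasure_distr)
    also have "\<dots> = (\<integral>\<^sup>+\<theta>. ennreal (?post \<theta>) * indicator ((\<lambda>\<theta>. s *\<^sub>R (\<theta> - \<theta>bar)) -` A) \<theta> \<partial>lborel)"
      by (rule emeasure_density) (auto intro!: measurable_sets_borel[OF _ A])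
    also have "\<dots> = (\<integral>\<^sup>+x. ennreal (p x) * indicator A x \<partial>lborel)"
      unfolding p_subst[OF A] by (simp add: indicator_def)
    also have "\<dots> = emeasure (density lborel (\<lambda>x. ennreal (p x))) A" by (simp add: emeasure_density)
    finally show "emeasure ?\<rho> A = emeasure (density lborel (\<lambda>x. ennreal (p x))) A" .
  qed simp
  interpret P: prob_space P by (rule P)
  interpret \<rho>: prob_space ?\<rho> by (rule P.prob_space_distr) measurable
  have intp: "integrable lborel p"
  proof (rule integrableI_bounded)
    have "(\<integral>\<^sup>+x. ennreal (norm (p x)) \<partial>lborel) = emeasure ?\<rho> (space ?\<rho>)"
      unfolding \<rho> using p0 by (simp add: emeasure_density)
    then show "(\<integral>\<^sup>+x. ennreal (norm (p x)) \<partial>lborel) < \<infinity>" by (simp only: \<rho>.emeasure_space_1) simp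
  qed measurable

  let ?N = "multivariate_normal 0 (matrix_inv Jbar)"
  have N: "?N = density lborel (\<lambda>x. ennreal (g x / ?m))"
    unfolding g_def by (rule multivariate_normal_eq_gaussian[OF sym pos])
  have intg: "integrable lborel (\<lambda>x. g x / ?m)"
    using integrable_gaussian[OF sym pos] unfolding g_def by simp
  have [measurable]: "g \<in> borel_measurable borel" unfolding g_def[abs_def] by measurable
  interpret N: prob_space ?N
  proof
    have "emeasure ?N (space ?N) = (\<integral>\<^sup>+x. ennreal (g x / ?m) \<partial>lborel)" unfolding N by (simp add: emeasure_density)
    also have "\<dots> = ennreal (\<integral>x. g x / ?m \<partial>lborel)" using m by (intro nn_integral_eq_integral intg) (simp add: g_def)
    also have "\<dots> = 1" using integral_gaussian[OF sym pos] m unfolding g_def by simp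
    finally show "emeasure ?N (space ?N) = 1" .
  qed
  have \<rho>A: "measure ?\<rho> A = (\<integral>x. indicator A x * p x \<partial>lborel)" if "A \<in> sets borel" for A
    unfolding \<rho> by (rule measure_density_lborel[OF intp p0 that])
  have NA: "measure ?N A = (\<integral>x. indicator A x * (g x / ?m) \<partial>lborel)" if "A \<in> sets borel" for A
    unfolding N using m by (intro measure_density_lborel[OF intg _ that]) (simp add: g_def)

  have \<rho>AB: "measure ?\<rho> (A \<inter> ?B) = c ^ ?d * (\<integral>x. indicator A x * (indicator ?B x * exp (- V x)) \<partial>lborel)" if "A \<in> sets borel" for A
  proof -
    have "indicator (A \<inter> ?B) x * p x = c ^ ?d * (indicator A x * (indicator ?B x * exp (- V x)))" for x
    proof (cases "x \<in> ?B")
      case True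
      then have "0 < ?post (\<theta>bar + c *\<^sub>R x)" using inB post_pos by blast
      then show ?thesis by (simp add: V_def Lbar p_def indicator_def)
    qed (simp add: indicator_def)
    then show ?thesis using that by (subst \<rho>A) auto
  qed
  have NAB: "measure ?N (A \<inter> ?B) = (\<integral>x. indicator A x * (indicator ?B x * exp (h x - V x)) \<partial>lborel) / ?m" if "A \<in> sets borel" for A
  proof -
    have "measure ?N (A \<inter> ?B) = (\<integral>x. indicator (A \<inter> ?B) x * (g x / ?m) \<partial>lborel)"
      using that by (intro NA) auto
    also have "\<dots> = (\<integral>x. (indicator A x * (indicator ?B x * exp (h x - V x))) / ?m \<partial>lborel)"
      unfolding g by (intro Bochner_Integration.integral_cong) (auto simp: indicator_def)
    finally show ?thesis by simp
  qed
  have \<rho>B: "measure ?\<rho> ?B = c ^ ?d * Z0" using \<rho>AB[of UNIV] by (simp add: Z0_def)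
  have NB: "measure ?N ?B = Z1 / ?m" using NAB[of UNIV] by (simp add: Z1_def)
  have Z0_pos: "0 < Z0"
  proof -
    have int: "integrable lborel (\<lambda>x. indicator ?B x * exp (- V x))"
    proof (rule integrableI_bounded_set[where A="?B" and B="exp K"])
      show "AE x in lborel. x \<in> ?B \<longrightarrow> norm (indicator ?B x * exp (- V x)) \<le> exp K"
      proof (intro AE_I2 impI)
        fix x assume x: "x \<in> ?B"
        then show "norm (indicator ?B x * exp (- V x)) \<le> exp K" using K(1)[OF x] by simp
      qed
      show "(\<lambda>x. indicator ?B x * exp (- V x)) \<in> borel_measurable lborel"
        by (intro borel_measurable_times borel_measurable_indicator) measurable
      show "emeasure lborel ?B < \<infinity>" by (rule emeasure_bounded_finite[OF bounded_cball])
    qed auto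
    have "0 < measure lborel ?B * exp (- K)" using Bpos by simp
    also have "\<dots> = (\<integral>x. indicator ?B x * exp (- K) \<partial>lborel)" by simp
    also have "\<dots> \<le> Z0" unfolding Z0_def
    proof (rule integral_mono)
      show "integrable lborel (\<lambda>x. indicator ?B x * exp (- K))"
        by (intro integrable_mult_left integrable_real_indicator emeasure_bounded_finite bounded_cball) simp
      show "indicator ?B x * exp (- K) \<le> indicator ?B x * exp (- V x)" for x
        using K(1)[of x] by (cases "x \<in> ?B") auto
    qed (rule int)
    finally show ?thesis .
  qed

  have \<rho>_tail: "1 - measure ?\<rho> ?B \<le> A2 / 2 * real n powr (real ?d / 2) * exp (- real n * \<kappa>bar)" and A2_nonneg: "0 \<le> A2"
  proof -
    let ?S = "{\<theta>. \<delta>bar < norm (\<theta> - \<theta>bar)}"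
    let ?bd = "A2 / 2 * real n powr (real ?d / 2) * exp (- real n * \<kappa>bar)"
    have max: "L \<theta> \<le> L \<theta>hat" for \<theta>
      using assm1(1) unfolding is_unique_arg_max_def is_arg_max_def by (auto simp: not_less)
    have compl: "1 - measure ?\<rho> ?B = measure ?\<rho> (- ?B)" using \<rho>.prob_compl[of ?B] by (simp add: Compl_eq_Diff_UNIV)
    have "ennreal (measure ?\<rho> (- ?B)) = (\<integral>\<^sup>+x. ennreal (p x) * indicator (- ?B) x \<partial>lborel)"
      unfolding \<rho>.emeasure_eq_measure[symmetric] unfolding \<rho> by (subst emeasure_density) auto
    also have "\<dots> = (\<integral>\<^sup>+\<theta>. indicator ?S \<theta> * ennreal (?post \<theta>) \<partial>lborel)"
      using s by (subst p_subst) (auto intro!: nn_integral_cong simp: indicator_def mult.commute[of \<delta>bar])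
    also have "\<dots> \<le> ennreal (\<bar>det Jp\<bar> powr (1 / 2) * M1_hat / ((2 * pi) powr (real ?d / 2) * (1 - gauss_tail n \<delta> Jp))
        * real n powr (real ?d / 2) * exp (- real n * \<kappa>bar))"
    proof (rule posterior_tail_le(2)[OF n prior z posterior Jp max assm1(2,3) _ assm2(1) _ assm4(2)])
      show "thrice_differentiable_at L \<theta> \<and> norm_third_deriv L \<theta> / real n \<le> M2" if "\<theta> \<in> cball \<theta>hat \<delta>" for \<theta> using assm1(4) that by blast
      show "\<pi> \<theta> \<noteq> 0 \<and> \<bar>1 / \<pi> \<theta>\<bar> \<le> M1_hat" if "\<theta> \<in> cball \<theta>hat \<delta>" for \<theta> using assm2(2) that by blast
      show "?S \<in> sets borel" by measurable
      show "L \<theta> \<le> L \<theta>hat - real n * \<kappa>bar" if "\<theta> \<in> ?S" for \<theta>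
      proof -
        have "norm (\<theta> - \<theta>bar) \<le> norm (\<theta> - \<theta>hat) + norm (\<theta>hat - \<theta>bar)" using norm_triangle_ineq[of "\<theta> - \<theta>hat" "\<theta>hat - \<theta>bar"] by simp
        then have "norm (\<theta> - \<theta>hat) > \<delta>bar - norm (\<theta>hat - \<theta>bar)" using that by simp
        then have "(L \<theta> - L \<theta>hat) / real n \<le> - \<kappa>bar" using assm6(2) by blast
        then show ?thesis using n0 by (simp add: pos_divide_le_eq algebra_simps)
      qed
    qed
    also have "\<bar>det Jp\<bar> powr (1 / 2) * M1_hat / ((2 * pi) powr (real ?d / 2) * (1 - gauss_tail n \<delta> Jp)) = A2 / 2"
      by (simp add: A2 Dp)
    finally have le: "ennreal (measure ?\<rho> (- ?B)) \<le> ennreal ?bd" .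
    have "Dp < 1"
      unfolding Dp
      by (rule posterior_tail_le(1)[OF n prior z posterior Jp max assm1(2,3) _ assm2(1) _ assm4(2), of "{}" \<kappa>bar])
        (use assm1(4) assm2(2) in \<open>auto simp del: mem_cball\<close>)
    then have "0 \<le> A2" using assm2(1) unfolding A2 by simp
    then have "0 \<le> ?bd" by simp
    with le have "measure ?\<rho> (- ?B) \<le> ?bd" by (subst (asm) ennreal_le_iff)
    then show "1 - measure ?\<rho> ?B \<le> ?bd" unfolding compl .
    show "0 \<le> A2" by fact
  qed
  have N_tail: "1 - measure ?N ?B \<le> Dbar"
    using Z1_ge m unfolding NB by (simp add: field_simps)

  have "total_variation ?\<rho> ?N \<le> A1 * real n powr (- 1 / 2) + (A2 / 2 * real n powr (real ?d / 2) * exp (- real n * \<kappa>bar)) + Dbar"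
    unfolding total_variation_def
  proof (rule cSUP_least)
    fix A assume "A \<in> sets ?\<rho>"
    then have A: "A \<in> sets borel" by simp
    have B: "?B \<in> sets borel" by simp
    have sN: "sets ?N = sets borel" unfolding N by simp
    have \<rho>split: "measure ?\<rho> A = measure ?\<rho> (A \<inter> ?B) + measure ?\<rho> (A - ?B)" "measure ?\<rho> (A - ?B) \<le> 1 - measure ?\<rho> ?B"
      using \<rho>.finite_measure_Union[of "A \<inter> ?B" "A - ?B"] \<rho>.finite_measure_mono[of "A - ?B" "UNIV - ?B"] \<rho>.prob_compl[of ?B] A B
      by (auto simp: Int_Diff_Un)
    have Nsplit: "measure ?N A = measure ?N (A \<inter> ?B) + measure ?N (A - ?B)" "measure ?N (A - ?B) \<le> 1 - measure ?N ?B"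
      using N.finite_measure_Union[of "A \<inter> ?B" "A - ?B"] N.finite_measure_mono[of "A - ?B" "space ?N - ?B"] N.prob_compl[of ?B] A B
      sets_eq_imp_space_eq[OF sN] by (auto simp: Int_Diff_Un sN)
    have "\<bar>measure ?\<rho> A - measure ?N A\<bar>
      \<le> \<bar>measure ?N (A \<inter> ?B) / measure ?N ?B - measure ?\<rho> (A \<inter> ?B) / measure ?\<rho> ?B\<bar> + (1 - measure ?\<rho> ?B) + (1 - measure ?N ?B)"
      unfolding \<rho>split(1) Nsplit(1)
    proof (rule abs_diff_le_conditional_diff)
      show "measure ?\<rho> (A \<inter> ?B) \<le> measure ?\<rho> ?B" using A B by (intro \<rho>.finite_measure_mono) auto
      show "measure ?N (A \<inter> ?B) \<le> measure ?N ?B" using A B by (intro N.finite_measure_mono) (auto simp: sN)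
      show "0 < measure ?\<rho> ?B" unfolding \<rho>B using c Z0_pos by simp
      show "0 < measure ?N ?B" unfolding NB using m Z1_pos by simp
    qed (use \<rho>split(2) Nsplit(2) in auto)
    also have "measure ?N (A \<inter> ?B) / measure ?N ?B = (\<integral>x. indicator A x * (indicator ?B x * exp (h x - V x)) \<partial>lborel) / Z1"
      unfolding NB NAB[OF A] using m by simp
    also have "measure ?\<rho> (A \<inter> ?B) / measure ?\<rho> ?B = (\<integral>x. indicator A x * (indicator ?B x * exp (- V x)) \<partial>lborel) / Z0"
      unfolding \<rho>B \<rho>AB[OF A] using c by simp
    finally show "\<bar>measure ?\<rho> A - measure ?N A\<bar> \<le> A1 * real n powr (- 1 / 2) + (A2 / 2 * real n powr (real ?d / 2) * exp (- real n * \<kappa>bar)) + Dbar"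
      using order_trans[OF cond[OF A] fisher] \<rho>_tail N_tail by linarith
  qed auto
  also have "\<dots> \<le> A1 * real n powr (- 1 / 2) + 2 * Dbar + A2 * real n powr (real ?d / 2) * exp (- real n * \<kappa>bar)"
  proof -
    have "0 \<le> A2 * real n powr (real ?d / 2) * exp (- real n * \<kappa>bar)" using A2_nonneg by simp
    moreover have "A2 / 2 * real n powr (real ?d / 2) * exp (- real n * \<kappa>bar) = A2 * real n powr (real ?d / 2) * exp (- real n * \<kappa>bar) / 2"
      by simp
    ultimately show ?thesis using D(1) by linarith
  qed
  finally show ?thesis unfolding s_def .
qed

end
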